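(* Let $0<q<1$. (1) For every $\rho\in\mathbb{R}$ with $-\sqrt{\frac{1-q}{1+q^{-1}}}<\rho<\sqrt{\frac{1-q}{1+q^{-1}}}$ we have, as $N\to\infty$, $$\mathbb{P}(X_0\ge 0,\dots,X_N\ge 0)=\lambda_\rho^{N+o(N)},$$ where $\lambda_\rho:=r(T_\rho)\in(0,1)$, the spectral radius of $T_\rho$ on $\mathcal{H}_q$, is the largest eigenvalue of $T_\rho$. There is a corresponding eigenfunction $f_\rho\in\mathcal{H}_q$ which is non-negative, i.e. $f_\rho(x)\ge 0$ for all $x\in\mathbb{R}$. (2) There are numbers $K_n\in\mathbb{R}$, $n\ge 0$, and $r_0>0.332$ such that the persistence exponent $\lambda_\rho$ admits the representation $$\lambda_\rho=\sum_{n=0}^\infty\rho^nK_n\qquad\text{for all } |\rho|<r_0 .$$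
   Context: Let $(\xi_i)_{i\ge -1}$ be i.i.d. standard normal random variables and, for $\rho\in\mathbb{R}$, let $X_n:=\rho\xi_{n-1}+\xi_n$, $n\in\mathbb{N}=\{0,1,2,\dots\}$ (the MA(1)-process with parameter $\rho$). The persistence exponent $\lambda_\rho$ is the exponential decay rate of $\mathbb{P}(X_0\ge0,\dots,X_N\ge0)$, i.e. the number $\lambda_\rho$ with $\mathbb{P}(X_0\ge0,\dots,X_N\ge0)=\lambda_\rho^{N+o(N)}$ as $N\to\infty$; it depends only on $\rho$ (not on $q$). $\phi(x)=(2\pi)^{-1/2}e^{-x^2/2}$. Let $h_n(x)=(-1)^n e^{x^2/2}\frac{d^n}{dx^n}e^{-x^2/2}$ be the $n$-th Hermite polynomial and $\hat h_n:=(n!)^{-1/2}h_n$. For $0<q<1$ let $$\mathcal{H}_q:=\Big\{f\colon\mathbb{R}\to\mathbb{C},\ f(x)=\sum_{n=0}^\infty a_n\hat h_n(x)\ \text{with } a_n\in\mathbb{C},\ \sum_{n=0}^\infty|a_n|^2q^{-n}<\infty\Big\},$$ a complex Hilbert space of analytic functions with inner product $\langle f,g\rangle_{\mathcal{H}_q}:=\sum_{n=0}^\infty a_n\overline{b_n}q^{-n}$ for $f=\sum a_n\hat h_n$, $g=\sum b_n\hat h_n$. For $|\rho|<\sqrt{\frac{1-q}{1+q^{-1}}}$ the operator $T_\rho\colon\mathcal{H}_q\to\mathcal{H}_q$, $T_\rho f(x):=\int_{-\rho x}^\infty f(y)\phi(y)\,dy$, is well-defined, bounded and compact (integrals of complex-valued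 functions are taken separately for real and imaginary parts). Its spectral radius is $r(T_\rho):=\sup\{|\lambda|:\lambda\in\Sigma(T_\rho)\}$, with $\Sigma(T_\rho)$ the spectrum of $T_\rho$. *)

theory Defs
  imports "HOL-Probability.Probability" "HOL-Library.Landau_Symbols"
begin

text \<open>Probabilists' Hermite polynomials and their normalisation, which is orthonormal with respect
  to the standard normal law.\<close>

definition hermite :: "nat \<Rightarrow> real \<Rightarrow> real" where
  "hermite n x = (-1) ^ n * exp (x\<^sup>2 / 2) * (deriv ^^ n) (\<lambda>t. exp (- t\<^sup>2 / 2)) x"

definition hermite_normed :: "nat \<Rightarrow> real \<Rightarrow> real" where
  "hermite_normed n x = hermite n x / sqrt (fact n)"


text \<open>The Hilbert space depends on the real number \<open>q\<close>, so it is a carrier set of functions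
  rather than a type.\<close>

definition hermite_expansion :: "real \<Rightarrow> (real \<Rightarrow> complex) \<Rightarrow> (nat \<Rightarrow> complex) \<Rightarrow> bool" where
  "hermite_expansion q f a \<longleftrightarrow>
     summable (\<lambda>n. (cmod (a n))\<^sup>2 / q ^ n) \<and>
     (\<forall>x. (\<lambda>n. a n * complex_of_real (hermite_normed n x)) sums f x)"

definition Hq :: "real \<Rightarrow> (real \<Rightarrow> complex) set" where
  "Hq q = {f. \<exists>a. hermite_expansion q f a}"

text \<open>For \<open>0 < q < 1\<close> the coefficient sequence of an element of \<open>Hq q\<close> is unique, because the
  expansion also converges in the \<open>L\<^sup>2\<close> space of the standard normal law.\<close>

definition hermite_coeff :: "real \<Rightarrow> (real \<Rightarrow> complex) \<Rightarrow> nat \<Rightarrow> complex" where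
  "hermite_coeff q f = (THE a. hermite_expansion q f a)"

definition Hq_inner :: "real \<Rightarrow> (real \<Rightarrow> complex) \<Rightarrow> (real \<Rightarrow> complex) \<Rightarrow> complex" where
  "Hq_inner q f g =
     (\<Sum>n. hermite_coeff q f n * cnj (hermite_coeff q g n) / complex_of_real (q ^ n))"

definition Hq_norm :: "real \<Rightarrow> (real \<Rightarrow> complex) \<Rightarrow> real" where
  "Hq_norm q f = sqrt (Re (Hq_inner q f f))"

definition Hq_bounded_operator ::
    "real \<Rightarrow> ((real \<Rightarrow> complex) \<Rightarrow> real \<Rightarrow> complex) \<Rightarrow> bool" where
  "Hq_bounded_operator q S \<longleftrightarrow>
     (\<forall>f\<in>Hq q. S f \<in> Hq q) \<and>
     (\<forall>f\<in>Hq q. \<forall>g\<in>Hq q. S (\<lambda>x. f x + g x) = (\<lambda>x. S f x + S g x)) \<and>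
     (\<forall>c. \<forall>f\<in>Hq q. S (\<lambda>x. c * f x) = (\<lambda>x. c * S f x)) \<and>
     (\<exists>C. \<forall>f\<in>Hq q. Hq_norm q (S f) \<le> C * Hq_norm q f)"

text \<open>The spectrum consists of those \<open>z\<close> for which \<open>T - z\<close> has no two-sided inverse among the bounded
  operators on \<open>Hq q\<close>.\<close>

definition Hq_spectrum ::
    "real \<Rightarrow> ((real \<Rightarrow> complex) \<Rightarrow> real \<Rightarrow> complex) \<Rightarrow> complex set" where
  "Hq_spectrum q T =
     {z. \<not> (\<exists>S. Hq_bounded_operator q S \<and>
               (\<forall>f\<in>Hq q. S (\<lambda>x. T f x - z * f x) = f) \<and>
               (\<forall>f\<in>Hq q. (\<lambda>x. T (S f) x - z * S f x) = f))}"

definition Hq_spectral_radius ::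
    "real \<Rightarrow> ((real \<Rightarrow> complex) \<Rightarrow> real \<Rightarrow> complex) \<Rightarrow> real" where
  "Hq_spectral_radius q T = Sup (cmod ` Hq_spectrum q T)"

definition Hq_eigenfunction ::
    "real \<Rightarrow> ((real \<Rightarrow> complex) \<Rightarrow> real \<Rightarrow> complex) \<Rightarrow> complex \<Rightarrow> (real \<Rightarrow> complex) \<Rightarrow> bool" where
  "Hq_eigenfunction q T z f \<longleftrightarrow> f \<in> Hq q \<and> f \<noteq> (\<lambda>x. 0) \<and> T f = (\<lambda>x. z * f x)"

definition Hq_eigenvalue ::
    "real \<Rightarrow> ((real \<Rightarrow> complex) \<Rightarrow> real \<Rightarrow> complex) \<Rightarrow> complex \<Rightarrow> bool" where
  "Hq_eigenvalue q T z \<longleftrightarrow> (\<exists>f. Hq_eigenfunction q T z f)"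

definition T_op :: "real \<Rightarrow> (real \<Rightarrow> complex) \<Rightarrow> real \<Rightarrow> complex" where
  "T_op \<rho> f x = (LINT y:{- \<rho> * x..}|lborel. f y * complex_of_real (std_normal_density y))"


text \<open>The innovations are indexed by integers; only the indices from \<open>-1\<close> on matter.\<close>

definition MA1 :: "real \<Rightarrow> (int \<Rightarrow> 'a \<Rightarrow> real) \<Rightarrow> nat \<Rightarrow> 'a \<Rightarrow> real" where
  "MA1 \<rho> \<xi> n \<omega> = \<rho> * \<xi> (int n - 1) \<omega> + \<xi> (int n) \<omega>"

definition persistence_prob :: "'a measure \<Rightarrow> (nat \<Rightarrow> 'a \<Rightarrow> real) \<Rightarrow> nat \<Rightarrow> real" where
  "persistence_prob M X N = measure M {\<omega> \<in> space M. \<forall>n\<le>N. X n \<omega> \<ge> 0}"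

text \<open>\<open>p N = l\<^bsup>N + o(N)\<^esup>\<close> as \<open>N \<rightarrow> \<infinity>\<close>. The condition \<open>0 < l\<close> keeps \<open>powr\<close> meaningful and makes \<open>l\<close>
  unique.\<close>

definition has_persistence_exponent :: "'a measure \<Rightarrow> (nat \<Rightarrow> 'a \<Rightarrow> real) \<Rightarrow> real \<Rightarrow> bool" where
  "has_persistence_exponent M X l \<longleftrightarrow>
     0 < l \<and>
     (\<exists>e. e \<in> o(\<lambda>N. real N) \<and>
          (\<forall>\<^sub>F N in sequentially. persistence_prob M X N = l powr (real N + e N)))"

end

theory Submission
  imports Defs "HOL-Complex_Analysis.Complex_Analysis"
begin

text \<open>Write \<open>T f(x) = \<integral>\<^bsub>-\<rho>x\<^esub>\<^bsup>\<infinity>\<^esup> f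
  \<phi>\<close>. Splitting the integral at \<open>0\<close> gives \<open>T f = \<ell>(f) 1 + A
  f\<close> with the functional \<open>\<ell>(f) =
  \<integral>\<^bsub>0\<^esub>\<^bsup>\<infinity>\<^esup> f \<phi>\<close>
  (\<open>half_mean\<close>) and the Volterra operator \<open>A f(x) =
  \<integral>\<^bsub>-\<rho>x\<^esub>\<^bsup>0\<^esup> f \<phi>\<close>. On Taylor coefficients at
  \<open>0\<close> the operator \<open>A\<close> is strictly lower triangular with rapidly
  decaying powers, so \<open>(1 - w A)\<^bsup>-1\<^esup>\<close> is given by its Neumann series
  for every complex \<open>w\<close>. Hence \<open>T\<close> is a rank-one perturbation of a
  quasi-nilpotent operator, and its spectral theory reduces to one entire function, the
  characteristic series \<open>D(w) = 1 - w \<ell>((1 - w A)\<^bsup>-1\<^esup> 1)\<close>: a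
  number \<open>z \<noteq> 0\<close> is an eigenvalue when \<open>D(1/z) = 0\<close>, with
  eigenfunction \<open>(1 - A/z)\<^bsup>-1\<^esup> 1\<close>, and otherwise the resolvent at
  \<open>z\<close> has an explicit formula (\<open>resolv\<close>).

  The passage between \<open>Hq\<close> and Taylor coefficients rests on two estimates. Functions
  in \<open>Hq\<close> have Taylor coefficients of order \<open>\<tau>\<^bsup>n/2\<^esup> / sqrt
  n!\<close> for each \<open>\<tau> > q/(1-q)\<close> (\<open>Hq_taylor\<close>); \<open>A\<close>
  turns such sequences into sequences of order \<open>\<sigma>\<^bsup>n/2\<^esup> / sqrt
  n!\<close> with \<open>\<sigma> = \<rho>\<^sup>2 (1 + \<tau>)\<close>
  (\<open>volterra_tbound\<close>); and these belong to \<open>Hq\<close> as soon as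
  \<open>\<sigma> < q/(1+q)\<close> (\<open>tbound_Hq\<close>). A suitable \<open>\<tau>\<close>
  exists exactly when \<open>\<rho>\<^sup>2 < (1-q)/(1+1/q)\<close>.

  The iterates \<open>T\<^sup>N 1\<close> are non-negative and satisfy a renewal equation, which
  says that the generating function of the numbers \<open>\<ell>(T\<^sup>N 1)\<close> is
  essentially \<open>1/D\<close>. A power series with non-negative coefficients whose reciprocal
  is entire has its radius of convergence \<open>R\<close> (\<open>pole\<close>) as a zero of that
  reciprocal (\<open>nonneg_fps_inverse_pole\<close>). So \<open>R\<close> is the zero of
  \<open>D\<close> of least modulus, the spectral radius is \<open>1/R\<close>, and it is an
  eigenvalue. Its eigenfunction is the limit of \<open>D(w) \<Sum>\<^sub>N w\<^sup>N T\<^sup>N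
  1\<close> as \<open>w\<close> increases to \<open>R\<close>, hence non-negative; it is bounded,
  so comparing it with the constant \<open>1\<close> gives \<open>T\<^sup>N 1 \<ge> c
  R\<^bsup>-N\<^esup>\<close>, while the radius of convergence gives the matching upper bound. By
  the Markov property of the innovations the probability that the first values of the process are
  non-negative is the Gaussian mean of \<open>T\<^sup>N 1\<close>, which yields the persistence
  exponent.

  For the power series, \<open>\<lambda> = 1/R\<close> solves \<open>\<lambda> = 1/2 +
  \<Sum>\<^bsub>k\<ge>1\<^esub> c\<^sub>k(\<rho>) \<lambda>\<^bsup>-k\<^esup>\<close> with
  \<open>c\<^sub>k(\<rho>) = \<ell>(A\<^sup>k 1)\<close>. The coefficients
  \<open>c\<^sub>k\<close> (\<open>char_coeff\<close>) make sense for complex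
  \<open>\<rho>\<close> and are bounded by replacing all signs by plus signs: \<open>|c\<^sub>1|
  \<le> artanh r / (2\<pi>)\<close> and \<open>|c\<^sub>k|\<close> is tiny for \<open>k \<ge>
  2\<close>. For \<open>|\<rho>| < 0.3322\<close> the right hand side is a contraction of the
  region \<open>|\<lambda> - 1/2| \<le> 0.23\<close>, so its fixed point is holomorphic in
  \<open>\<rho>\<close>, and for real \<open>\<rho>\<close> it must be \<open>1/R\<close>.\<close>

section \<open>Hermite polynomials as coefficients of a generating function\<close>

text \<open>The power series of \<open>exp (a x\<^sup>2)\<close>. It is the bridge between
  monomials and Hermite polynomials: multiplying the exponential generating function of the
  monomials by \<open>gauss_ser (-1/2)\<close> gives that of the Hermite polynomials, and
  \<open>gauss_ser (1/2)\<close> undoes this.\<close>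

definition gauss_ser :: "'a::field_char_0 \<Rightarrow> 'a fps" where
  "gauss_ser a = Abs_fps (\<lambda>n. if even n then a ^ (n div 2) / fact (n div 2) else 0)"

text \<open>The differential equation \<open>F' = 2 c x F\<close> with \<open>F(0) = 1\<close>
  determines the coefficients recursively, which makes the multiplication law of these series a
  one-line consequence.\<close>

lemma gauss_ser_unique:
  fixes F :: "'a::field_char_0 fps"
  assumes "F $ 0 = 1" and "fps_deriv F = fps_const (2 * c) * fps_X * F"
  shows "F = gauss_ser c"
proof -
  have rec: "of_nat (Suc n) * F $ Suc n = (if n = 0 then 0 else 2 * c * F $ (n - 1))" for n
    using arg_cong[OF assms(2), of "\<lambda>G. G $ n"] by (simp add: mult.assoc)
  have "F $ n = gauss_ser c $ n" for n
  proof (induction n rule: nat_less_induct)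
    case (1 n)
    consider "n = 0" | "n = 1" | k where "n = Suc (Suc k)"
      by (metis One_nat_def nat.exhaust)
    then show ?case
    proof cases
      case 1 then show ?thesis using assms(1) by (simp add: gauss_ser_def)
    next
      case 2 then show ?thesis using rec[of 0] by (simp add: gauss_ser_def)
    next
      case (3 k)
      have "of_nat (Suc (Suc k)) * F $ n = 2 * c * F $ k" using rec[of "Suc k"] 3 by simp
      also have "F $ k = gauss_ser c $ k" using 1 3 by simp
      also have "2 * c * gauss_ser c $ k = of_nat (Suc (Suc k)) * gauss_ser c $ n"
      proof (cases "even k")
        case True
        then obtain j where j: "k = 2 * j" by blast
        have nz: "(of_nat (Suc j) :: 'a) \<noteq> 0" by (rule of_nat_neq_0)
        have e: "(of_nat (Suc (Suc k)) :: 'a) = 2 * of_nat (Suc j)" using j by simp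
        have "Suc (Suc k) div 2 = Suc j" "k div 2 = j" using j by auto
        then show ?thesis unfolding e gauss_ser_def fps_nth_Abs_fps 3
          using True nz by (simp add: divide_simps)
      qed (simp add: gauss_ser_def 3)
      finally show ?thesis
        by (metis mult_cancel_left of_nat_neq_0)
    qed
  qed
  then show ?thesis by (simp add: fps_eq_iff)
qed

lemma gauss_ser_0: "gauss_ser a $ 0 = 1" by (simp add: gauss_ser_def)

lemma gauss_ser_deriv: "fps_deriv (gauss_ser (a::'a::field_char_0)) = fps_const (2 * a) * fps_X * gauss_ser a"
proof (rule fps_ext)
  fix n
  show "fps_deriv (gauss_ser a) $ n = (fps_const (2 * a) * fps_X * gauss_ser a) $ n"
  proof (cases n)
    case 0 then show ?thesis by (simp add: gauss_ser_def mult.assoc)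
  next
    case (Suc k)
    show ?thesis
    proof (cases "even k")
      case True
      then obtain j where j: "k = 2 * j" by blast
      have nz: "(of_nat (Suc j) :: 'a) \<noteq> 0" by (rule of_nat_neq_0)
      have e: "(of_nat (Suc (Suc k)) :: 'a) = 2 * of_nat (Suc j)" using j by simp
      have "Suc (Suc k) div 2 = Suc j" "k div 2 = j" using j by auto
      then have "of_nat (Suc (Suc k)) * gauss_ser a $ Suc (Suc k) = 2 * a * gauss_ser a $ k"
        unfolding e gauss_ser_def fps_nth_Abs_fps
        using True nz by (simp add: divide_simps)
      then show ?thesis using Suc by (simp add: mult.assoc)
    qed (simp add: gauss_ser_def Suc mult.assoc)
  qed
qed

lemma gauss_ser_mult: "gauss_ser a * gauss_ser b = gauss_ser (a + b)"
proof (rule gauss_ser_unique)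
  show "fps_deriv (gauss_ser a * gauss_ser b) = fps_const (2 * (a + b)) * fps_X * (gauss_ser a * gauss_ser b)"
    by (simp add: gauss_ser_deriv algebra_simps flip: fps_const_add)
qed (simp add: gauss_ser_def)

lemma gauss_ser_zero: "gauss_ser 0 = 1"
  by (rule gauss_ser_unique[symmetric]) auto

text \<open>The \<open>n\<close>-th coefficient is the \<open>n\<close>-th Hermite polynomial at
  \<open>x\<close> divided by \<open>n!\<close>.\<close>

definition herm_gen :: "real \<Rightarrow> real fps" where "herm_gen x = gauss_ser (-1/2) * fps_exp x"

lemma herm_gen_Suc: "real (Suc n) * herm_gen x $ Suc n = x * herm_gen x $ n - (if n = 0 then 0 else herm_gen x $ (n - 1))"
proof -
  have "fps_deriv (herm_gen x) = fps_const x * herm_gen x - fps_X * herm_gen x"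
    unfolding herm_gen_def fps_deriv_mult gauss_ser_deriv fps_exp_deriv
    by (simp add: algebra_simps flip: fps_const_neg)
  from arg_cong[OF this, of "\<lambda>G. G $ n"] show ?thesis by simp
qed

lemma herm_gen_nth: "herm_gen x $ n = (\<Sum>i=0..n. gauss_ser (-1/2) $ (n - i) * (x ^ i / fact i))"
  unfolding herm_gen_def fps_mult_nth
  by (rule sum.reindex_bij_witness[of _ "\<lambda>i. n - i" "\<lambda>i. n - i"]) auto

lemma herm_gen_deriv: "((\<lambda>x. herm_gen x $ n) has_real_derivative (if n = 0 then 0 else herm_gen x $ (n - 1))) (at x)"
proof (cases n)
  case 0 then show ?thesis by (simp add: herm_gen_nth)
next
  case (Suc k)
  have "((\<lambda>x. herm_gen x $ n) has_real_derivative
      (\<Sum>i=0..n. gauss_ser (-1/2) $ (n - i) * (real i * x ^ (i - 1) / fact i))) (at x)"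
    unfolding herm_gen_nth by (auto intro!: derivative_eq_intros sum.cong simp: power2_eq_square)
  also have "(\<Sum>i=0..n. gauss_ser (-1/2) $ (n - i) * (real i * x ^ (i - 1) / fact i)) =
      (\<Sum>i=0..k. gauss_ser (-1/2) $ (n - Suc i) * (real (Suc i) * x ^ i / fact (Suc i)))"
    unfolding Suc by (subst sum.atLeast0_atMost_Suc_shift) simp
  also have "\<dots> = herm_gen x $ k" unfolding herm_gen_nth
    by (intro sum.cong refl) (simp add: Suc divide_simps)
  finally show ?thesis using Suc by simp
qed

lemma iterated_deriv_gauss:
  "(deriv ^^ n) (\<lambda>t. exp (- t\<^sup>2 / 2)) = (\<lambda>x::real. (-1) ^ n * fact n * herm_gen x $ n * exp (- x\<^sup>2 / 2))"
proof (induction n)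
  case 0 show ?case by (simp add: herm_gen_nth gauss_ser_def)
next
  case (Suc n)
  show ?case
  proof
    fix x :: real
    have "((\<lambda>x. (-1) ^ n * fact n * herm_gen x $ n * exp (- x\<^sup>2 / 2)) has_real_derivative
        (-1) ^ n * fact n * ((if n = 0 then 0 else herm_gen x $ (n - 1)) - x * herm_gen x $ n) * exp (- x\<^sup>2 / 2)) (at x)"
      by (rule DERIV_cong, (rule derivative_eq_intros herm_gen_deriv refl | simp)+)
        (simp add: algebra_simps power2_eq_square)
    also have "(if n = 0 then 0 else herm_gen x $ (n - 1)) - x * herm_gen x $ n = - (real (Suc n) * herm_gen x $ Suc n)"
      using herm_gen_Suc[of n x] by simp
    finally show "(deriv ^^ Suc n) (\<lambda>t. exp (- t\<^sup>2 / 2)) x =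
        (-1) ^ Suc n * fact (Suc n) * herm_gen x $ Suc n * exp (- x\<^sup>2 / 2)"
      using Suc by (simp add: DERIV_imp_deriv algebra_simps)
  qed
qed

lemma hermite_eq: "hermite n x = fact n * herm_gen x $ n"
proof -
  have "exp (x\<^sup>2 / 2) * exp (- x\<^sup>2 / 2) = 1" by (simp flip: exp_add)
  moreover have "(-1) ^ n * (-1) ^ n = (1::real)" by (simp flip: power_mult_distrib)
  moreover have "hermite n x = ((-1) ^ n * (-1) ^ n) * (exp (x\<^sup>2 / 2) * exp (- x\<^sup>2 / 2)) * (fact n * herm_gen x $ n)"
    unfolding hermite_def iterated_deriv_gauss by (simp only: mult_ac)
  ultimately show ?thesis by simp
qed

lemma hermite_normed_eq: "hermite_normed n x = sqrt (fact n) * herm_gen x $ n"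
  by (simp add: hermite_normed_def hermite_eq real_div_sqrt divide_simps)

lemma fact_double_le: "fact (2 * j) \<le> (4 ^ j * (fact j)\<^sup>2 :: real)"
proof (induction j)
  case (Suc j)
  have "fact (2 * Suc j) = (real (2 * j + 2) * real (2 * j + 1)) * fact (2 * j)"
    by (simp add: algebra_simps)
  also have "\<dots> \<le> (4 * (real (Suc j))\<^sup>2) * (4 ^ j * (fact j)\<^sup>2)"
    by (rule mult_mono[OF _ Suc]) (auto simp: power2_eq_square algebra_simps)
  also have "\<dots> = 4 ^ Suc j * (fact (Suc j))\<^sup>2"
    by (simp add: power2_eq_square algebra_simps)
  finally show ?case .
qed simp

text \<open>With \<open>i = 2 j\<close> this is \<open>(2 j)! \<le> (2\<^sup>j
  j!)\<^sup>2\<close>. In combination with binomial coefficients it produces the weights \<open>1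
  / sqrt n!\<close> that are used everywhere below.\<close>

lemma abs_gauss_ser_half: "\<bar>a\<bar> = (1/2 :: real) \<Longrightarrow> \<bar>gauss_ser a $ i\<bar> \<le> 1 / sqrt (fact i)"
proof (cases "even i")
  case True
  assume a: "\<bar>a\<bar> = 1/2"
  obtain j where j: "i = 2 * j" using True by blast
  have "sqrt (fact i) \<le> sqrt ((2 ^ j * fact j)\<^sup>2)"
    unfolding real_sqrt_le_iff j using fact_double_le[of j]
    by (simp add: power_mult_distrib flip: power_mult) (simp add: power_mult power2_eq_square flip: power_mult_distrib)
  then have "sqrt (fact i) \<le> 2 ^ j * fact j" by simp
  then have "1 / (2 ^ j * fact j) \<le> 1 / sqrt (fact i)" by (intro divide_left_mono) auto
  moreover have "\<bar>gauss_ser a $ i\<bar> = 1 / (2 ^ j * fact j)"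
    unfolding gauss_ser_def using True j by (simp add: power_abs a power_divide)
  ultimately show ?thesis using j by simp
qed (simp add: gauss_ser_def)

section \<open>Changing between Hermite and Taylor coefficients\<close>

text \<open>A single term of the binomial expansion of \<open>(t + (1 - t))\<^sup>m\<close> is at
  most \<open>1\<close>. The free parameter \<open>t\<close> decides how a geometric bound in
  \<open>m\<close> is distributed over \<open>n\<close> and \<open>m - n\<close>.\<close>

lemma binom_weight_le:
  fixes t q :: real
  assumes "0 < t" "t < 1" "0 \<le> q" "n \<le> m"
  shows "sqrt (q ^ m * (m choose n)) \<le> sqrt ((q / t) ^ n) * sqrt ((q / (1 - t)) ^ (m - n))"
proof -
  have "real (m choose n) * t ^ n * (1 - t) ^ (m - n) \<le> (\<Sum>k\<le>m. real (m choose k) * t ^ k * (1 - t) ^ (m - k))"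
    using assms by (intro member_le_sum[of n "{..m}" "\<lambda>k. real (m choose k) * t ^ k * (1 - t) ^ (m - k)"]) auto
  also have "\<dots> = (t + (1 - t)) ^ m" by (rule binomial_ring[symmetric])
  finally have *: "real (m choose n) * (t ^ n * (1 - t) ^ (m - n)) \<le> 1" by simp
  have "real (m choose n) \<le> 1 / (t ^ n * (1 - t) ^ (m - n))"
    using * assms by (subst pos_le_divide_eq) auto
  then have "q ^ m * real (m choose n) \<le> q ^ m * (1 / (t ^ n * (1 - t) ^ (m - n)))"
    using assms by (intro mult_left_mono) auto
  also have "q ^ m * (1 / (t ^ n * (1 - t) ^ (m - n))) = (q / t) ^ n * (q / (1 - t)) ^ (m - n)"
  proof -
    have "q ^ m = q ^ n * q ^ (m - n)" using assms by (simp flip: power_add)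
    then show ?thesis by (simp add: power_divide)
  qed
  finally show ?thesis by (simp flip: real_sqrt_mult)
qed


lemma double_sum_swap:
  fixes F :: "nat \<Rightarrow> nat \<Rightarrow> 'a::banach"
  assumes s1: "\<And>n. summable (\<lambda>m. norm (F m n))" and s2: "summable (\<lambda>n. \<Sum>m. norm (F m n))"
  shows "summable (\<lambda>n. norm (F m n))" "summable (\<lambda>m. \<Sum>n. norm (F m n))"
    "(\<lambda>m. \<Sum>n. F m n) sums (\<Sum>n. \<Sum>m. F m n)"
proof -
  have inf1: "infsum (\<lambda>m. norm (F m n)) UNIV = (\<Sum>m. norm (F m n))" for n
    by (intro infsumI norm_summable_imp_has_sum summable_sums) (simp_all only: real_norm_def abs_norm_cancel s1)
  have "(\<lambda>p. norm ((\<lambda>(n, m). F m n) p)) summable_on (UNIV \<times> UNIV)"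
  proof (subst Infinite_Sum.abs_summable_on_Sigma_iff, intro conjI ballI)
    fix n :: nat
    show "(\<lambda>m. norm (case (n, m) of (n, m) \<Rightarrow> F m n)) summable_on UNIV"
      using s1[of n] by (intro norm_summable_imp_summable_on) simp
  next
    have "summable (\<lambda>n. norm (\<Sum>m. norm (F m n)))"
      using s2 suminf_nonneg[OF s1] by simp
    then show "(\<lambda>n. norm (infsum (\<lambda>m. norm (case (n, m) of (n, m) \<Rightarrow> F m n)) UNIV)) summable_on UNIV"
      by (intro norm_summable_imp_summable_on) (simp add: inf1)
  qed
  then have abs: "(\<lambda>p. norm ((\<lambda>(m, n). F m n) p)) summable_on (UNIV \<times> UNIV)"
    using summable_on_swap[of "\<lambda>p. norm ((\<lambda>(n, m). F m n) p)" UNIV UNIV] by (simp only: case_prod_unfold fst_conv snd_conv)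
  have abs': "\<forall>m\<in>UNIV. (\<lambda>n. norm (F m n)) summable_on UNIV"
      "(\<lambda>m. norm (infsum (\<lambda>n. norm (F m n)) UNIV)) summable_on UNIV"
    using abs[unfolded Infinite_Sum.abs_summable_on_Sigma_iff] by simp_all
  have sn: "summable (\<lambda>n. norm (F m n))" for m
    by (rule summable_on_imp_summable) (rule bspec[OF abs'(1)], rule UNIV_I)
  then show "summable (\<lambda>n. norm (F m n))" .
  have inf2: "infsum (\<lambda>n. norm (F m n)) UNIV = (\<Sum>n. norm (F m n))" for m
    by (intro infsumI norm_summable_imp_has_sum summable_sums) (simp_all only: real_norm_def abs_norm_cancel sn)
  have inf3: "infsum (\<lambda>n. F m n) UNIV = (\<Sum>n. F m n)" for m
    by (rule infsumI[OF norm_summable_imp_has_sum[OF sn summable_sums[OF summable_norm_cancel[OF sn]]]])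
  have inf4: "infsum (\<lambda>m. F m n) UNIV = (\<Sum>m. F m n)" for n
    by (rule infsumI[OF norm_summable_imp_has_sum[OF s1 summable_sums[OF summable_norm_cancel[OF s1]]]])
  have "(\<lambda>m. norm (\<Sum>n. norm (F m n))) summable_on UNIV"
    using abs'(2) unfolding inf2 .
  then have sm: "summable (\<lambda>m. norm (\<Sum>n. norm (F m n)))"
    by (rule summable_on_imp_summable)
  then show sm': "summable (\<lambda>m. \<Sum>n. norm (F m n))"
    by (rule summable_norm_cancel)
  have "(\<lambda>(m, n). F m n) summable_on (UNIV \<times> UNIV)"
    using abs by (rule abs_summable_summable)
  from infsum_swap_banach[OF this]
  have e: "infsum (\<lambda>m. \<Sum>n. F m n) UNIV = infsum (\<lambda>n. \<Sum>m. F m n) UNIV"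
    by (simp add: inf3 inf4)
  have t1: "summable (\<lambda>m. norm (\<Sum>n. F m n))"
    by (rule summable_comparison_test'[OF sm', of 0]) (simp add: summable_norm sn)
  have t2: "summable (\<lambda>n. norm (\<Sum>m. F m n))"
    by (rule summable_comparison_test'[OF s2, of 0]) (simp add: summable_norm s1)
  have "infsum (\<lambda>m. \<Sum>n. F m n) UNIV = (\<Sum>m. \<Sum>n. F m n)"
    by (rule infsumI[OF norm_summable_imp_has_sum[OF t1 summable_sums[OF summable_norm_cancel[OF t1]]]])
  moreover have "infsum (\<lambda>n. \<Sum>m. F m n) UNIV = (\<Sum>n. \<Sum>m. F m n)"
    by (rule infsumI[OF norm_summable_imp_has_sum[OF t2 summable_sums[OF summable_norm_cancel[OF t2]]]])
  ultimately show "(\<lambda>m. \<Sum>n. F m n) sums (\<Sum>n. \<Sum>m. F m n)"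
    using e summable_sums[OF summable_norm_cancel[OF t1]] by simp
qed

text \<open>The natural size of Taylor coefficients here: coefficients of this order belong to
  entire functions bounded by \<open>exp (c |z|\<^sup>2)\<close> for each \<open>c >
  t/2\<close>.\<close>

definition wt :: "real \<Rightarrow> nat \<Rightarrow> real" where "wt t n = sqrt (t ^ n / fact n)"

lemma wt_nonneg: "0 \<le> t \<Longrightarrow> 0 \<le> wt t n" by (simp add: wt_def)

lemma summable_wt_power:
  assumes "0 \<le> t" shows "summable (\<lambda>n. wt t n * y ^ n)"
proof (cases "t = 0 \<or> y = 0")
  case True
  then have "wt t n * y ^ n = 0" if "n \<notin> {0}" for n using that by (auto simp: wt_def)
  then show ?thesis by (rule summable_finite[of "{0}", rotated]) auto
next
  case False
  then have t: "t > 0" "y \<noteq> 0" using assms by auto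
  obtain N :: nat where N: "4 * t * y\<^sup>2 \<le> N" using real_arch_simple by blast
  show ?thesis
  proof (rule summable_ratio_test[of "1/2" N])
    fix n assume n: "n \<ge> N"
    have "wt t (Suc n) = wt t n * sqrt (t / real (Suc n))"
      unfolding wt_def real_sqrt_mult[symmetric] by (simp add: field_simps)
    then have "norm (wt t (Suc n) * y ^ Suc n) = sqrt (t / real (Suc n)) * \<bar>y\<bar> * norm (wt t n * y ^ n)"
      using t by (simp add: abs_mult)
    also have "sqrt (t / real (Suc n)) * \<bar>y\<bar> = sqrt (t * y\<^sup>2 / real (Suc n))"
      by (simp add: real_sqrt_mult real_sqrt_divide)
    also have "\<dots> \<le> sqrt ((1/2)\<^sup>2)"
    proof -
      have "t * y\<^sup>2 / real (Suc n) \<le> 1/4"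
        using N n by (simp add: divide_simps)
      then show ?thesis by (simp add: power2_eq_square)
    qed
    finally show "norm (wt t (Suc n) * y ^ Suc n) \<le> 1 / 2 * norm (wt t n * y ^ n)"
      by (simp add: mult_right_mono)
  qed simp
qed

lemma summable_geometric_tail:
  fixes s :: real assumes "0 \<le> s" "s < 1"
  shows "(\<lambda>m. if n \<le> m then s ^ (m - n) else 0) sums (1 / (1 - s))"
proof -
  have "(\<lambda>m. if n \<le> m + n then s ^ (m + n - n) else 0) sums (1 / (1 - s))"
    using geometric_sums[of s] assms by simp
  then show ?thesis by (subst (asm) sums_iff_shift) simp
qed

lemma summable_geometric_tail_sqrt:
  fixes s :: real assumes "0 \<le> s" "s < 1"
  shows "(\<lambda>m. if n \<le> m then sqrt (s ^ (m - n)) else 0) sums (1 / (1 - sqrt s))"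
  using summable_geometric_tail[of "sqrt s" n] assms by (simp add: real_sqrt_power cong: if_cong)

text \<open>The Taylor coefficients of the function with normalised Hermite coefficients
  \<open>a\<close>, and conversely.\<close>

definition herm_taylor :: "(nat \<Rightarrow> complex) \<Rightarrow> nat \<Rightarrow> complex" where
  "herm_taylor a n = (\<Sum>m. if n \<le> m then a m * of_real (sqrt (fact m) * gauss_ser (-1/2) $ (m - n) / fact n) else 0)"

definition taylor_herm :: "(nat \<Rightarrow> complex) \<Rightarrow> nat \<Rightarrow> complex" where
  "taylor_herm c m = (\<Sum>n. if m \<le> n then c n * of_real (fact n * gauss_ser (1/2) $ (n - m) / sqrt (fact m)) else 0)"

lemma hermite_normed_sum:
  "hermite_normed m x = (\<Sum>n\<le>m. sqrt (fact m) * gauss_ser (-1/2) $ (m - n) / fact n * x ^ n)"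
  unfolding hermite_normed_eq herm_gen_nth sum_distrib_left atMost_atLeast0 by (simp add: algebra_simps)

lemma power_hermite_sum:
  "x ^ n = (\<Sum>m\<le>n. fact n * gauss_ser (1/2) $ (n - m) / sqrt (fact m) * hermite_normed m x)"
proof -
  have "gauss_ser (1/2) * herm_gen x = fps_exp x"
    unfolding herm_gen_def mult.assoc[symmetric] gauss_ser_mult by (simp add: gauss_ser_zero)
  then have "fps_exp x $ n = (herm_gen x * gauss_ser (1/2)) $ n" by (simp add: mult.commute)
  also have "\<dots> = (\<Sum>m\<le>n. herm_gen x $ m * gauss_ser (1/2) $ (n - m))"
    by (simp add: fps_mult_nth atMost_atLeast0)
  finally have "x ^ n = (\<Sum>m\<le>n. fact n * (herm_gen x $ m * gauss_ser (1/2) $ (n - m)))"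
    by (simp add: sum_distrib_left[symmetric] divide_simps)
  then show ?thesis by (simp add: hermite_normed_eq algebra_simps)
qed

lemma herm_term_bound:
  assumes q: "0 < q" "0 < t" "t < 1" and a: "cmod (a m) \<le> B * sqrt (q ^ m)" and B: "0 \<le> B" and nm: "n \<le> m"
  shows "cmod (a m * of_real (sqrt (fact m) * gauss_ser (-1/2) $ (m - n) / fact n))
    \<le> B * wt (q / t) n * sqrt ((q / (1 - t)) ^ (m - n))"
proof -
  have g: "\<bar>gauss_ser (-1/2::real) $ (m - n)\<bar> \<le> 1 / sqrt (fact (m - n))" by (rule abs_gauss_ser_half) simp
  have "cmod (a m * of_real (sqrt (fact m) * gauss_ser (-1/2) $ (m - n) / fact n))
      = cmod (a m) * (sqrt (fact m) * \<bar>gauss_ser (-1/2::real) $ (m - n)\<bar> / fact n)"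
    by (simp add: norm_mult norm_divide)
  also have "\<dots> \<le> (B * sqrt (q ^ m)) * (sqrt (fact m) * (1 / sqrt (fact (m - n))) / fact n)"
    using a B q g by (intro mult_mono divide_right_mono mult_left_mono) (auto intro: order_trans)
  also have "\<dots> = B * (sqrt (q ^ m * (m choose n)) / sqrt (fact n))"
    using nm by (simp add: binomial_fact real_sqrt_mult real_sqrt_divide divide_simps)
  also have "\<dots> \<le> B * ((sqrt ((q / t) ^ n) * sqrt ((q / (1 - t)) ^ (m - n))) / sqrt (fact n))"
    using B by (intro mult_left_mono divide_right_mono binom_weight_le) (use q nm in auto)
  finally show ?thesis by (simp add: wt_def real_sqrt_divide)
qed


lemma sums_if_le:
  fixes f :: "nat \<Rightarrow> 'a::real_normed_vector"
  shows "(\<lambda>n. if n \<le> m then f n else 0) sums (\<Sum>n\<le>m. f n)"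
  using sums_finite[of "{..m}" "\<lambda>n. if n \<le> m then f n else 0"] by simp

text \<open>Both changes of basis are given by triangular arrays whose columns decay geometrically
  below the diagonal. Summing such an array by rows or by columns gives the same result.\<close>

lemma triangular_transform:
  fixes E :: "nat \<Rightarrow> nat \<Rightarrow> complex" and y :: "nat \<Rightarrow> real"
  assumes s: "0 \<le> s" "s < 1"
    and E: "\<And>i j. j \<le> i \<Longrightarrow> cmod (E i j) \<le> w j * sqrt (s ^ (i - j))"
    and w: "summable (\<lambda>j. w j * \<bar>y j\<bar>)"
    and row: "\<And>i. (\<Sum>j\<le>i. E i j * of_real (y j)) = z i"
  defines "b \<equiv> \<lambda>j. \<Sum>i. if j \<le> i then E i j else 0"
  shows "cmod (b j) \<le> w j / (1 - sqrt s)"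
    and "(\<lambda>j. b j * of_real (y j)) sums (\<Sum>i. z i)"
    and "summable (\<lambda>i. cmod (z i))"
proof -
  define E' where "E' = (\<lambda>i j. if j \<le> i then E i j else 0)"
  have G: "(\<lambda>i. w j * (if j \<le> i then sqrt (s ^ (i - j)) else 0)) sums (w j * (1 / (1 - sqrt s)))" for j
    by (intro sums_mult summable_geometric_tail_sqrt s)
  have le: "cmod (E' i j) \<le> w j * (if j \<le> i then sqrt (s ^ (i - j)) else 0)" for i j
    using E[of j i] by (auto simp: E'_def)
  have sm: "summable (\<lambda>i. cmod (E' i j))" for j
    by (rule summable_comparison_test'[OF sums_summable[OF G[of j]], of 0]) (use le in auto)
  have nb: "(\<Sum>i. cmod (E' i j)) \<le> w j / (1 - sqrt s)" for j
    using suminf_le[OF le sm sums_summable[OF G]] sums_unique[OF G[of j]] by simp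
  have b: "b j = (\<Sum>i. E' i j)" for j unfolding b_def E'_def ..
  show "cmod (b j) \<le> w j / (1 - sqrt s)"
    unfolding b by (rule order_trans[OF summable_norm[OF sm] nb])
  define F where "F = (\<lambda>i j. E' i j * of_real (y j))"
  have nF: "cmod (F i j) = cmod (E' i j) * \<bar>y j\<bar>" for i j by (simp add: F_def norm_mult)
  have smF: "summable (\<lambda>i. cmod (F i j))" for j unfolding nF by (rule summable_mult2[OF sm])
  have s2: "summable (\<lambda>j. \<Sum>i. cmod (F i j))"
  proof (rule summable_comparison_test'[OF summable_mult[OF w, of "1 / (1 - sqrt s)"], of 0])
    fix j
    have "(\<Sum>i. cmod (F i j)) = (\<Sum>i. cmod (E' i j)) * \<bar>y j\<bar>"
      unfolding nF by (rule suminf_mult2[OF sm, symmetric])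
    also have "\<dots> \<le> w j / (1 - sqrt s) * \<bar>y j\<bar>" by (intro mult_right_mono nb) simp
    finally show "norm (\<Sum>i. cmod (F i j)) \<le> 1 / (1 - sqrt s) * (w j * \<bar>y j\<bar>)"
      using suminf_nonneg[OF smF] by simp
  qed
  note dss = double_sum_swap[OF smF s2]
  have row': "(\<lambda>j. F i j) sums z i" for i
  proof -
    have "(\<lambda>j. if j \<le> i then E i j * of_real (y j) else 0) sums z i"
      unfolding row[symmetric] by (rule sums_if_le)
    moreover have "(\<lambda>j. if j \<le> i then E i j * of_real (y j) else 0) = F i" by (auto simp: F_def E'_def)
    ultimately show ?thesis by simp
  qed
  have col: "(\<Sum>i. F i j) = b j * of_real (y j)" for j
    unfolding F_def b by (rule suminf_mult2[symmetric]) (rule summable_norm_cancel[OF sm])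
  have "summable (\<lambda>j. b j * of_real (y j))"
    by (rule summable_comparison_test'[OF s2, of 0]) (simp only: col[symmetric] summable_norm[OF smF])
  moreover have "(\<Sum>i. z i) = (\<Sum>j. b j * of_real (y j))"
    using sums_unique[OF dss(3)] unfolding sums_unique[OF row', symmetric] col by simp
  ultimately show "(\<lambda>j. b j * of_real (y j)) sums (\<Sum>i. z i)" by (simp add: summable_sums)
  show "summable (\<lambda>i. cmod (z i))"
  proof (rule summable_comparison_test'[OF dss(2), of 0])
    fix i show "norm (cmod (z i)) \<le> (\<Sum>j. cmod (F i j))"
      using summable_norm[OF dss(1)[of i]] unfolding sums_unique[OF row', symmetric] by simp
  qed
qed

text \<open>An \<open>n\<close>-th Taylor coefficient collects the Hermite coefficients of index
  \<open>m \<ge> n\<close>, weighted by \<open>sqrt (m choose n)\<close>; this sum costs the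
  factor \<open>1/(1-q)\<close> in the geometric rate.\<close>

lemma herm_taylor:
  assumes q: "0 < q" "q < 1" and tau: "q / (1 - q) < \<tau>" and B: "0 \<le> B"
    and a: "\<And>m. cmod (a m) \<le> B * sqrt (q ^ m)"
  shows "cmod (herm_taylor a n) \<le> B * wt \<tau> n / (1 - sqrt (q / (1 - q / \<tau>)))"
    and "(\<lambda>n. herm_taylor a n * of_real (x ^ n)) sums (\<Sum>m. a m * of_real (hermite_normed m x))"
    and "summable (\<lambda>m. cmod (a m * of_real (hermite_normed m x)))"
proof -
  (* The binomial parameter that turns the rate q of the Hermite coefficients into \<tau>. *)
  define t where "t = q / \<tau>"
  have tau_pos: "\<tau> > 0" using q tau by (smt (verit) divide_pos_pos)
  have t: "0 < t" "t < 1 - q" using q tau tau_pos by (auto simp: t_def field_simps)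
  have s: "0 \<le> q / (1 - t)" "q / (1 - t) < 1" using q t by auto
  have tq: "q / t = \<tau>" using q tau_pos by (simp add: t_def)
  let ?E = "\<lambda>m n. a m * of_real (sqrt (fact m) * gauss_ser (-1/2) $ (m - n) / fact n)"
  have E: "cmod (?E m n) \<le> B * wt \<tau> n * sqrt ((q / (1 - t)) ^ (m - n))" if "n \<le> m" for m n
    using herm_term_bound[where a = a and m = m and B = B and q = q and t = t, OF q(1) t(1) _ a B that] t q
    unfolding tq by simp
  have w: "summable (\<lambda>n. B * wt \<tau> n * \<bar>x ^ n\<bar>)"
    using summable_mult[OF summable_wt_power[of \<tau> "\<bar>x\<bar>"], of B] tau_pos by (simp add: power_abs mult.assoc)
  have row: "(\<Sum>n\<le>m. ?E m n * of_real (x ^ n)) = a m * of_real (hermite_normed m x)" for m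
    unfolding hermite_normed_sum of_real_sum sum_distrib_left
    by (intro sum.cong refl) (simp add: mult_ac)
  note T = triangular_transform[of "q / (1 - t)" ?E, OF s E w row, folded herm_taylor_def]
  show "cmod (herm_taylor a n) \<le> B * wt \<tau> n / (1 - sqrt (q / (1 - q / \<tau>)))"
    using T(1)[of n] by (simp add: t_def)
  show "(\<lambda>n. herm_taylor a n * of_real (x ^ n)) sums (\<Sum>m. a m * of_real (hermite_normed m x))"
    "summable (\<lambda>m. cmod (a m * of_real (hermite_normed m x)))"
    using T(2,3) by simp_all
qed

lemma taylor_term_bound:
  assumes q: "0 < q" and sig: "0 \<le> \<sigma>" and c: "cmod (c n) \<le> B * wt \<sigma> n" and B: "0 \<le> B" and mn: "m \<le> n"
  defines "s \<equiv> \<sigma> * (1 + q) / q"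
  shows "cmod (c n * of_real (fact n * gauss_ser (1/2) $ (n - m) / sqrt (fact m)))
    \<le> B * sqrt ((s * q) ^ m) * sqrt (s ^ (n - m))"
proof -
  have g: "\<bar>gauss_ser (1/2::real) $ (n - m)\<bar> \<le> 1 / sqrt (fact (n - m))" by (rule abs_gauss_ser_half) simp
  have "cmod (c n * of_real (fact n * gauss_ser (1/2) $ (n - m) / sqrt (fact m)))
      = cmod (c n) * (fact n * \<bar>gauss_ser (1/2::real) $ (n - m)\<bar> / sqrt (fact m))"
    by (simp add: norm_mult norm_divide)
  also have "\<dots> \<le> (B * wt \<sigma> n) * (fact n * (1 / sqrt (fact (n - m))) / sqrt (fact m))"
    using c B sig g by (intro mult_mono divide_right_mono mult_left_mono) (auto intro!: mult_nonneg_nonneg wt_nonneg)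
  also have "\<dots> = B * sqrt (\<sigma> ^ n * (n choose m))"
    using mn by (simp add: wt_def binomial_fact real_sqrt_mult real_sqrt_divide divide_simps)
  (* The parameter 1 / (1 + q) makes the growth in m exactly s q, where q compensates the weight
     of the norm, and the decay in n - m exactly s. *)
  also have "\<dots> \<le> B * (sqrt ((\<sigma> / (1 / (1 + q))) ^ m) * sqrt ((\<sigma> / (1 - 1 / (1 + q))) ^ (n - m)))"
    using B by (intro mult_left_mono binom_weight_le) (use q sig mn in \<open>auto simp: divide_simps\<close>)
  also have "\<sigma> / (1 / (1 + q)) = s * q" using q by (simp add: s_def)
  also have "\<sigma> / (1 - 1 / (1 + q)) = s" using q by (simp add: s_def divide_simps)
  finally show ?thesis by simp
qed

text \<open>The square of the norm of \<open>x\<^sup>n\<close> in \<open>Hq\<close> is at most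
  \<open>n! (1 + 1/q)\<^sup>n\<close>, so coefficients of order \<open>\<sigma>\<^bsup>n/2\<^esup>
  / sqrt n!\<close> are admissible when \<open>\<sigma> (1 + 1/q) < 1\<close>.\<close>

lemma taylor_herm:
  assumes q: "0 < q" "q < 1" and sig: "0 \<le> \<sigma>" "\<sigma> < q / (1 + q)" and B: "0 \<le> B"
    and c: "\<And>n. cmod (c n) \<le> B * wt \<sigma> n"
  defines "s \<equiv> \<sigma> * (1 + q) / q"
  shows "cmod (taylor_herm c m) \<le> B * sqrt ((s * q) ^ m) / (1 - sqrt s)"
    and "(\<lambda>m. taylor_herm c m * of_real (hermite_normed m x)) sums (\<Sum>n. c n * of_real (x ^ n))"
proof -
  have s: "0 \<le> s" "s < 1" using q sig by (auto simp: s_def field_simps)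
  let ?E = "\<lambda>n m. c n * of_real (fact n * gauss_ser (1/2) $ (n - m) / sqrt (fact m))"
  have E: "cmod (?E n m) \<le> B * sqrt ((s * q) ^ m) * sqrt (s ^ (n - m))" if "m \<le> n" for m n
    using taylor_term_bound[where c = c and n = n and B = B and q = q and \<sigma> = \<sigma>, OF q(1) sig(1) c B that]
    unfolding s_def .
  have sq: "s * q < 1" "0 \<le> s * q" using s q mult_strict_mono[of s 1 q 1] by auto
  (* Any rate p between s q and 1 serves to sum the Hermite polynomials at x. *)
  then obtain p where p: "s * q < p" "p < 1" using dense by blast
  have p0: "0 < p" using p sq by linarith
  have "summable (\<lambda>m. cmod (of_real (sqrt ((s * q) ^ m)) * of_real (hermite_normed m x)))"
  proof (rule herm_taylor(3)[where q = p and B = 1 and \<tau> = "p / (1 - p) + 1"])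
    show "cmod (of_real (sqrt ((s * q) ^ m))) \<le> 1 * sqrt (p ^ m)" for m
      using p sq by (auto intro!: power_mono)
  qed (use p p0 in auto)
  from summable_mult[OF this, of B]
  have w: "summable (\<lambda>m. B * sqrt ((s * q) ^ m) * \<bar>hermite_normed m x\<bar>)"
    using sq by (simp add: norm_mult mult.assoc)
  have row: "(\<Sum>m\<le>n. ?E n m * of_real (hermite_normed m x)) = c n * of_real (x ^ n)" for n
    unfolding power_hermite_sum[of x n] of_real_sum sum_distrib_left
    by (intro sum.cong refl) (simp add: mult_ac)
  note T = triangular_transform[of s ?E, OF s E w row, folded taylor_herm_def]
  show "cmod (taylor_herm c m) \<le> B * sqrt ((s * q) ^ m) / (1 - sqrt s)"
    "(\<lambda>m. taylor_herm c m * of_real (hermite_normed m x)) sums (\<Sum>n. c n * of_real (x ^ n))"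
    using T(1,2) by simp_all
qed

section \<open>The Volterra part of the operator on Taylor coefficients\<close>

text \<open>The Taylor coefficients of \<open>x \<mapsto>
  \<integral>\<^bsub>-\<rho>x\<^esub>\<^bsup>0\<^esup> f \<phi>\<close> when \<open>f\<close> has
  Taylor coefficients \<open>c\<close>: multiply by the series of \<open>\<phi>\<close>, integrate
  term by term and substitute \<open>-\<rho>x\<close>. The parameter is complex, because the
  dependence on it is shown to be holomorphic later.\<close>

definition volterra :: "complex \<Rightarrow> (nat \<Rightarrow> complex) \<Rightarrow> nat \<Rightarrow> complex" where
  "volterra \<rho> c m = (case m of 0 \<Rightarrow> 0 | Suc n \<Rightarrow>
     (- ((- \<rho>) ^ Suc n)) / of_nat (Suc n) * (\<Sum>i\<le>n. c i * of_real (gauss_ser (-1/2) $ (n - i))) / of_real (sqrt (2 * pi)))"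

text \<open>The Taylor coefficients of the constant function \<open>1\<close>.\<close>

definition one_co :: "nat \<Rightarrow> complex" where "one_co n = (if n = 0 then 1 else 0)"

definition tbound :: "real \<Rightarrow> real \<Rightarrow> (nat \<Rightarrow> complex) \<Rightarrow> bool" where
  "tbound t C c \<longleftrightarrow> 0 \<le> C \<and> (\<forall>n. cmod (c n) \<le> C * wt t n)"

lemma tbound_D: "tbound t C c \<Longrightarrow> cmod (c n) \<le> C * wt t n" by (simp add: tbound_def)

lemma tbound_nonneg: "tbound t C c \<Longrightarrow> 0 \<le> C" by (simp add: tbound_def)

lemma tbound_one: "0 \<le> t \<Longrightarrow> tbound t 1 one_co" 
  by (auto simp: tbound_def one_co_def wt_def)

lemma tbound_add: "tbound t C c \<Longrightarrow> tbound t D d \<Longrightarrow> tbound t (C + D) (\<lambda>n. c n + d n)"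
  unfolding tbound_def by (auto simp: algebra_simps intro: norm_triangle_le add_mono)

lemma tbound_cmult: "tbound t C c \<Longrightarrow> tbound t (cmod x * C) (\<lambda>n. x * c n)"
  unfolding tbound_def by (auto simp: norm_mult mult_left_mono mult.assoc)

lemma wt_mono: "0 \<le> t \<Longrightarrow> t \<le> t' \<Longrightarrow> wt t n \<le> wt t' n"
  by (auto simp: wt_def intro!: divide_right_mono power_mono)

lemma tbound_mono: "tbound t C c \<Longrightarrow> 0 \<le> t \<Longrightarrow> t \<le> t' \<Longrightarrow> C \<le> C' \<Longrightarrow> tbound t' C' c"
  unfolding tbound_def by (meson mult_mono wt_mono wt_nonneg order_trans)

lemma tbound_summable: assumes "tbound t C c" "0 \<le> t" shows "summable (\<lambda>n. cmod (c n * z ^ n))"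
proof (rule summable_comparison_test'[of _ 0])
  show "summable (\<lambda>n. C * (wt t n * cmod z ^ n))" by (intro summable_mult summable_wt_power assms)
  fix n show "norm (cmod (c n * z ^ n)) \<le> C * (wt t n * cmod z ^ n)"
    using tbound_D[OF assms(1), of n] by (simp add: norm_mult norm_power mult_right_mono flip: mult.assoc)
qed

lemma volterra_0 [simp]: "volterra \<rho> c 0 = 0" by (simp add: volterra_def)

lemma volterra_Suc: "volterra \<rho> c (Suc n) =
   (- ((- \<rho>) ^ Suc n)) / of_nat (Suc n) * (\<Sum>i\<le>n. c i * of_real (gauss_ser (-1/2) $ (n - i))) / of_real (sqrt (2 * pi))"
  by (simp add: volterra_def)

lemma volterra_cong: "(\<And>i. i < m \<Longrightarrow> c i = d i) \<Longrightarrow> volterra \<rho> c m = volterra \<rho> d m"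
  by (cases m) (simp_all add: volterra_Suc)

lemma volterra_add: "volterra \<rho> (\<lambda>n. c n + d n) = (\<lambda>m. volterra \<rho> c m + volterra \<rho> d m)"
proof
  fix m show "volterra \<rho> (\<lambda>n. c n + d n) m = volterra \<rho> c m + volterra \<rho> d m"
    by (cases m) (simp_all only: volterra_Suc volterra_0 distrib_right sum.distrib distrib_left add_divide_distrib add_0_left)
qed

lemma volterra_cmult: "volterra \<rho> (\<lambda>n. x * c n) = (\<lambda>m. x * volterra \<rho> c m)"
proof
  fix m show "volterra \<rho> (\<lambda>n. x * c n) m = x * volterra \<rho> c m"
    by (cases m) (simp_all add: volterra_Suc mult.assoc sum_distrib_left[symmetric] mult.left_commute
        del: of_nat_Suc power_Suc)
qed

lemma volterra_zero: "volterra \<rho> (\<lambda>n. 0) = (\<lambda>m. 0)"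
  using volterra_cmult[of \<rho> 0 "\<lambda>n. 0"] by simp

lemma volterra_sum: "finite I \<Longrightarrow> volterra \<rho> (\<lambda>n. \<Sum>k\<in>I. c k n) = (\<lambda>m. \<Sum>k\<in>I. volterra \<rho> (c k) m)"
  by (induction I rule: finite_induct) (simp_all add: volterra_zero volterra_add)

text \<open>By Cauchy-Schwarz the sum of the roots of the \<open>n + 1\<close> terms of \<open>(1
  + t)\<^sup>n\<close> is at most \<open>sqrt ((n + 1) (1 + t)\<^sup>n)\<close>. The factor
  \<open>n + 1\<close> is cancelled by the integration in \<open>volterra\<close>.\<close>

lemma gauss_convolution_bound:
  assumes "0 \<le> t"
  shows "(\<Sum>i\<le>n. wt t i * (1 / sqrt (fact (n - i)))) \<le> sqrt (real (Suc n) * (1 + t) ^ n / fact n)"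
proof (rule real_le_rsqrt)
  have "(\<Sum>i\<le>n. wt t i * (1 / sqrt (fact (n - i))))\<^sup>2 = (\<Sum>i\<le>n. 1 * (wt t i * (1 / sqrt (fact (n - i)))))\<^sup>2"
    by simp
  also have "\<dots> \<le> (\<Sum>i\<le>n. 1\<^sup>2) * (\<Sum>i\<le>n. (wt t i * (1 / sqrt (fact (n - i))))\<^sup>2)"
    by (rule Cauchy_Schwarz_ineq_sum)
  also have "(\<Sum>i\<le>n. (wt t i * (1 / sqrt (fact (n - i))))\<^sup>2) = (\<Sum>i\<le>n. real (n choose i) * t ^ i * 1 ^ (n - i)) / fact n"
    unfolding sum_divide_distrib using assms
    by (intro sum.cong refl) (simp add: wt_def power_mult_distrib power_divide binomial_fact)
  also have "(\<Sum>i\<le>n. real (n choose i) * t ^ i * 1 ^ (n - i)) = (t + 1) ^ n"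
    by (rule binomial_ring[symmetric])
  finally show "(\<Sum>i\<le>n. wt t i * (1 / sqrt (fact (n - i))))\<^sup>2 \<le> real (Suc n) * (1 + t) ^ n / fact n"
    by (simp add: add.commute)
qed

lemma volterra_tbound:
  assumes c: "tbound t C c" and t: "0 \<le> t"
  shows "tbound ((cmod \<rho>)\<^sup>2 * (1 + t)) C (volterra \<rho> c)"
  unfolding tbound_def
proof (intro conjI allI)
  show C: "0 \<le> C" using c by (rule tbound_nonneg)
  fix m show "cmod (volterra \<rho> c m) \<le> C * wt ((cmod \<rho>)\<^sup>2 * (1 + t)) m"
  proof (cases m)
    case 0 then show ?thesis using C by (simp add: wt_def)
  next
    case (Suc n)
    have "cmod (\<Sum>i\<le>n. c i * of_real (gauss_ser (-1/2) $ (n - i))) \<le> (\<Sum>i\<le>n. C * (wt t i * (1 / sqrt (fact (n - i)))))"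
    proof (rule sum_norm_le)
      fix i
      have "cmod (c i * of_real (gauss_ser (-1/2) $ (n - i))) \<le> (C * wt t i) * (1 / sqrt (fact (n - i)))"
        unfolding norm_mult norm_of_real
        using C t by (intro mult_mono tbound_D[OF c] abs_gauss_ser_half mult_nonneg_nonneg wt_nonneg) auto
      then show "cmod (c i * of_real (gauss_ser (-1/2) $ (n - i))) \<le> C * (wt t i * (1 / sqrt (fact (n - i))))"
        by simp
    qed
    also have "\<dots> \<le> C * sqrt (real (Suc n) * (1 + t) ^ n / fact n)"
      unfolding sum_distrib_left[symmetric] by (intro mult_left_mono gauss_convolution_bound t C)
    finally have S: "cmod (\<Sum>i\<le>n. c i * of_real (gauss_ser (-1/2) $ (n - i))) \<le> C * sqrt (real (Suc n) * (1 + t) ^ n / fact n)" .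
    have pi1: "sqrt (2 * pi) \<ge> 1" using pi_gt3 by simp
    have "cmod (volterra \<rho> c m) = cmod \<rho> ^ Suc n / real (Suc n) * cmod (\<Sum>i\<le>n. c i * of_real (gauss_ser (-1/2) $ (n - i))) / sqrt (2 * pi)"
      unfolding Suc volterra_Suc norm_mult norm_divide norm_minus_cancel norm_power norm_of_nat norm_of_real
      by simp
    also have "\<dots> \<le> cmod \<rho> ^ Suc n / real (Suc n) * cmod (\<Sum>i\<le>n. c i * of_real (gauss_ser (-1/2) $ (n - i))) / 1"
      using pi1 by (intro divide_left_mono) auto
    also have "\<dots> \<le> cmod \<rho> ^ Suc n / real (Suc n) * (C * sqrt (real (Suc n) * (1 + t) ^ n / fact n))"
      unfolding div_by_1 by (intro mult_left_mono S) auto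
    also have "\<dots> = C * sqrt ((cmod \<rho> ^ Suc n / real (Suc n))\<^sup>2 * (real (Suc n) * (1 + t) ^ n / fact n))"
      unfolding real_sqrt_mult[of "_\<^sup>2"] by simp
    also have "(cmod \<rho> ^ Suc n / real (Suc n))\<^sup>2 * (real (Suc n) * (1 + t) ^ n / fact n) =
        ((cmod \<rho>)\<^sup>2) ^ Suc n * (1 + t) ^ n / fact (Suc n)"
      unfolding fact_Suc of_nat_mult power_divide power_mult[symmetric] mult.commute[of _ 2]
      by (simp add: power2_eq_square[of "1 + real n"] divide_simps of_nat_Suc flip: power_mult)
    also have "C * sqrt (\<dots>) \<le> C * wt ((cmod \<rho>)\<^sup>2 * (1 + t)) m"
    proof -
      have "(1 + t) ^ n \<le> (1 + t) ^ Suc n" using t by (intro power_increasing) auto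
      then show ?thesis unfolding wt_def Suc power_mult_distrib
        using C by (intro mult_left_mono real_sqrt_le_mono divide_right_mono) auto
    qed
    finally show ?thesis .
  qed
qed

lemma volterra_pow_lower: "i < k \<Longrightarrow> (volterra \<rho> ^^ k) c i = 0"
proof (induction k arbitrary: i)
  case (Suc k)
  have "volterra \<rho> ((volterra \<rho> ^^ k) c) i = volterra \<rho> (\<lambda>n. 0) i"
    using Suc by (intro volterra_cong) auto
  then show ?case by (simp add: volterra_zero)
qed simp

lemma wt_scale: "0 \<le> k \<Longrightarrow> wt (k\<^sup>2 * t) n = k ^ n * wt t n"
  by (simp add: wt_def power_mult_distrib real_sqrt_mult real_sqrt_divide power_mult[symmetric] mult.commute[of 2])
    (simp add: power_mult)

text \<open>Each application lowers the rate from \<open>t\<close> to \<open>\<kappa>\<^sup>2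
  t\<close>, which gains \<open>\<kappa>\<^sup>n\<close> at index \<open>n\<close>. The
  \<open>k\<close>-th power vanishes below index \<open>k\<close>, so the gain in the
  \<open>k\<close>-th step is at least \<open>\<kappa>\<^sup>k\<close>: the operator is
  quasi-nilpotent, with super-exponentially small powers.\<close>

lemma volterra_pow_tbound:
  assumes c: "tbound t C c" and t: "0 \<le> t" and k: "0 \<le> \<kappa>" "\<kappa> \<le> 1" "(cmod \<rho>)\<^sup>2 * (1 + t) \<le> \<kappa>\<^sup>2 * t"
  shows "tbound t (C * \<kappa> ^ (\<Sum>{..k})) ((volterra \<rho> ^^ k) c)"
proof (induction k)
  case 0 show ?case using c by simp
next
  case (Suc k)
  let ?C = "C * \<kappa> ^ (\<Sum>{..k})"
  have C: "0 \<le> ?C" using Suc by (rule tbound_nonneg)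
  have 1: "tbound (\<kappa>\<^sup>2 * t) ?C ((volterra \<rho> ^^ Suc k) c)"
    using tbound_mono[OF volterra_tbound[OF Suc t] _ k(3) order_refl] t by simp
  show ?case unfolding tbound_def
  proof (intro conjI allI)
    show "0 \<le> C * \<kappa> ^ \<Sum>{..Suc k}" using k tbound_nonneg[OF c] by simp
    fix n show "cmod ((volterra \<rho> ^^ Suc k) c n) \<le> C * \<kappa> ^ \<Sum>{..Suc k} * wt t n"
    proof (cases "n < Suc k")
      case True then show ?thesis using volterra_pow_lower[OF True, of \<rho> c] k t tbound_nonneg[OF c]
        by (simp add: wt_nonneg)
    next
      case False
      have "cmod ((volterra \<rho> ^^ Suc k) c n) \<le> ?C * (\<kappa> ^ n * wt t n)"
        using tbound_D[OF 1, of n] k by (simp add: wt_scale)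
      also have "\<dots> \<le> ?C * (\<kappa> ^ Suc k * wt t n)"
        using C t k False by (intro mult_left_mono mult_right_mono power_decreasing wt_nonneg) auto
      finally show ?thesis by (simp add: power_add mult_ac)
    qed
  qed
qed

lemma summable_triangular_power:
  fixes \<kappa> W :: real assumes "0 \<le> \<kappa>" "\<kappa> < 1"
  shows "summable (\<lambda>k. W ^ k * \<kappa> ^ (\<Sum>{..k}))"
proof -
  have "(\<lambda>k. \<bar>W\<bar> * \<kappa> ^ Suc k) \<longlonglongrightarrow> \<bar>W\<bar> * 0"
    by (intro tendsto_intros LIMSEQ_Suc LIMSEQ_power_zero) (use assms in auto)
  then have "\<forall>\<^sub>F k in sequentially. \<bar>W\<bar> * \<kappa> ^ Suc k < 1/2"
    by (intro order_tendstoD(2)) auto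
  then obtain N where N: "\<And>k. k \<ge> N \<Longrightarrow> \<bar>W\<bar> * \<kappa> ^ Suc k < 1/2"
    by (auto simp: eventually_sequentially)
  show ?thesis
  proof (rule summable_ratio_test[of "1/2" N])
    fix k assume "N \<le> k"
    have "norm (W ^ Suc k * \<kappa> ^ \<Sum>{..Suc k}) = (\<bar>W\<bar> * \<kappa> ^ Suc k) * norm (W ^ k * \<kappa> ^ \<Sum>{..k})"
      using assms by (simp add: abs_mult power_abs power_add)
    also have "\<dots> \<le> 1/2 * norm (W ^ k * \<kappa> ^ \<Sum>{..k})"
      using N[OF \<open>N \<le> k\<close>] by (intro mult_right_mono) auto
    finally show "norm (W ^ Suc k * \<kappa> ^ \<Sum>{..Suc k}) \<le> 1/2 * norm (W ^ k * \<kappa> ^ \<Sum>{..k})" .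
  qed simp
qed

text \<open>The Neumann series of \<open>(1 - w A)\<^bsup>-1\<^esup>\<close>. As \<open>A\<close>
  is strictly lower triangular, each coefficient is a finite sum.\<close>

definition neumann :: "complex \<Rightarrow> complex \<Rightarrow> (nat \<Rightarrow> complex) \<Rightarrow> nat \<Rightarrow> complex" where
  "neumann \<rho> w c n = (\<Sum>k\<le>n. w ^ k * (volterra \<rho> ^^ k) c n)"

lemma neumann_extend: "n \<le> m \<Longrightarrow> neumann \<rho> w c n = (\<Sum>k\<le>m. w ^ k * (volterra \<rho> ^^ k) c n)"
  unfolding neumann_def by (rule sum.mono_neutral_left) (auto simp: volterra_pow_lower)

lemma neumann_fixpoint: "neumann \<rho> w c n = c n + w * volterra \<rho> (neumann \<rho> w c) n"
proof -
  have "volterra \<rho> (neumann \<rho> w c) n = volterra \<rho> (\<lambda>i. \<Sum>k\<le>n. w ^ k * (volterra \<rho> ^^ k) c i) n"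
    by (intro volterra_cong neumann_extend) auto
  also have "\<dots> = (\<Sum>k\<le>n. w ^ k * (volterra \<rho> ^^ Suc k) c n)"
    by (simp add: volterra_sum volterra_cmult)
  finally have "c n + w * volterra \<rho> (neumann \<rho> w c) n = (\<Sum>k\<le>Suc n. w ^ k * (volterra \<rho> ^^ k) c n)"
    by (subst sum.atMost_Suc_shift) (simp add: sum_distrib_left mult.assoc)
  then show ?thesis using neumann_extend[of n "Suc n" \<rho> w c] by simp
qed

text \<open>Strict triangularity: the equation determines the coefficients one after the
  other.\<close>

lemma volterra_fixpoint_unique:
  assumes "\<And>n. c n = g n + w * volterra \<rho> c n" "\<And>n. d n = g n + w * volterra \<rho> d n"
  shows "c n = d n"
proof (induction n rule: less_induct)
  case (less n)
  then have "volterra \<rho> c n = volterra \<rho> d n" by (intro volterra_cong)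
  then show ?case using assms by metis
qed

lemma neumann_tbound:
  assumes c: "tbound t C c" and t: "0 \<le> t" and k: "0 \<le> \<kappa>" "\<kappa> < 1" "(cmod \<rho>)\<^sup>2 * (1 + t) \<le> \<kappa>\<^sup>2 * t"
  shows "tbound t (C * (\<Sum>k. cmod w ^ k * \<kappa> ^ (\<Sum>{..k}))) (neumann \<rho> w c)"
proof -
  let ?S = "\<Sum>k. cmod w ^ k * \<kappa> ^ (\<Sum>{..k})"
  have s: "summable (\<lambda>k. cmod w ^ k * \<kappa> ^ (\<Sum>{..k}))" by (rule summable_triangular_power) (use k in auto)
  have C: "0 \<le> C" using c by (rule tbound_nonneg)
  have S: "0 \<le> ?S" using s k by (intro suminf_nonneg) auto
  show ?thesis unfolding tbound_def
  proof (intro conjI allI)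
    show "0 \<le> C * ?S" using C S by simp
    fix n
    have "cmod (neumann \<rho> w c n) \<le> (\<Sum>k\<le>n. cmod w ^ k * \<kappa> ^ (\<Sum>{..k}) * (C * wt t n))"
      unfolding neumann_def
    proof (rule sum_norm_le)
      fix j
      have "cmod ((volterra \<rho> ^^ j) c n) \<le> C * \<kappa> ^ (\<Sum>{..j}) * wt t n"
        using k by (intro tbound_D[OF volterra_pow_tbound[OF c t]]) auto
      then have "cmod w ^ j * cmod ((volterra \<rho> ^^ j) c n) \<le> cmod w ^ j * (C * \<kappa> ^ (\<Sum>{..j}) * wt t n)"
        by (intro mult_left_mono) auto
      then show "cmod (w ^ j * (volterra \<rho> ^^ j) c n) \<le> cmod w ^ j * \<kappa> ^ (\<Sum>{..j}) * (C * wt t n)"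
        by (simp add: norm_mult norm_power mult_ac)
    qed
    also have "\<dots> = (\<Sum>k\<le>n. cmod w ^ k * \<kappa> ^ (\<Sum>{..k})) * (C * wt t n)" by (rule sum_distrib_right[symmetric])
    also have "\<dots> \<le> ?S * (C * wt t n)"
      using C t k by (intro mult_right_mono sum_le_suminf s mult_nonneg_nonneg wt_nonneg) auto
    finally show "cmod (neumann \<rho> w c n) \<le> C * ?S * wt t n" by (simp add: mult_ac)
  qed
qed

section \<open>From Taylor coefficients to functions\<close>

definition tfun :: "(nat \<Rightarrow> complex) \<Rightarrow> real \<Rightarrow> complex" where
  "tfun c x = (\<Sum>n. c n * of_real (x ^ n))"

lemma tfun_summable: "tbound t C c \<Longrightarrow> 0 \<le> t \<Longrightarrow> summable (\<lambda>n. cmod (c n * of_real (x ^ n)))"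
  using tbound_summable[of t C c "of_real x"] by simp

lemma tfun_sums: "tbound t C c \<Longrightarrow> 0 \<le> t \<Longrightarrow> (\<lambda>n. c n * of_real (x ^ n)) sums tfun c x"
  unfolding tfun_def by (intro summable_sums summable_norm_cancel[OF tfun_summable])

lemma tfun_one: "tfun one_co x = 1"
proof -
  have "(\<lambda>n. one_co n * of_real (x ^ n)) sums (\<Sum>n\<in>{0}. one_co n * of_real (x ^ n))"
    by (rule sums_finite) (auto simp: one_co_def)
  then show ?thesis unfolding tfun_def by (simp add: sums_iff one_co_def)
qed

lemma tfun_add: "tbound t C c \<Longrightarrow> tbound t D d \<Longrightarrow> 0 \<le> t \<Longrightarrow> tfun (\<lambda>n. c n + d n) x = tfun c x + tfun d x"
  using sums_add[OF tfun_sums[of t C c x] tfun_sums[of t D d x]]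
  by (simp add: tfun_def sums_iff distrib_right)

lemma tfun_cmult: "tbound t C c \<Longrightarrow> 0 \<le> t \<Longrightarrow> tfun (\<lambda>n. z * c n) x = z * tfun c x"
  using sums_mult[OF tfun_sums[of t C c x], of z]
  by (simp add: tfun_def sums_iff mult.assoc)

lemma tfun_at_0: "tfun c 0 = c 0"
proof -
  have "(\<lambda>n. c n * of_real (0 ^ n)) sums (\<Sum>n\<in>{0}. c n * of_real (0 ^ n))"
    by (rule sums_finite) auto
  then show ?thesis unfolding tfun_def by (simp add: sums_iff)
qed

text \<open>The zeros of a non-zero power series do not accumulate at \<open>0\<close>, so its
  values on the real line determine it.\<close>

lemma tfun_unique:
  assumes c: "tbound t C c" and d: "tbound t D d" and t: "0 \<le> t" and eq: "\<And>x. tfun c x = tfun d x"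
  shows "c = d"
proof
  fix m
  define a where "a = (\<lambda>n. c n - d n)"
  have s: "summable (\<lambda>n. a n * z ^ n)" for z
    unfolding a_def left_diff_distrib
    by (intro summable_diff summable_norm_cancel[OF tbound_summable[OF c t]] summable_norm_cancel[OF tbound_summable[OF d t]])
  have z: "(\<Sum>n. a n * of_real x ^ n) = 0" for x :: real
    using sums_diff[OF tfun_sums[OF c t, of x] tfun_sums[OF d t, of x]] eq[of x]
    by (simp add: a_def left_diff_distrib sums_iff)
  have a0: "a 0 = 0" using eq[of 0] by (simp add: a_def tfun_at_0)
  show "c m = d m"
  proof (rule ccontr)
    assume "c m \<noteq> d m"
    then have am: "a m \<noteq> 0" by (simp add: a_def)
    with a0 have "m > 0" by (metis gr0I)
    obtain s where s0: "0 < s" "\<And>z. z \<in> cball 0 s - {0} \<Longrightarrow> (\<Sum>n. a n * z ^ n) \<noteq> 0"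
    proof (rule powser_0_nonzero[of 1 0 a "\<lambda>z. \<Sum>n. a n * z ^ n" m])
      show "(\<lambda>n. a n * (x - 0) ^ n) sums (\<Sum>n. a n * x ^ n)" for x
        using s[of x] by (simp add: summable_sums)
      show "(\<Sum>n. a n * 0 ^ n) = 0" using z[of 0] by simp
    qed (use am \<open>m > 0\<close> in auto)
    show False using s0(2)[of "of_real s"] s0(1) z[of s] by simp
  qed
qed

lemma gauss_ser_sums: "(\<lambda>n. gauss_ser a $ n * x ^ n) sums exp (a * x\<^sup>2 :: real)"
proof -
  have "(\<lambda>j. (a * x\<^sup>2) ^ j /\<^sub>R fact j) sums exp (a * x\<^sup>2)" by (rule exp_converges)
  also have "(\<lambda>j. (a * x\<^sup>2) ^ j /\<^sub>R fact j) = (\<lambda>j. gauss_ser a $ (2 * j) * x ^ (2 * j))"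
    by (auto simp: gauss_ser_def power_mult_distrib power_mult divide_simps)
  also have "(\<dots> sums exp (a * x\<^sup>2)) \<longleftrightarrow> ?thesis"
  proof (rule sums_mono_reindex[of "\<lambda>j. 2 * j"])
    fix n :: nat assume "n \<notin> range (\<lambda>j. 2 * j)"
    then have "odd n" by (metis evenE rangeI)
    then show "gauss_ser a $ n * x ^ n = 0" by (simp add: gauss_ser_def)
  qed (simp add: strict_mono_def)
  finally show ?thesis .
qed

lemma gauss_ser_abs_summable: "summable (\<lambda>n. \<bar>gauss_ser a $ n * x ^ n\<bar>)" for a x :: real
proof -
  have "\<bar>gauss_ser a $ n * x ^ n\<bar> = gauss_ser \<bar>a\<bar> $ n * \<bar>x\<bar> ^ n" for n
    by (simp add: gauss_ser_def abs_mult power_abs)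
  then show ?thesis using sums_summable[OF gauss_ser_sums] by simp
qed

text \<open>The Taylor coefficients of the product of a function with the standard normal
  density.\<close>

definition gauss_prod :: "(nat \<Rightarrow> complex) \<Rightarrow> nat \<Rightarrow> complex" where
  "gauss_prod c n = (\<Sum>i\<le>n. c i * of_real (gauss_ser (-1/2) $ (n - i))) / of_real (sqrt (2 * pi))"

lemma gauss_prod_sums:
  assumes "tbound t C c" "0 \<le> t"
  shows "(\<lambda>n. gauss_prod c n * of_real (x ^ n)) sums (tfun c x * of_real (std_normal_density x))"
proof -
  let ?b = "\<lambda>n. complex_of_real (gauss_ser (-1/2) $ n * x ^ n)"
  have b: "summable (\<lambda>n. cmod (?b n))" using gauss_ser_abs_summable[of "-1/2" x] by (simp only: norm_of_real)
  have bs: "(\<Sum>n. ?b n) = of_real (exp (- x\<^sup>2 / 2))"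
    using sums_of_real[OF gauss_ser_sums[of "-1/2" x], where 'a = complex] by (simp add: sums_iff)
  have "(\<lambda>k. \<Sum>i\<le>k. (c i * of_real (x ^ i)) * ?b (k - i)) sums (tfun c x * (\<Sum>n. ?b n))"
    unfolding tfun_def by (rule Cauchy_product_sums[OF tfun_summable[OF assms] b])
  then have "(\<lambda>k. (\<Sum>i\<le>k. (c i * of_real (x ^ i)) * ?b (k - i)) / of_real (sqrt (2 * pi)))
      sums (tfun c x * of_real (exp (- x\<^sup>2 / 2)) / of_real (sqrt (2 * pi)))"
    unfolding bs by (rule sums_divide)
  also have "(\<lambda>k. (\<Sum>i\<le>k. (c i * of_real (x ^ i)) * ?b (k - i)) / of_real (sqrt (2 * pi))) =
      (\<lambda>n. gauss_prod c n * of_real (x ^ n))"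
  proof
    fix k
    have "(\<Sum>i\<le>k. (c i * of_real (x ^ i)) * ?b (k - i)) = (\<Sum>i\<le>k. c i * of_real (gauss_ser (-1/2) $ (k - i)) * of_real (x ^ k))"
    proof (intro sum.cong refl)
      fix i assume "i \<in> {..k}"
      then have "x ^ k = x ^ i * x ^ (k - i)" by (simp flip: power_add)
      then show "(c i * of_real (x ^ i)) * ?b (k - i) = c i * of_real (gauss_ser (-1/2) $ (k - i)) * of_real (x ^ k)"
        by simp
    qed
    then show "(\<Sum>i\<le>k. (c i * of_real (x ^ i)) * ?b (k - i)) / of_real (sqrt (2 * pi)) = gauss_prod c k * of_real (x ^ k)"
      by (simp add: gauss_prod_def sum_distrib_right)
  qed
  finally show ?thesis by (simp add: std_normal_density_def)
qed

lemma volterra_minus1: "volterra (-1) c (Suc n) = - gauss_prod c n / of_nat (Suc n)"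
  by (simp add: volterra_Suc gauss_prod_def)

lemma volterra_scale: "volterra \<rho> c m = (- \<rho>) ^ m * volterra (-1) c m"
  by (cases m) (simp_all add: volterra_Suc mult.assoc)

text \<open>The parameter only rescales the argument, which reduces the identification of
  \<open>volterra\<close> with an integral to the parameter \<open>-1\<close>.\<close>

lemma tfun_volterra: "tfun (volterra (of_real \<rho>) c) x = tfun (volterra (-1) c) (- \<rho> * x)"
  unfolding tfun_def
proof (rule suminf_cong)
  fix n
  have "complex_of_real ((- \<rho> * x) ^ n) = (- of_real \<rho>) ^ n * of_real (x ^ n)"
    by (simp only: power_mult_distrib of_real_mult of_real_power of_real_minus)
  then show "volterra (of_real \<rho>) c n * of_real (x ^ n) = volterra (-1) c n * of_real ((- \<rho> * x) ^ n)"
    by (subst volterra_scale) (simp only: mult_ac)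
qed

lemma tfun_volterra_deriv:
  assumes c: "tbound t C c" "0 \<le> t"
  shows "(tfun (volterra (-1) c) has_vector_derivative - (tfun c y * of_real (std_normal_density y))) (at y within S)"
proof -
  let ?a = "volterra (-1) c"
  have "summable (\<lambda>n. ?a n * z ^ n)" for z
    using summable_norm_cancel[OF tbound_summable[OF volterra_tbound[OF c, of "-1"]]] c(2) by simp
  from termdiffs_strong_converges_everywhere[OF this]
  have "((\<lambda>z. \<Sum>n. ?a n * z ^ n) has_field_derivative (\<Sum>n. diffs ?a n * (of_real y) ^ n)) (at (of_real y))" .
  also have "(\<Sum>n. diffs ?a n * (of_real y) ^ n) = - (tfun c y * of_real (std_normal_density y))"
  proof -
    have "diffs ?a n * of_real y ^ n = - (gauss_prod c n * of_real (y ^ n))" for n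
      by (simp add: diffs_def volterra_minus1 del: of_nat_Suc)
    then show ?thesis using sums_minus[OF gauss_prod_sums[OF c, of y]] by (simp add: sums_iff)
  qed
  finally have "((\<lambda>z. \<Sum>n. ?a n * z ^ n) has_field_derivative - (tfun c y * of_real (std_normal_density y))) (at (of_real y))" .
  from has_vector_derivative_real_field[OF this]
  have "((\<lambda>y. \<Sum>n. ?a n * of_real y ^ n) has_vector_derivative - (tfun c y * of_real (std_normal_density y))) (at y within S)" .
  then show ?thesis unfolding tfun_def[abs_def] by simp
qed

lemma tfun_continuous:
  assumes c: "tbound t C c" "0 \<le> t"
  shows "continuous_on S (tfun c)"
proof -
  have "summable (\<lambda>n. c n * z ^ n)" for z
    using summable_norm_cancel[OF tbound_summable[OF c]] by simp
  from termdiffs_strong_converges_everywhere[OF this]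
  have "isCont (\<lambda>z. \<Sum>n. c n * z ^ n) z" for z by (rule DERIV_isCont)
  then have "continuous_on UNIV (\<lambda>z. \<Sum>n. c n * z ^ n)" by (simp add: continuous_at_imp_continuous_on)
  then have "continuous_on S (\<lambda>x. \<Sum>n. c n * of_real x ^ n)"
    by (rule continuous_on_compose2) (auto intro: continuous_intros)
  then show ?thesis unfolding tfun_def[abs_def] by simp
qed

lemma set_lebesgue_integral_atLeast_split:
  fixes g :: "real \<Rightarrow> complex"
  assumes g: "integrable lborel g" and ab: "a \<le> b"
  shows "(LINT y:{a..}|lborel. g y) = (LINT y:{a..b}|lborel. g y) + (LINT y:{b..}|lborel. g y)"
proof -
  have si: "set_integrable lborel A g" if "A \<in> sets borel" for A
    unfolding set_integrable_def using that g by (intro integrable_mult_indicator) auto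
  have "{a..} = {a..b} \<union> {b..}" using ab by auto
  moreover have "AE y in lborel. \<not> (y \<in> {a..b} \<and> y \<in> {b..})"
    using AE_lborel_singleton[of b] by eventually_elim auto
  ultimately show ?thesis by (auto intro!: set_integral_Un_AE si)
qed

definition half_mean :: "(real \<Rightarrow> complex) \<Rightarrow> complex" where
  "half_mean f = (LINT y:{0..}|lborel. f y * complex_of_real (std_normal_density y))"

text \<open>The rank-one decomposition \<open>T f = \<ell>(f) 1 + A f\<close>: split the integral
  at \<open>0\<close> and use the fundamental theorem of calculus on the bounded part.\<close>

lemma T_op_tfun:
  assumes c: "tbound t C c" "0 \<le> t"
    and int: "integrable lborel (\<lambda>y. tfun c y * complex_of_real (std_normal_density y))"
  shows "T_op \<rho> (tfun c) x = half_mean (tfun c) + tfun (volterra (of_real \<rho>) c) x"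
proof -
  let ?g = "\<lambda>y. tfun c y * complex_of_real (std_normal_density y)"
  let ?H = "tfun (volterra (-1) c)"
  have FTC: "(LINT y:{a..b}|lborel. ?g y) = ?H a - ?H b" if "a \<le> b" for a b
  proof -
    have "integral\<^sup>L lborel (\<lambda>x. indicator {a .. b} x *\<^sub>R ?g x) = (- ?H b) - (- ?H a)"
    proof (rule integral_FTC_atLeastAtMost[OF that])
      show "((\<lambda>y. - ?H y) has_vector_derivative ?g x) (at x within {a..b})" for x
        using has_vector_derivative_minus[OF tfun_volterra_deriv[OF c, of x "{a..b}"]] by simp
      show "continuous_on {a..b} ?g"
        unfolding std_normal_density_def by (intro continuous_intros tfun_continuous[OF c]) auto
    qed
    then show ?thesis by (simp add: set_lebesgue_integral_def)
  qed
  have H0: "?H 0 = 0" by (simp add: tfun_at_0)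
  have "(LINT y:{a..}|lborel. ?g y) = half_mean (tfun c) + ?H a" for a
  proof (cases "a \<le> 0")
    case True
    then show ?thesis using set_lebesgue_integral_atLeast_split[OF int True] FTC[OF True] H0
      by (simp add: half_mean_def)
  next
    case False
    then have "0 \<le> a" by simp
    then show ?thesis using set_lebesgue_integral_atLeast_split[OF int \<open>0 \<le> a\<close>] FTC[OF \<open>0 \<le> a\<close>] H0
      by (simp add: half_mean_def)
  qed
  then show ?thesis by (simp add: T_op_def tfun_volterra)
qed

section \<open>Orthogonality of the Hermite polynomials\<close>

lemma gauss_poly_integrable: "integrable lborel (\<lambda>x. poly p x * std_normal_density x)"
  unfolding poly_altdef sum_distrib_right
proof (rule Bochner_Integration.integrable_sum)
  fix i
  have "integrable lborel (\<lambda>x. coeff p i * (std_normal_density x * x ^ i))"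
    by (intro integrable_mult_right integrable_std_normal_moment)
  then show "integrable lborel (\<lambda>x. coeff p i * x ^ i * std_normal_density x)" by (simp add: mult_ac)
qed

lemma gauss_poly_tendsto: "((\<lambda>x. poly p x * std_normal_density x) \<longlongrightarrow> 0) at_infinity"
proof -
  have mono: "((\<lambda>x. x ^ i * std_normal_density x) \<longlongrightarrow> 0) at_infinity" for i
  proof (rule Lim_null_comparison)
    have "((\<lambda>x. norm x ^ i / exp (norm x)) \<longlongrightarrow> 0) (at_infinity :: real filter)"
      by (rule filterlim_compose[OF tendsto_power_div_exp_0 filterlim_norm_at_top])
    from tendsto_mult[OF tendsto_const[of "exp (1/2) :: real"] this]
    show "((\<lambda>x. exp (1/2) * (norm x ^ i / exp (norm x))) \<longlongrightarrow> 0) (at_infinity :: real filter)" by simp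
    show "\<forall>\<^sub>F x in at_infinity. norm (x ^ i * std_normal_density x) \<le> exp (1/2) * (norm x ^ i / exp (norm x))"
    proof (rule always_eventually, rule allI)
      fix x :: real
      have "0 \<le> (\<bar>x\<bar> - 1)\<^sup>2" by simp
      then have "- x\<^sup>2 / 2 \<le> 1/2 - \<bar>x\<bar>" by (simp add: power2_eq_square algebra_simps)
      then have e: "exp (- x\<^sup>2 / 2) \<le> exp (1/2) / exp \<bar>x\<bar>" by (simp flip: exp_diff)
      have "1 / sqrt (2 * pi) \<le> 1" using pi_gt3 by (simp add: divide_simps)
      then have "std_normal_density x \<le> 1 * (exp (1/2) / exp \<bar>x\<bar>)"
        unfolding std_normal_density_def using e by (intro mult_mono) auto
      then have "\<bar>x\<bar> ^ i * std_normal_density x \<le> \<bar>x\<bar> ^ i * (1 * (exp (1/2) / exp \<bar>x\<bar>))"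
        by (intro mult_left_mono) auto
      then show "norm (x ^ i * std_normal_density x) \<le> exp (1/2) * (norm x ^ i / exp (norm x))"
        by (simp add: abs_mult power_abs mult_ac)
    qed
  qed
  have "((\<lambda>x. \<Sum>i\<le>degree p. coeff p i * (x ^ i * std_normal_density x)) \<longlongrightarrow> (\<Sum>i\<le>degree p. coeff p i * 0)) at_infinity"
    by (intro tendsto_sum tendsto_mult tendsto_const mono)
  then show ?thesis by (simp add: poly_altdef sum_distrib_right mult.assoc)
qed

text \<open>The integrand is the derivative of \<open>p \<phi>\<close>, which vanishes at
  infinity.\<close>

lemma gauss_poly_ibp:
  "(\<integral>x. (poly (pderiv p) x - x * poly p x) * std_normal_density x \<partial>lborel) = 0"
proof -
  let ?f = "\<lambda>x. (poly (pderiv p) x - x * poly p x) * std_normal_density x"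
  let ?F = "\<lambda>x. poly p x * std_normal_density x"

  have "(LBINT x=-\<infinity>..\<infinity>. ?f x) = 0 - 0"
  proof (rule interval_integral_FTC_integrable[where F = ?F])
    fix x
    have "(?F has_real_derivative ?f x) (at x)"
      unfolding std_normal_density_def
      by (rule DERIV_cong, (rule derivative_eq_intros poly_DERIV refl | simp)+)
        (simp add: algebra_simps diff_divide_distrib)
    then show "(?F has_vector_derivative ?f x) (at x)"
      by (simp add: has_real_derivative_iff_has_vector_derivative)
    show "isCont ?f x" unfolding std_normal_density_def by (intro continuous_intros) auto
  next
    show "set_integrable lborel (einterval (-\<infinity>) \<infinity>) ?f"
      using gauss_poly_integrable[of "pderiv p - [:0, 1:] * p"] by (simp add: set_integrable_def)
    show "((?F \<circ> real_of_ereal) \<longlongrightarrow> 0) (at_right (-\<infinity>))"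
      unfolding ereal_tendsto_simps using gauss_poly_tendsto at_bot_le_at_infinity by (rule tendsto_mono[rotated])
    show "((?F \<circ> real_of_ereal) \<longlongrightarrow> 0) (at_left \<infinity>)"
      unfolding ereal_tendsto_simps using gauss_poly_tendsto at_top_le_at_infinity by (rule tendsto_mono[rotated])
  qed simp
  then show ?thesis by (simp add: interval_lebesgue_integral_def set_lebesgue_integral_def)
qed

definition herm_poly :: "nat \<Rightarrow> real poly" where
  "herm_poly n = (\<Sum>i=0..n. monom (gauss_ser (-1/2) $ (n - i) / fact i) i)"

lemma poly_herm_poly: "poly (herm_poly n) x = herm_gen x $ n"
  unfolding herm_poly_def herm_gen_nth by (simp add: poly_sum poly_monom)

lemma pderiv_herm_poly: "poly (pderiv (herm_poly n)) x = (if n = 0 then 0 else herm_gen x $ (n - 1))"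
  using DERIV_unique[OF poly_DERIV[of "herm_poly n" x]] herm_gen_deriv[of n x] unfolding poly_herm_poly by blast

text \<open>The Gaussian inner product of two Hermite polynomials, up to the factorials in
  \<open>herm_gen\<close>.\<close>

definition herm_pair :: "nat \<Rightarrow> nat \<Rightarrow> real" where
  "herm_pair m n = (\<integral>x. herm_gen x $ m * herm_gen x $ n * std_normal_density x \<partial>lborel)"

lemma herm_gen_prod_integrable: "integrable lborel (\<lambda>x. herm_gen x $ m * herm_gen x $ n * std_normal_density x)"
  using gauss_poly_integrable[of "herm_poly m * herm_poly n"] by (simp add: poly_herm_poly)

lemma herm_pair_rec: "real (Suc n) * herm_pair m (Suc n) = (if m = 0 then 0 else herm_pair (m - 1) n)"
proof -
  have "0 = (\<integral>x. (poly (pderiv (herm_poly m * herm_poly n)) x - x * poly (herm_poly m * herm_poly n) x) * std_normal_density x \<partial>lborel)"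
    by (rule gauss_poly_ibp[symmetric])
  also have "\<dots> = (\<integral>x. (if m = 0 then 0 else herm_gen x $ (m - 1)) * herm_gen x $ n * std_normal_density x
      - real (Suc n) * (herm_gen x $ m * herm_gen x $ Suc n * std_normal_density x) \<partial>lborel)"
  proof (rule Bochner_Integration.integral_cong[OF refl])
    fix x :: real
    have "poly (pderiv (herm_poly m * herm_poly n)) x - x * poly (herm_poly m * herm_poly n) x =
      (if m = 0 then 0 else herm_gen x $ (m - 1)) * herm_gen x $ n + herm_gen x $ m * ((if n = 0 then 0 else herm_gen x $ (n - 1)) - x * herm_gen x $ n)"
      by (simp add: pderiv_mult pderiv_herm_poly poly_herm_poly algebra_simps)
    also have "(if n = 0 then 0 else herm_gen x $ (n - 1)) - x * herm_gen x $ n = - (real (Suc n) * herm_gen x $ Suc n)"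
      using herm_gen_Suc[of n x] by simp
    finally have *: "poly (pderiv (herm_poly m * herm_poly n)) x - x * poly (herm_poly m * herm_poly n) x =
      (if m = 0 then 0 else herm_gen x $ (m - 1)) * herm_gen x $ n - real (Suc n) * (herm_gen x $ m * herm_gen x $ Suc n)"
      by simp
    show "(poly (pderiv (herm_poly m * herm_poly n)) x - x * poly (herm_poly m * herm_poly n) x) * std_normal_density x =
      (if m = 0 then 0 else herm_gen x $ (m - 1)) * herm_gen x $ n * std_normal_density x
      - real (Suc n) * (herm_gen x $ m * herm_gen x $ Suc n * std_normal_density x)"
      unfolding * by (simp only: left_diff_distrib mult.assoc)
  qed
  also have "\<dots> = (if m = 0 then 0 else herm_pair (m - 1) n) - real (Suc n) * herm_pair m (Suc n)"
    unfolding herm_pair_def by (cases "m = 0") (simp_all add: herm_gen_prod_integrable)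
  finally show ?thesis by simp
qed

lemma herm_pair_eq: "herm_pair m n = (if m = n then 1 / fact n else 0)"
proof (induction n arbitrary: m)
  case 0
  have "herm_pair 0 0 = 1"
    using integral_std_normal_moment_even[of 0] by (simp add: herm_pair_def herm_gen_nth gauss_ser_0)
  moreover have "herm_pair (Suc k) 0 = 0" for k
    using herm_pair_rec[of k 0] by (simp add: herm_pair_def mult.commute)
  ultimately show ?case by (cases m) auto
next
  case (Suc n)
  have "herm_pair m (Suc n) = (if m = 0 then 0 else herm_pair (m - 1) n) / real (Suc n)"
    using herm_pair_rec[of n m] by (simp add: field_simps)
  then show ?case using Suc[of "m - 1"] by (cases m) auto
qed

lemma hermite_orthonormal:
  "integrable lborel (\<lambda>x. hermite_normed m x * hermite_normed n x * std_normal_density x)"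
  "(\<integral>x. hermite_normed m x * hermite_normed n x * std_normal_density x \<partial>lborel) = (if m = n then 1 else 0)"
proof -
  have e: "hermite_normed m x * hermite_normed n x * std_normal_density x =
     (sqrt (fact m) * sqrt (fact n)) * (herm_gen x $ m * herm_gen x $ n * std_normal_density x)" for x
    by (simp add: hermite_normed_eq mult_ac)
  show "integrable lborel (\<lambda>x. hermite_normed m x * hermite_normed n x * std_normal_density x)"
    unfolding e by (intro integrable_mult_right herm_gen_prod_integrable)
  have "(\<integral>x. hermite_normed m x * hermite_normed n x * std_normal_density x \<partial>lborel) = (sqrt (fact m) * sqrt (fact n)) * herm_pair m n"
    unfolding e herm_pair_def by simp
  then show "(\<integral>x. hermite_normed m x * hermite_normed n x * std_normal_density x \<partial>lborel) = (if m = n then 1 else 0)"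
    by (simp add: herm_pair_eq)
qed

lemma hermite_abs_integral_le:
  "(\<integral>x. \<bar>hermite_normed m x * hermite_normed n x * std_normal_density x\<bar> \<partial>lborel) \<le> 1"
proof -
  have "(\<integral>x. \<bar>hermite_normed m x * hermite_normed n x * std_normal_density x\<bar> \<partial>lborel) \<le>
    (\<integral>x. (hermite_normed m x * hermite_normed m x * std_normal_density x + hermite_normed n x * hermite_normed n x * std_normal_density x) / 2 \<partial>lborel)"
  proof (rule integral_mono)
    fix x :: real
    have "0 \<le> (\<bar>hermite_normed m x\<bar> - \<bar>hermite_normed n x\<bar>)\<^sup>2" by simp
    then have "\<bar>hermite_normed m x * hermite_normed n x\<bar> \<le> (hermite_normed m x * hermite_normed m x + hermite_normed n x * hermite_normed n x) / 2"
      by (simp add: power2_eq_square algebra_simps abs_mult)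
    then have "\<bar>hermite_normed m x * hermite_normed n x\<bar> * std_normal_density x \<le> (hermite_normed m x * hermite_normed m x + hermite_normed n x * hermite_normed n x) / 2 * std_normal_density x"
      by (intro mult_right_mono) auto
    then show "\<bar>hermite_normed m x * hermite_normed n x * std_normal_density x\<bar> \<le> (hermite_normed m x * hermite_normed m x * std_normal_density x + hermite_normed n x * hermite_normed n x * std_normal_density x) / 2"
      by (simp add: abs_mult algebra_simps)
  qed (intro integrable_abs hermite_orthonormal Bochner_Integration.integrable_add integrable_divide)+
  also have "\<dots> = 1" by (simp add: hermite_orthonormal)
  finally show ?thesis .
qed

section \<open>The Hilbert space in terms of coefficients\<close>

definition herm_sqnorm :: "real \<Rightarrow> (nat \<Rightarrow> complex) \<Rightarrow> real" where
  "herm_sqnorm q a = (\<Sum>n. (cmod (a n))\<^sup>2 / q ^ n)"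

lemma herm_sqnorm_nonneg: "0 < q \<Longrightarrow> hermite_expansion q f a \<Longrightarrow> 0 \<le> herm_sqnorm q a"
  unfolding herm_sqnorm_def hermite_expansion_def by (intro suminf_nonneg) auto

lemma hermite_expansion_coeff_le:
  assumes h: "hermite_expansion q f a" and q: "0 < q"
  shows "cmod (a n) \<le> sqrt (herm_sqnorm q a) * sqrt (q ^ n)"
proof -
  have s: "summable (\<lambda>n. (cmod (a n))\<^sup>2 / q ^ n)" using h by (simp add: hermite_expansion_def)
  have "(cmod (a n))\<^sup>2 / q ^ n \<le> herm_sqnorm q a"
    using sum_le_suminf[OF s, of "{n}"] q by (simp add: herm_sqnorm_def)
  then have "(cmod (a n))\<^sup>2 \<le> herm_sqnorm q a * q ^ n" using q by (simp add: divide_simps)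
  then have "cmod (a n) \<le> sqrt (herm_sqnorm q a * q ^ n)" by (rule real_le_rsqrt)
  then show ?thesis by (simp add: real_sqrt_mult)
qed

text \<open>Orthonormality bounds each term of the expansion in mean, and a square-summable
  sequence with the weights \<open>q\<^bsup>-n\<^esup>\<close> is absolutely summable, so
  integration and summation commute. The weight \<open>g\<close> is a Hermite polynomial when
  coefficients are extracted, and an indicator function or \<open>1\<close> when functionals are
  bounded.\<close>

lemma hermite_expansion_weighted_integral:
  fixes g :: "real \<Rightarrow> real"
  assumes h: "hermite_expansion q f a" and q: "0 < q" "q < 1"
    and g [measurable]: "g \<in> borel_measurable borel" and gk: "\<And>x. \<bar>g x\<bar> \<le> \<bar>hermite_normed k x\<bar>"
  shows "integrable lborel (\<lambda>x. f x * of_real (g x * std_normal_density x))"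
    and "(\<lambda>n. a n * of_real (\<integral>x. hermite_normed n x * g x * std_normal_density x \<partial>lborel)) sums
      (\<integral>x. f x * of_real (g x * std_normal_density x) \<partial>lborel)"
    and "cmod (\<integral>x. f x * of_real (g x * std_normal_density x) \<partial>lborel) \<le> sqrt (herm_sqnorm q a) * (1 / (1 - sqrt q))"
proof -
  have meas [measurable]: "hermite_normed n \<in> borel_measurable borel" for n
    unfolding hermite_normed_eq[abs_def] poly_herm_poly[symmetric]
    by (intro borel_measurable_continuous_onI continuous_intros)
  let ?F = "\<lambda>n x. a n * of_real (hermite_normed n x * g x * std_normal_density x)"
  have le: "\<bar>hermite_normed n x * g x * std_normal_density x\<bar> \<le> \<bar>hermite_normed n x * hermite_normed k x * std_normal_density x\<bar>" for n x
    unfolding abs_mult by (intro mult_right_mono mult_left_mono gk) auto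
  have intr: "integrable lborel (\<lambda>x. hermite_normed n x * g x * std_normal_density x)" for n
    by (rule Bochner_Integration.integrable_bound[OF hermite_orthonormal(1)[of n k]]) (use le in auto)
  have i1: "(\<integral>x. \<bar>hermite_normed n x * g x * std_normal_density x\<bar> \<partial>lborel) \<le> 1" for n
  proof -
    have "(\<integral>x. \<bar>hermite_normed n x * g x * std_normal_density x\<bar> \<partial>lborel) \<le>
      (\<integral>x. \<bar>hermite_normed n x * hermite_normed k x * std_normal_density x\<bar> \<partial>lborel)"
      by (intro integral_mono integrable_abs intr hermite_orthonormal le)
    then show ?thesis using hermite_abs_integral_le[of n k] by linarith
  qed
  have int: "integrable lborel (?F n)" for n
    by (intro integrable_mult_right integrable_of_real intr)
  have sgeo: "summable (\<lambda>n. sqrt (herm_sqnorm q a) * sqrt q ^ n)"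
    using q by (intro summable_mult summable_geometric) auto
  have an: "cmod (a n) \<le> sqrt (herm_sqnorm q a) * sqrt q ^ n" for n
    using hermite_expansion_coeff_le[OF h q(1), of n] by (simp add: real_sqrt_power)
  have nF: "(\<integral>x. norm (?F n x) \<partial>lborel) \<le> sqrt (herm_sqnorm q a) * sqrt q ^ n" for n
  proof -
    have "(\<integral>x. norm (?F n x) \<partial>lborel) = cmod (a n) * (\<integral>x. \<bar>hermite_normed n x * g x * std_normal_density x\<bar> \<partial>lborel)"
      by (simp add: norm_mult flip: of_real_mult)
    also have "\<dots> \<le> cmod (a n) * 1" by (intro mult_left_mono i1) auto
    finally show ?thesis using an[of n] by simp
  qed
  have sn: "summable (\<lambda>n. \<integral>x. norm (?F n x) \<partial>lborel)"
    by (rule summable_comparison_test'[OF sgeo, of 0]) (use nF in \<open>simp add: integral_nonneg_AE\<close>)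
  obtain \<tau> where tau: "q / (1 - q) < \<tau>" using gt_ex by blast
  have sx: "summable (\<lambda>m. cmod (a m * of_real (hermite_normed m x)))" for x
    by (rule herm_taylor(3)[OF q tau, of "sqrt (herm_sqnorm q a)"])
      (use hermite_expansion_coeff_le[OF h q(1)] herm_sqnorm_nonneg[OF q(1) h] in auto)
  have nFx: "norm (?F n x) = cmod (a n * of_real (hermite_normed n x)) * \<bar>g x * std_normal_density x\<bar>" for n x
    by (simp add: norm_mult abs_mult)
  have AE: "AE x in lborel. summable (\<lambda>n. norm (?F n x))"
    unfolding nFx by (intro AE_I2 summable_mult2 sx)
  have sumF: "(\<Sum>n. ?F n x) = f x * of_real (g x * std_normal_density x)" for x
  proof -
    have "(\<lambda>n. a n * of_real (hermite_normed n x)) sums f x"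
      using h by (simp add: hermite_expansion_def)
    from sums_mult2[OF this, of "of_real (g x * std_normal_density x)"]
    show ?thesis by (simp add: sums_iff mult.assoc)
  qed
  show "integrable lborel (\<lambda>x. f x * of_real (g x * std_normal_density x))"
    using integrable_suminf[OF int AE sn] unfolding sumF .
  have Fint: "(\<integral>x. ?F n x \<partial>lborel) = a n * of_real (\<integral>x. hermite_normed n x * g x * std_normal_density x \<partial>lborel)" for n
    by (simp only: integral_mult_right_zero integral_complex_of_real)
  show S: "(\<lambda>n. a n * of_real (\<integral>x. hermite_normed n x * g x * std_normal_density x \<partial>lborel)) sums
      (\<integral>x. f x * of_real (g x * std_normal_density x) \<partial>lborel)"
    using sums_integral[OF int AE sn] unfolding sumF Fint .
  have "cmod (a n * of_real (\<integral>x. hermite_normed n x * g x * std_normal_density x \<partial>lborel)) \<le> sqrt (herm_sqnorm q a) * sqrt q ^ n" for n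
    unfolding Fint[symmetric] using integral_norm_bound[of lborel "?F n"] nF[of n] by linarith
  from norm_suminf_le[OF this sgeo]
  have "cmod (\<integral>x. f x * of_real (g x * std_normal_density x) \<partial>lborel) \<le> (\<Sum>n. sqrt (herm_sqnorm q a) * sqrt q ^ n)"
    using S by (simp add: sums_iff)
  also have "\<dots> = sqrt (herm_sqnorm q a) * (1 / (1 - sqrt q))"
    using q by (subst suminf_mult) (auto simp: suminf_geometric summable_geometric)
  finally show "cmod (\<integral>x. f x * of_real (g x * std_normal_density x) \<partial>lborel) \<le> sqrt (herm_sqnorm q a) * (1 / (1 - sqrt q))" .
qed

lemma hermite_expansion_coeff_eq:
  assumes h: "hermite_expansion q f a" and q: "0 < q" "q < 1"
  shows "a k = (\<integral>x. f x * of_real (hermite_normed k x * std_normal_density x) \<partial>lborel)"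
proof -
  have meas: "hermite_normed k \<in> borel_measurable borel"
    unfolding hermite_normed_eq[abs_def] poly_herm_poly[symmetric]
    by (intro borel_measurable_continuous_onI continuous_intros)
  have "(\<lambda>n. a n * of_real (\<integral>x. hermite_normed n x * hermite_normed k x * std_normal_density x \<partial>lborel)) sums
      (\<integral>x. f x * of_real (hermite_normed k x * std_normal_density x) \<partial>lborel)"
    by (rule hermite_expansion_weighted_integral(2)[OF h q meas, where k = k]) simp
  moreover have "(\<lambda>n. a n * of_real (\<integral>x. hermite_normed n x * hermite_normed k x * std_normal_density x \<partial>lborel)) sums
     (\<Sum>n\<in>{k}. a n * of_real (\<integral>x. hermite_normed n x * hermite_normed k x * std_normal_density x \<partial>lborel))"
    by (rule sums_finite) (auto simp: hermite_orthonormal)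
  ultimately show ?thesis by (simp add: sums_iff hermite_orthonormal)
qed

lemma hermite_coeff_eq:
  assumes h: "hermite_expansion q f a" and q: "0 < q" "q < 1"
  shows "hermite_coeff q f = a"
  unfolding hermite_coeff_def
proof (rule the_equality)
  show "hermite_expansion q f a" by (rule h)
  fix b assume "hermite_expansion q f b"
  note hb = this
  show "b = a"
    by (rule ext) (simp only: hermite_expansion_coeff_eq[OF hb q] hermite_expansion_coeff_eq[OF h q])
qed

lemma Hq_norm_eq:
  assumes h: "hermite_expansion q f a" and q: "0 < q" "q < 1"
  shows "Hq_norm q f = sqrt (herm_sqnorm q a)"
proof -
  have s: "summable (\<lambda>n. (cmod (a n))\<^sup>2 / q ^ n)" using h by (simp add: hermite_expansion_def)
  have "a n * cnj (a n) / complex_of_real (q ^ n) = of_real ((cmod (a n))\<^sup>2 / q ^ n)" for n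
    by (simp only: of_real_divide complex_norm_square)
  then have "Hq_inner q f f = of_real (herm_sqnorm q a)"
    unfolding Hq_inner_def hermite_coeff_eq[OF h q] herm_sqnorm_def using suminf_of_real[OF s, where 'a=complex] by (simp only:)
  then show ?thesis by (simp add: Hq_norm_def)
qed

lemma Hq_expansion: "f \<in> Hq q \<Longrightarrow> 0 < q \<Longrightarrow> q < 1 \<Longrightarrow> hermite_expansion q f (hermite_coeff q f)"
  unfolding Hq_def using hermite_coeff_eq by auto

lemma Hq_norm_nonneg: "f \<in> Hq q \<Longrightarrow> 0 < q \<Longrightarrow> q < 1 \<Longrightarrow> 0 \<le> Hq_norm q f"
  using Hq_norm_eq[OF Hq_expansion] herm_sqnorm_nonneg[OF _ Hq_expansion] by simp

lemma Hq_cmult: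
  assumes f: "f \<in> Hq q" and q: "0 < q" "q < 1"
  shows "(\<lambda>x. z * f x) \<in> Hq q" "Hq_norm q (\<lambda>x. z * f x) = cmod z * Hq_norm q f"
proof -
  let ?a = "hermite_coeff q f"
  have h: "hermite_expansion q f ?a" by (rule Hq_expansion[OF f q])
  then have s: "summable (\<lambda>n. (cmod (?a n))\<^sup>2 / q ^ n)" by (simp add: hermite_expansion_def)
  have e: "(cmod (z * ?a n))\<^sup>2 / q ^ n = (cmod z)\<^sup>2 * ((cmod (?a n))\<^sup>2 / q ^ n)" for n
    by (simp add: norm_mult power_mult_distrib)
  have h': "hermite_expansion q (\<lambda>x. z * f x) (\<lambda>n. z * ?a n)"
    unfolding hermite_expansion_def e mult.assoc
    using h summable_mult[OF s, of "(cmod z)\<^sup>2"] by (auto simp only: hermite_expansion_def intro!: sums_mult)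
  then show "(\<lambda>x. z * f x) \<in> Hq q" unfolding Hq_def by auto
  show "Hq_norm q (\<lambda>x. z * f x) = cmod z * Hq_norm q f"
    unfolding Hq_norm_eq[OF h q] Hq_norm_eq[OF h' q] herm_sqnorm_def e suminf_mult[OF s]
    by (simp add: real_sqrt_mult)
qed

lemma Hq_add:
  assumes f: "f \<in> Hq q" and g: "g \<in> Hq q" and q: "0 < q" "q < 1"
  shows "(\<lambda>x. f x + g x) \<in> Hq q" "Hq_norm q (\<lambda>x. f x + g x) \<le> 2 * (Hq_norm q f + Hq_norm q g)"
proof -
  let ?a = "hermite_coeff q f" and ?b = "hermite_coeff q g"
  have h: "hermite_expansion q f ?a" "hermite_expansion q g ?b" by (intro Hq_expansion f g q)+
  then have s: "summable (\<lambda>n. (cmod (?a n))\<^sup>2 / q ^ n)" "summable (\<lambda>n. (cmod (?b n))\<^sup>2 / q ^ n)"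
    by (simp_all add: hermite_expansion_def)
  have s2: "summable (\<lambda>n. 2 * ((cmod (?a n))\<^sup>2 / q ^ n) + 2 * ((cmod (?b n))\<^sup>2 / q ^ n))"
    by (intro summable_add summable_mult s)
  have e: "(cmod (?a n + ?b n))\<^sup>2 / q ^ n \<le> 2 * ((cmod (?a n))\<^sup>2 / q ^ n) + 2 * ((cmod (?b n))\<^sup>2 / q ^ n)" for n
  proof -
    have "(cmod (?a n + ?b n))\<^sup>2 \<le> (cmod (?a n) + cmod (?b n))\<^sup>2"
      by (intro power_mono norm_triangle_ineq) auto
    also have "\<dots> \<le> 2 * (cmod (?a n))\<^sup>2 + 2 * (cmod (?b n))\<^sup>2"
      using zero_le_power2[of "cmod (?a n) - cmod (?b n)"] by (simp add: power2_eq_square algebra_simps)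
    finally have "(cmod (?a n + ?b n))\<^sup>2 / q ^ n \<le> (2 * (cmod (?a n))\<^sup>2 + 2 * (cmod (?b n))\<^sup>2) / q ^ n"
      using q by (intro divide_right_mono) auto
    then show ?thesis by (simp add: add_divide_distrib)
  qed
  have s3: "summable (\<lambda>n. (cmod (?a n + ?b n))\<^sup>2 / q ^ n)"
    by (rule summable_comparison_test'[OF s2, of 0]) (use e q in auto)
  have h': "hermite_expansion q (\<lambda>x. f x + g x) (\<lambda>n. ?a n + ?b n)"
    unfolding hermite_expansion_def distrib_right
    using h s3 by (auto simp: hermite_expansion_def intro!: sums_add)
  then show "(\<lambda>x. f x + g x) \<in> Hq q" unfolding Hq_def by auto
  have "herm_sqnorm q (\<lambda>n. ?a n + ?b n) \<le> 2 * herm_sqnorm q ?a + 2 * herm_sqnorm q ?b"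
  proof -
    have "herm_sqnorm q (\<lambda>n. ?a n + ?b n) \<le> (\<Sum>n. 2 * ((cmod (?a n))\<^sup>2 / q ^ n) + 2 * ((cmod (?b n))\<^sup>2 / q ^ n))"
      unfolding herm_sqnorm_def by (intro suminf_le e s3 s2)
    also have "\<dots> = 2 * herm_sqnorm q ?a + 2 * herm_sqnorm q ?b"
      unfolding herm_sqnorm_def using suminf_add[OF summable_mult[OF s(1), of 2] summable_mult[OF s(2), of 2]] suminf_mult[OF s(1), of 2] suminf_mult[OF s(2), of 2] by simp
    finally show ?thesis .
  qed
  also have "\<dots> \<le> (2 * (sqrt (herm_sqnorm q ?a) + sqrt (herm_sqnorm q ?b)))\<^sup>2"
  proof -
    have 0: "0 \<le> herm_sqnorm q ?a" "0 \<le> herm_sqnorm q ?b" using herm_sqnorm_nonneg q h by blast+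
    then have "0 \<le> sqrt (herm_sqnorm q ?a) * sqrt (herm_sqnorm q ?b)" by simp
    then show ?thesis using 0 by (simp add: power2_eq_square algebra_simps)
  qed
  finally have "sqrt (herm_sqnorm q (\<lambda>n. ?a n + ?b n)) \<le> 2 * (sqrt (herm_sqnorm q ?a) + sqrt (herm_sqnorm q ?b))"
    using herm_sqnorm_nonneg[OF q(1) h(1)] herm_sqnorm_nonneg[OF q(1) h(2)] by (intro real_le_lsqrt) auto
  then show "Hq_norm q (\<lambda>x. f x + g x) \<le> 2 * (Hq_norm q f + Hq_norm q g)"
    unfolding Hq_norm_eq[OF h(1) q] Hq_norm_eq[OF h(2) q] Hq_norm_eq[OF h' q] .
qed

text \<open>The Taylor coefficients at \<open>0\<close> of an element of \<open>Hq\<close>,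
  obtained from its Hermite coefficients.\<close>

definition tcoeffs :: "real \<Rightarrow> (real \<Rightarrow> complex) \<Rightarrow> nat \<Rightarrow> complex" where
  "tcoeffs q f = herm_taylor (hermite_coeff q f)"

lemma Hq_taylor:
  assumes f: "f \<in> Hq q" and q: "0 < q" "q < 1" and tau: "q / (1 - q) < \<tau>"
  shows "tbound \<tau> (1 / (1 - sqrt (q / (1 - q / \<tau>))) * Hq_norm q f) (tcoeffs q f)" "tfun (tcoeffs q f) = f"
proof -
  let ?a = "hermite_coeff q f"
  have h: "hermite_expansion q f ?a" by (rule Hq_expansion[OF f q])
  note ht = herm_taylor[OF q tau _ hermite_expansion_coeff_le[OF h q(1)]]
  have "0 \<le> 1 / (1 - sqrt (q / (1 - q / \<tau>)))"
  proof -
    have "\<tau> > 0" using q tau by (smt (verit) divide_pos_pos)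
    then have "q / \<tau> < 1 - q" using q tau by (simp add: field_simps)
    then have "q / (1 - q / \<tau>) \<le> 1" using q by (subst divide_le_eq_1) linarith
    then show ?thesis by simp
  qed
  then show "tbound \<tau> (1 / (1 - sqrt (q / (1 - q / \<tau>))) * Hq_norm q f) (tcoeffs q f)"
    unfolding tbound_def tcoeffs_def
    using ht(1) Hq_norm_nonneg[OF f q] herm_sqnorm_nonneg[OF q(1) h] Hq_norm_eq[OF h q] by (auto intro: mult_nonneg_nonneg)
  show "tfun (tcoeffs q f) = f"
  proof
    fix x
    have "(\<lambda>n. ?a n * of_real (hermite_normed n x)) sums f x"
      using h by (simp add: hermite_expansion_def)
    then show "tfun (tcoeffs q f) x = f x" unfolding tfun_def tcoeffs_def
      using ht(2)[of x] herm_sqnorm_nonneg[OF q(1) h] by (simp add: sums_iff)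
  qed
qed

lemma tbound_Hq:
  assumes c: "tbound \<sigma> B c" and sig: "0 \<le> \<sigma>" "\<sigma> < q / (1 + q)" and q: "0 < q" "q < 1"
  defines "s \<equiv> \<sigma> * (1 + q) / q"
  shows "tfun c \<in> Hq q" "Hq_norm q (tfun c) \<le> 1 / ((1 - sqrt s) * sqrt (1 - s)) * B"
proof -
  let ?a = "taylor_herm c"
  have s: "0 \<le> s" "s < 1" using q sig by (auto simp: s_def field_simps)
  let ?K = "B / (1 - sqrt s)"
  have K: "0 \<le> ?K" using s tbound_nonneg[OF c] by simp
  note th = taylor_herm[OF q sig tbound_nonneg[OF c] tbound_D[OF c]]
  have le: "(cmod (?a m))\<^sup>2 / q ^ m \<le> ?K\<^sup>2 * s ^ m" for m
  proof -
    have "cmod (?a m) \<le> ?K * sqrt ((s * q) ^ m)" using th(1)[of m] unfolding s_def by simp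
    then have "(cmod (?a m))\<^sup>2 \<le> (?K * sqrt ((s * q) ^ m))\<^sup>2" by (intro power_mono) auto
    also have "\<dots> = ?K\<^sup>2 * (s * q) ^ m"
      using s q by (simp only: power_mult_distrib[of ?K] real_sqrt_pow2 mult_nonneg_nonneg zero_le_power less_imp_le)
    finally show ?thesis using q by (simp add: power_mult_distrib pos_divide_le_eq mult.assoc)
  qed
  have gs: "summable (\<lambda>m. ?K\<^sup>2 * s ^ m)" using s by (intro summable_mult summable_geometric) auto
  have sm: "summable (\<lambda>m. (cmod (?a m))\<^sup>2 / q ^ m)"
    by (rule summable_comparison_test'[OF gs, of 0]) (use le q in auto)
  have h: "hermite_expansion q (tfun c) ?a"
    unfolding hermite_expansion_def using sm th(2) by (auto simp: tfun_def)
  then show "tfun c \<in> Hq q" unfolding Hq_def by auto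
  have "herm_sqnorm q ?a \<le> (\<Sum>m. ?K\<^sup>2 * s ^ m)" unfolding herm_sqnorm_def by (intro suminf_le le sm gs)
  also have "\<dots> = ?K\<^sup>2 / (1 - s)" using s by (subst suminf_mult) (auto simp: suminf_geometric summable_geometric)
  finally have "Hq_norm q (tfun c) \<le> sqrt (?K\<^sup>2 / (1 - s))" unfolding Hq_norm_eq[OF h q] by simp
  also have "\<dots> = 1 / ((1 - sqrt s) * sqrt (1 - s)) * B"
    unfolding real_sqrt_divide real_sqrt_abs abs_of_nonneg[OF K] by simp
  finally show "Hq_norm q (tfun c) \<le> 1 / ((1 - sqrt s) * sqrt (1 - s)) * B" .
qed

lemma tcoeffs_eq:
  assumes c: "tbound t C c" and t: "0 \<le> t" and f: "tfun c \<in> Hq q" and q: "0 < q" "q < 1"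
  shows "tcoeffs q (tfun c) = c"
proof -
  obtain \<tau> where tau: "q / (1 - q) < \<tau>" using gt_ex by blast
  have tau_pos: "0 \<le> \<tau>" using q tau by (smt (verit) divide_pos_pos)
  note T = Hq_taylor[OF f q tau]
  show ?thesis
    by (rule tfun_unique[OF tbound_mono[OF T(1) tau_pos, of "max t \<tau>"] tbound_mono[OF c t, of "max t \<tau>"]])
      (use T(2) t in auto)
qed

lemma Hq_integrable:
  assumes f: "f \<in> Hq q" and q: "0 < q" "q < 1"
  shows "integrable lborel (\<lambda>x. f x * complex_of_real (std_normal_density x))"
  using hermite_expansion_weighted_integral(1)[OF Hq_expansion[OF f q] q, of "\<lambda>_. 1" 0]
  by (simp add: hermite_normed_eq herm_gen_nth gauss_ser_0)

lemma half_mean_bound: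
  assumes f: "f \<in> Hq q" and q: "0 < q" "q < 1"
  shows "cmod (half_mean f) \<le> 1 / (1 - sqrt q) * Hq_norm q f"
proof -
  have "half_mean f = (\<integral>x. f x * of_real (indicator {0..} x * std_normal_density x) \<partial>lborel)"
    unfolding half_mean_def set_lebesgue_integral_def
    by (intro Bochner_Integration.integral_cong refl) (simp add: indicator_def)
  moreover have "cmod (\<integral>x. f x * of_real (indicator {0..} x * std_normal_density x) \<partial>lborel)
      \<le> sqrt (herm_sqnorm q (hermite_coeff q f)) * (1 / (1 - sqrt q))"
    by (rule hermite_expansion_weighted_integral(3)[OF Hq_expansion[OF f q] q, where k = 0])
      (simp_all add: hermite_normed_eq herm_gen_nth gauss_ser_0 indicator_def)
  ultimately show ?thesis using Hq_norm_eq[OF Hq_expansion[OF f q] q] by (simp add: mult.commute)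
qed

lemma half_mean_add:
  assumes "integrable lborel (\<lambda>x. f x * complex_of_real (std_normal_density x))"
    "integrable lborel (\<lambda>x. g x * complex_of_real (std_normal_density x))"
  shows "half_mean (\<lambda>x. f x + g x) = half_mean f + half_mean g"
proof -
  have si: "set_integrable lborel {0..} (\<lambda>x. h x * complex_of_real (std_normal_density x))"
    if "integrable lborel (\<lambda>x. h x * complex_of_real (std_normal_density x))" for h
    unfolding set_integrable_def using that by (intro integrable_mult_indicator) auto
  show ?thesis unfolding half_mean_def distrib_right by (intro set_integral_add si assms)
qed

lemma half_mean_cmult: "half_mean (\<lambda>x. z * f x) = z * half_mean f"
  unfolding half_mean_def set_lebesgue_integral_def
  by (subst integral_mult_right_zero[symmetric]) (simp add: mult_ac scaleR_conv_of_real)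

section \<open>Reciprocals of entire functions with non-negative coefficients\<close>

text \<open>This replaces the theorem of Perron-Frobenius type that is usually invoked for
  positive compact operators. If \<open>D\<close> did not vanish at the radius of convergence
  \<open>r\<close>, monotone convergence would make the series \<open>1/D\<close> with
  non-negative coefficients converge absolutely on the closed disc of radius \<open>r\<close>.
  Then \<open>D\<close> has no zero there, and by compactness none in a larger disc, so that the
  radius of convergence would exceed \<open>r\<close>.\<close>

lemma nonneg_fps_inverse_pole:
  fixes D :: "complex fps" and b :: "nat \<Rightarrow> real"
  assumes D: "fps_conv_radius D = \<infinity>" and FD: "Abs_fps (\<lambda>n. complex_of_real (b n)) * D = 1"
    and b0: "\<And>n. 0 \<le> b n" and b1: "\<And>n. b n \<le> 1" and lower: "\<And>n. \<delta> ^ n \<le> b n" and delta: "0 < \<delta>"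
  obtains r where "0 < r" "ereal r = fps_conv_radius (Abs_fps (\<lambda>n. complex_of_real (b n)))"
    "eval_fps D (of_real r) = 0"
    "\<And>w. cmod w < r \<Longrightarrow> eval_fps (Abs_fps (\<lambda>n. complex_of_real (b n))) w * eval_fps D w = 1"
proof -
  define F where "F = Abs_fps (\<lambda>n. complex_of_real (b n))"
  define R where "R = fps_conv_radius F"
  have FD': "F * D = 1" using FD by (simp add: F_def)
  have low: "ereal (1/2) \<le> R"
  proof -
    have "summable (\<lambda>n. F $ n * (of_real (1/2)) ^ n)"
    proof (rule summable_comparison_test'[of "\<lambda>n. (1/2) ^ n" 0])
      fix n show "norm (F $ n * (of_real (1/2)) ^ n) \<le> (1/2) ^ n"
        using b0[of n] b1[of n] by (simp add: F_def norm_mult norm_power norm_divide power_divide mult_left_le_one_le divide_right_mono)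
    qed (simp add: summable_geometric)
    then have "norm (of_real (1/2) :: complex) \<le> R" unfolding R_def fps_conv_radius_def
      by (rule conv_radius_geI)
    then show ?thesis by simp
  qed
  have up: "R \<le> ereal (1 / \<delta>)"
  proof (rule ccontr)
    assume "\<not> R \<le> ereal (1 / \<delta>)"
    then have "norm (of_real (1/\<delta>) :: complex) < fps_conv_radius F" using delta by (simp add: R_def norm_divide)
    from summable_fps[OF this] have "(\<lambda>n. F $ n * (of_real (1/\<delta>)) ^ n) \<longlonglongrightarrow> 0" by (rule summable_LIMSEQ_zero)
    then have "(\<lambda>n. norm (F $ n * (of_real (1/\<delta>)) ^ n)) \<longlonglongrightarrow> 0" by (rule tendsto_norm_zero)
    moreover have "1 \<le> norm (F $ n * (of_real (1/\<delta>)) ^ n)" for n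
      using lower[of n] b0[of n] delta by (simp add: F_def norm_mult norm_power norm_divide power_divide pos_le_divide_eq)
    ultimately show False using LIMSEQ_le_const[of "\<lambda>n. norm (F $ n * (of_real (1/\<delta>)) ^ n)" 0 1] by auto
  qed
  obtain r where r: "R = ereal r" using low up by (cases R) auto
  have rpos: "0 < r" using low r by simp
  have FDw: "eval_fps F w * eval_fps D w = 1" if "cmod w < r" for w
  proof -
    have "eval_fps (F * D) w = eval_fps F w * eval_fps D w"
      by (rule eval_fps_mult) (use that r D in \<open>simp_all add: R_def\<close>)
    then show ?thesis by (simp add: FD')
  qed
  have contD: "continuous_on UNIV (eval_fps D)"
    using continuous_on_eval_fps[of D] D by simp
  have Dr: "eval_fps D (of_real r) = 0"
  proof (rule ccontr)
    assume nz: "eval_fps D (of_real r) \<noteq> 0"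
    have Fx: "eval_fps F (of_real x) = of_real (\<Sum>n. b n * x ^ n)" "summable (\<lambda>n. b n * x ^ n)" if x: "0 \<le> x" "x < r" for x
    proof -
      have xr: "ereal (norm (complex_of_real x)) < fps_conv_radius F" using x r by (simp add: R_def)
      from norm_summable_fps[OF this]
      show s: "summable (\<lambda>n. b n * x ^ n)" using b0 x by (simp add: F_def norm_mult norm_power)
      from suminf_of_real[OF this, where 'a = complex]
      show "eval_fps F (of_real x) = of_real (\<Sum>n. b n * x ^ n)" by (simp add: eval_fps_def F_def)
    qed
    have "((\<lambda>x. inverse (eval_fps D (of_real x))) \<longlongrightarrow> inverse (eval_fps D (of_real r))) (at_left r)"
    proof (rule tendsto_inverse[OF _ nz])
      have "isCont (\<lambda>x. eval_fps D (complex_of_real x)) r"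
        using continuous_on_compose2[OF contD continuous_on_of_real[OF continuous_on_id, of UNIV]]
        by (simp add: continuous_on_eq_continuous_at)
      then show "((\<lambda>x. eval_fps D (complex_of_real x)) \<longlongrightarrow> eval_fps D (of_real r)) (at_left r)"
        unfolding isCont_def by (rule tendsto_mono[OF at_le, rotated]) simp
    qed
    then have "\<forall>\<^sub>F x in at_left r. dist (inverse (eval_fps D (of_real x))) (inverse (eval_fps D (of_real r))) < 1"
      by (rule tendstoD) simp
    moreover have "\<forall>\<^sub>F x in at_left r. 0 < x" using rpos by (rule eventually_at_left_real[THEN eventually_mono]) auto
    moreover have "\<forall>\<^sub>F x in at_left r. x < r" by (simp add: eventually_at_filter)
    ultimately have tfun: "\<forall>\<^sub>F x in at_left r. 0 < x \<and> x < r \<and> cmod (inverse (eval_fps D (of_real x))) \<le> cmod (inverse (eval_fps D (of_real r))) + 1"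
    proof eventually_elim
      case (elim x)
      then show ?case using norm_triangle_ineq2[of "inverse (eval_fps D (of_real x))" "inverse (eval_fps D (of_real r))"]
        by (auto simp: dist_norm)
    qed
    define B where "B = cmod (inverse (eval_fps D (of_real r))) + 1"
    (* Monotone convergence from below, by hand: partial sums are continuous up to r. *)
    have part: "(\<Sum>n<K. b n * r ^ n) \<le> B" for K
    proof (rule tendsto_upperbound)
      show "((\<lambda>x. \<Sum>n<K. b n * x ^ n) \<longlongrightarrow> (\<Sum>n<K. b n * r ^ n)) (at_left r)"
        by (intro tendsto_intros)
      show "\<forall>\<^sub>F x in at_left r. (\<Sum>n<K. b n * x ^ n) \<le> B"
        using tfun
      proof eventually_elim
        case (elim x)
        have "(\<Sum>n<K. b n * x ^ n) \<le> (\<Sum>n. b n * x ^ n)"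
          by (rule sum_le_suminf) (use Fx(2) elim b0 in auto)
        also have "\<dots> \<le> cmod (eval_fps F (of_real x))" using Fx(1)[of x] elim by simp
        also have "eval_fps F (of_real x) = inverse (eval_fps D (of_real x))"
          using FDw[of "of_real x"] elim
          by (intro inverse_unique[symmetric]) (simp add: mult.commute)
        finally show ?case using elim by (simp add: B_def)
      qed
    qed simp
    have sr: "summable (\<lambda>n. b n * r ^ n)"
      by (rule summableI_nonneg_bounded[of _ B]) (use b0 rpos part in auto)
    have nzc: "eval_fps D w \<noteq> 0" if w: "cmod w \<le> r" for w
    proof -
      have sF: "summable (\<lambda>n. norm (F $ n * w ^ n))"
      proof (rule summable_comparison_test'[OF sr, of 0])
        fix n show "norm (norm (F $ n * w ^ n)) \<le> b n * r ^ n"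
          using b0[of n] w by (simp add: F_def norm_mult norm_power mult_left_mono power_mono)
      qed
      have sD: "summable (\<lambda>n. norm (D $ n * w ^ n))" by (rule norm_summable_fps) (simp add: D)
      have "(\<lambda>k. \<Sum>i\<le>k. (F $ i * w ^ i) * (D $ (k - i) * w ^ (k - i))) sums ((\<Sum>n. F $ n * w ^ n) * eval_fps D w)"
        unfolding eval_fps_def by (rule Cauchy_product_sums[OF sF sD])
      moreover have "(\<Sum>i\<le>k. (F $ i * w ^ i) * (D $ (k - i) * w ^ (k - i))) = (F * D) $ k * w ^ k" for k
        unfolding fps_mult_nth sum_distrib_right atMost_atLeast0
        by (intro sum.cong refl) (simp add: mult_ac flip: power_add)
      moreover have "(\<lambda>k. (F * D) $ k * w ^ k) sums 1"
        using sums_finite[of "{0}" "\<lambda>k. (F * D) $ k * w ^ k"] by (simp add: FD')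
      ultimately have "(\<Sum>n. F $ n * w ^ n) * eval_fps D w = 1" by (simp add: sums_iff)
      then show ?thesis by auto
    qed
    have "closed {w. eval_fps D w = 0}"
      by (rule closed_Collect_eq[OF contD continuous_on_const])
    moreover have "cball 0 r \<inter> {w. eval_fps D w = 0} = {}" using nzc by auto
    ultimately obtain d where d: "d > 0" "\<And>x y. x \<in> cball 0 r \<Longrightarrow> y \<in> {w. eval_fps D w = 0} \<Longrightarrow> d \<le> dist x y"
      using separate_compact_closed[OF compact_cball, of "{w. eval_fps D w = 0}" 0 r] by blast
    (* A point between the two circles is compared with its radial projection to the inner one.
       *)
    have nz2: "eval_fps D w \<noteq> 0" if "ereal (cmod w) < ereal (r + d)" for w
    proof (cases "cmod w \<le> r")
      case False
      let ?x = "of_real (r / cmod w) * w"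
      have "w \<noteq> 0" using False rpos by (metis norm_zero less_imp_le)
      then have "?x \<in> cball 0 r" using rpos by (simp add: norm_mult norm_divide)
      moreover have "dist ?x w < d"
      proof -
        have "?x - w = of_real (r / cmod w - 1) * w" by (simp add: algebra_simps)
        then have "dist ?x w = \<bar>r / cmod w - 1\<bar> * cmod w" by (simp only: dist_norm norm_mult norm_of_real)
        also have "\<dots> = cmod w - r" using False rpos \<open>w \<noteq> 0\<close> by (simp add: abs_if field_simps)
        finally show ?thesis using that by simp
      qed
      ultimately show ?thesis using d(2)[of ?x w] by auto
    qed (use nzc in auto)
    have "F = inverse D" using FD' D nzc[of 0] rpos
      by (metis fps_inverse_unique mult.commute)
    then have "min (ereal (r + d)) \<infinity> \<le> R"
      using fps_conv_radius_inverse[of "ereal (r + d)" D] nz2 by (simp add: R_def D)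
    then show False using d r by simp
  qed
  show ?thesis by (rule that[OF rpos _ Dr]) (use r FDw in \<open>simp_all add: R_def F_def\<close>)
qed

section \<open>The rank-one decomposition and the renewal equation\<close>

lemma volterra_pow_lin: "(volterra \<rho> ^^ k) (\<lambda>n. c n + z * d n) = (\<lambda>n. (volterra \<rho> ^^ k) c n + z * (volterra \<rho> ^^ k) d n)"
  by (induction k) (simp_all add: volterra_add volterra_cmult)

text \<open>The finite Neumann expansion with remainder lets every bounded functional pass through
  the infinite series.\<close>

lemma neumann_truncate:
  "neumann \<rho> w c n = (\<Sum>k<K. w ^ k * (volterra \<rho> ^^ k) c n) + w ^ K * (volterra \<rho> ^^ K) (neumann \<rho> w c) n"
proof (induction K)
  case (Suc K)
  have "(volterra \<rho> ^^ K) (neumann \<rho> w c) = (volterra \<rho> ^^ K) (\<lambda>n. c n + w * volterra \<rho> (neumann \<rho> w c) n)"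
    by (rule arg_cong[of _ _ "volterra \<rho> ^^ K"]) (rule ext, rule neumann_fixpoint)
  also have "\<dots> = (\<lambda>n. (volterra \<rho> ^^ K) c n + w * (volterra \<rho> ^^ K) (volterra \<rho> (neumann \<rho> w c)) n)" by (rule volterra_pow_lin)
  also have "(volterra \<rho> ^^ K) (volterra \<rho> (neumann \<rho> w c)) = (volterra \<rho> ^^ Suc K) (neumann \<rho> w c)" by (simp only: funpow_Suc_right o_apply)
  finally have *: "(volterra \<rho> ^^ K) (neumann \<rho> w c) n = (volterra \<rho> ^^ K) c n + w * (volterra \<rho> ^^ Suc K) (neumann \<rho> w c) n"
    by (rule fun_cong)
  show ?case unfolding Suc.IH * sum.lessThan_Suc by (simp only: power_Suc2 distrib_left mult.assoc add.assoc)
qed simp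

definition gauss_mean :: "(real \<Rightarrow> complex) \<Rightarrow> complex" where
  "gauss_mean f = (\<integral>x. f x * complex_of_real (std_normal_density x) \<partial>lborel)"

lemma gauss_mean_bound:
  assumes f: "f \<in> Hq q" and q: "0 < q" "q < 1"
  shows "cmod (gauss_mean f) \<le> 1 / (1 - sqrt q) * Hq_norm q f"
  using hermite_expansion_weighted_integral(3)[OF Hq_expansion[OF f q] q, of "\<lambda>_. 1" 0] Hq_norm_eq[OF Hq_expansion[OF f q] q]
  by (simp add: hermite_normed_eq herm_gen_nth gauss_ser_0 gauss_mean_def mult.commute)

text \<open>The parameter \<open>\<tau>\<close> governs the Taylor coefficients of elements of
  \<open>Hq\<close>, and \<open>\<sigma> = \<rho>\<^sup>2 (1 + \<tau>)\<close> those in the image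
  of \<open>A\<close>. The assumptions say that \<open>Hq\<close> embeds into the larger sequence
  space, and that \<open>A\<close> maps that space back into \<open>Hq\<close>. The ratio
  \<open>\<kappa>\<close> works for both rates at once.\<close>

locale ma1 =
  fixes \<rho> q \<tau> :: real
  assumes q: "0 < q" "q < 1" and tau: "q / (1 - q) < \<tau>" and rho: "\<rho>\<^sup>2 * (1 + \<tau>) < q / (1 + q)"
begin

definition "\<sigma> = \<rho>\<^sup>2 * (1 + \<tau>)"
definition "\<kappa> = sqrt ((1 + \<sigma>) / (1 + \<tau>))"
abbreviation "A \<equiv> volterra (complex_of_real \<rho>)"
definition "neumann_norm w = (\<Sum>k. cmod w ^ k * \<kappa> ^ (\<Sum>{..k}))"
definition "decay = \<sigma> * (1 + q) / q"
definition "embed_const = 1 / ((1 - sqrt decay) * sqrt (1 - decay))"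

lemma tau_pos: "0 < \<tau>" using q tau by (smt (verit) divide_pos_pos)

lemma sig: "0 \<le> \<sigma>" "\<sigma> < q / (1 + q)" "\<sigma> < \<tau>"
proof -
  show "0 \<le> \<sigma>" "\<sigma> < q / (1 + q)" using tau_pos rho by (simp_all add: \<sigma>_def)
  have "q / (1 + q) \<le> q / (1 - q)" using q by (intro divide_left_mono) auto
  then show "\<sigma> < \<tau>" using tau \<open>\<sigma> < q / (1 + q)\<close> by linarith
qed

lemma kap: "0 \<le> \<kappa>" "\<kappa> < 1" "\<rho>\<^sup>2 * (1 + \<tau>) \<le> \<kappa>\<^sup>2 * \<tau>" "\<rho>\<^sup>2 * (1 + \<sigma>) \<le> \<kappa>\<^sup>2 * \<sigma>"
proof -
  have k2: "\<kappa>\<^sup>2 = (1 + \<sigma>) / (1 + \<tau>)" using sig tau_pos by (simp add: \<kappa>_def)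
  show "0 \<le> \<kappa>" "\<kappa> < 1" using sig tau_pos by (simp_all add: \<kappa>_def)
  have "\<sigma> * (1 + \<tau>) \<le> (1 + \<sigma>) * \<tau>" using sig by (simp add: algebra_simps)
  then have "\<sigma> \<le> (1 + \<sigma>) / (1 + \<tau>) * \<tau>" using tau_pos by (simp add: divide_simps)
  then show "\<rho>\<^sup>2 * (1 + \<tau>) \<le> \<kappa>\<^sup>2 * \<tau>" unfolding k2 \<sigma>_def .
  show "\<rho>\<^sup>2 * (1 + \<sigma>) \<le> \<kappa>\<^sup>2 * \<sigma>" unfolding k2 using tau_pos by (simp add: \<sigma>_def)
qed

lemma rho_less_1: "\<bar>\<rho>\<bar> < 1"
proof -
  have "\<rho>\<^sup>2 * 1 \<le> \<rho>\<^sup>2 * (1 + \<tau>)" using tau_pos by (intro mult_left_mono) auto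
  also have "\<dots> < 1" using rho q by (smt (verit) divide_less_eq_1_pos)
  finally show ?thesis by (simp add: abs_square_less_1)
qed

lemma A_tbound: "tbound \<tau> C c \<Longrightarrow> tbound \<sigma> C (A c)"
  using volterra_tbound[of \<tau> C c "of_real \<rho>"] tau_pos by (simp add: \<sigma>_def)

lemma tbound_sig_tau: "tbound \<sigma> C c \<Longrightarrow> tbound \<tau> C c"
  using tbound_mono[of \<sigma> C c \<tau> C] sig by simp

lemma A_tbound_sig: "tbound \<sigma> C c \<Longrightarrow> tbound \<sigma> C (A c)"
  by (intro A_tbound tbound_sig_tau)

lemma Apow_tbound: "tbound \<sigma> C c \<Longrightarrow> tbound \<sigma> (C * \<kappa> ^ (\<Sum>{..k})) ((A ^^ k) c)"
  by (rule volterra_pow_tbound) (use kap sig in auto)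

lemma neumann_tbound_sig: "tbound \<sigma> C c \<Longrightarrow> tbound \<sigma> (C * neumann_norm w) (neumann \<rho> w c)"
  unfolding neumann_norm_def by (rule neumann_tbound) (use kap sig in auto)

lemma neumann_tbound_tau: "tbound \<tau> C c \<Longrightarrow> tbound \<tau> (C * neumann_norm w) (neumann \<rho> w c)"
  unfolding neumann_norm_def by (rule neumann_tbound) (use kap tau_pos in auto)

lemma embed_const_nonneg: "0 \<le> embed_const"
proof -
  have "0 \<le> decay" "decay < 1" using q sig by (auto simp: decay_def field_simps)
  then show ?thesis by (simp add: embed_const_def)
qed

lemma tbound_in_Hq: assumes "tbound \<sigma> C c" shows "tfun c \<in> Hq q" "Hq_norm q (tfun c) \<le> embed_const * C"
  using tbound_Hq[OF assms sig(1,2) q] by (simp_all add: embed_const_def decay_def)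

lemma T_op_eq:
  assumes "tbound \<tau> C c" "tfun c \<in> Hq q"
  shows "T_op \<rho> (tfun c) x = half_mean (tfun c) + tfun (A c) x"
  by (rule T_op_tfun[OF assms(1)]) (use tau_pos Hq_integrable[OF assms(2) q] in auto)

text \<open>Linear functionals that are bounded on the smaller sequence space. Point evaluations,
  the mean over the half-line and the full Gaussian mean are treated uniformly in this
  way.\<close>

definition bdd_fun :: "((nat \<Rightarrow> complex) \<Rightarrow> complex) \<Rightarrow> bool" where
  "bdd_fun L \<longleftrightarrow> (\<forall>c d z C D. tbound \<sigma> C c \<longrightarrow> tbound \<sigma> D d \<longrightarrow> L (\<lambda>n. c n + z * d n) = L c + z * L d) \<and>
     (\<exists>K\<ge>0. \<forall>C c. tbound \<sigma> C c \<longrightarrow> cmod (L c) \<le> K * C)"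

lemma bdd_fun_lin: "bdd_fun L \<Longrightarrow> tbound \<sigma> C c \<Longrightarrow> tbound \<sigma> D d \<Longrightarrow> L (\<lambda>n. c n + z * d n) = L c + z * L d"
  unfolding bdd_fun_def by blast

lemma tbound_zero: "tbound t 0 (\<lambda>n. 0)" by (simp add: tbound_def)

lemma tbound_lin: "tbound t C c \<Longrightarrow> tbound t D d \<Longrightarrow> tbound t (C + cmod z * D) (\<lambda>n. c n + z * d n)"
  by (intro tbound_add tbound_cmult)

lemma tbound_sum: "(\<And>i::nat. i < N \<Longrightarrow> \<exists>C. tbound \<sigma> C (c i)) \<Longrightarrow> \<exists>C. tbound \<sigma> C (\<lambda>n. \<Sum>i<N. z i * c i n)"
proof (induction N)
  case 0 then show ?case using tbound_zero by auto
next
  case (Suc N)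
  then obtain C D where "tbound \<sigma> C (\<lambda>n. \<Sum>i<N. z i * c i n)" "tbound \<sigma> D (c N)" by (meson lessI less_SucI)
  from tbound_lin[OF this, of "z N"] show ?case by (auto simp: sum.lessThan_Suc)
qed

lemma bdd_fun_sum:
  assumes L: "bdd_fun L" and "\<And>i::nat. i < N \<Longrightarrow> \<exists>C. tbound \<sigma> C (c i)"
  shows "L (\<lambda>n. \<Sum>i<N. z i * c i n) = (\<Sum>i<N. z i * L (c i))"
  using assms(2)
proof (induction N)
  case 0
  show ?case using bdd_fun_lin[OF L tbound_zero tbound_zero, of 1] by simp
next
  case (Suc N)
  obtain C D where *: "tbound \<sigma> C (\<lambda>n. \<Sum>i<N. z i * c i n)" "tbound \<sigma> D (c N)"
    using Suc.prems tbound_sum[of N c z] by (meson lessI less_SucI)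
  show ?case using bdd_fun_lin[OF L *, of "z N"] Suc by (simp add: sum.lessThan_Suc)
qed

lemma bdd_fun_tfun: "bdd_fun (\<lambda>c. tfun c x)"
  unfolding bdd_fun_def
proof (intro conjI allI impI)
  fix c d z C D assume "tbound \<sigma> C c" "tbound \<sigma> D d"
  then show "tfun (\<lambda>n. c n + z * d n) x = tfun c x + z * tfun d x"
    using tfun_add[OF _ tbound_cmult[of \<sigma> D d z], of C c] tfun_cmult[of \<sigma> D d] sig by simp
next
  have s: "summable (\<lambda>n. wt \<sigma> n * \<bar>x\<bar> ^ n)" by (rule summable_wt_power[OF sig(1)])
  show "\<exists>K\<ge>0. \<forall>C c. tbound \<sigma> C c \<longrightarrow> cmod (tfun c x) \<le> K * C"
  proof (intro exI[of _ "\<Sum>n. wt \<sigma> n * \<bar>x\<bar> ^ n"] conjI allI impI)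
    show "0 \<le> (\<Sum>n. wt \<sigma> n * \<bar>x\<bar> ^ n)" using sig by (intro suminf_nonneg s mult_nonneg_nonneg wt_nonneg) auto
    fix C c assume c: "tbound \<sigma> C c"
    have "cmod (tfun c x) \<le> (\<Sum>n. C * (wt \<sigma> n * \<bar>x\<bar> ^ n))"
      unfolding tfun_def
    proof (rule norm_suminf_le)
      fix n show "cmod (c n * of_real (x ^ n)) \<le> C * (wt \<sigma> n * \<bar>x\<bar> ^ n)"
        using tbound_D[OF c, of n] by (simp add: norm_mult norm_power mult_right_mono flip: mult.assoc)
    qed (intro summable_mult s)
    also have "\<dots> = (\<Sum>n. wt \<sigma> n * \<bar>x\<bar> ^ n) * C" using s by (simp add: suminf_mult mult.commute)
    finally show "cmod (tfun c x) \<le> (\<Sum>n. wt \<sigma> n * \<bar>x\<bar> ^ n) * C" .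
  qed
qed

lemma tfun_lin: "tbound \<sigma> C c \<Longrightarrow> tbound \<sigma> D d \<Longrightarrow> tfun (\<lambda>n. c n + z * d n) = (\<lambda>x. tfun c x + z * tfun d x)"
  using bdd_fun_lin[OF bdd_fun_tfun] by (auto simp: fun_eq_iff)

lemma bdd_fun_functional:
  assumes lin: "\<And>f g z. f \<in> Hq q \<Longrightarrow> g \<in> Hq q \<Longrightarrow> L (\<lambda>x. f x + z * g x) = L f + z * L g"
    and bound: "\<And>f. f \<in> Hq q \<Longrightarrow> cmod (L f) \<le> K * Hq_norm q f" and K: "0 \<le> K"
  shows "bdd_fun (\<lambda>c. L (tfun c))"
  unfolding bdd_fun_def
proof (intro conjI allI impI)
  fix c d z C D assume *: "tbound \<sigma> C c" "tbound \<sigma> D d"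
  then show "L (tfun (\<lambda>n. c n + z * d n)) = L (tfun c) + z * L (tfun d)"
    using tfun_lin[OF *] lin tbound_in_Hq(1) by simp
next
  show "\<exists>K\<ge>0. \<forall>C c. tbound \<sigma> C c \<longrightarrow> cmod (L (tfun c)) \<le> K * C"
  proof (intro exI[of _ "K * embed_const"] conjI allI impI)
    show "0 \<le> K * embed_const" using K embed_const_nonneg by simp
    fix C c assume c: "tbound \<sigma> C c"
    have "cmod (L (tfun c)) \<le> K * Hq_norm q (tfun c)" by (intro bound tbound_in_Hq(1)[OF c])
    also have "\<dots> \<le> K * (embed_const * C)" by (intro mult_left_mono tbound_in_Hq(2)[OF c] K)
    finally show "cmod (L (tfun c)) \<le> K * embed_const * C" by simp
  qed
qed

lemma half_mean_lin: "f \<in> Hq q \<Longrightarrow> g \<in> Hq q \<Longrightarrow> half_mean (\<lambda>x. f x + z * g x) = half_mean f + z * half_mean g"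
  using half_mean_add[OF Hq_integrable[OF _ q] Hq_integrable[OF Hq_cmult(1)[OF _ q] q]] by (simp add: half_mean_cmult)

lemma gauss_mean_lin: "f \<in> Hq q \<Longrightarrow> g \<in> Hq q \<Longrightarrow> gauss_mean (\<lambda>x. f x + z * g x) = gauss_mean f + z * gauss_mean g"
  unfolding gauss_mean_def distrib_right mult.assoc
  by (subst Bochner_Integration.integral_add) (auto intro!: Hq_integrable q integrable_mult_right)

lemma bdd_fun_half_mean: "bdd_fun (\<lambda>c. half_mean (tfun c))"
  using q by (intro bdd_fun_functional[OF half_mean_lin, where K = "1 / (1 - sqrt q)"] half_mean_bound) auto

lemma bdd_fun_gauss_mean: "bdd_fun (\<lambda>c. gauss_mean (tfun c))"
  using q by (intro bdd_fun_functional[OF gauss_mean_lin, where K = "1 / (1 - sqrt q)"] gauss_mean_bound) auto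

text \<open>The generating function of the numbers \<open>L(A\<^sup>k 1)\<close>, which is entire
  in \<open>w\<close> and equals \<open>L((1 - w A)\<^bsup>-1\<^esup> 1)\<close>.\<close>

definition neumann_ser :: "((nat \<Rightarrow> complex) \<Rightarrow> complex) \<Rightarrow> complex fps" where
  "neumann_ser L = Abs_fps (\<lambda>k. L ((A ^^ k) one_co))"

lemma neumann_ser_radius:
  assumes L: "bdd_fun L" shows "fps_conv_radius (neumann_ser L) = \<infinity>"
  unfolding fps_conv_radius_def
proof (rule conv_radius_inftyI'')
  fix z :: complex
  obtain K where K: "K \<ge> 0" "\<And>C c. tbound \<sigma> C c \<Longrightarrow> cmod (L c) \<le> K * C" using L unfolding bdd_fun_def by blast
  show "summable (\<lambda>n. neumann_ser L $ n * z ^ n)"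
  proof (rule summable_comparison_test'[of _ 0])
    show "summable (\<lambda>n. K * (cmod z ^ n * \<kappa> ^ (\<Sum>{..n})))"
      by (intro summable_mult summable_triangular_power) (use kap in auto)
    fix n
    have "cmod (L ((A ^^ n) one_co)) \<le> K * (1 * \<kappa> ^ (\<Sum>{..n}))"
      by (intro K(2) Apow_tbound tbound_one sig)
    then have "cmod (L ((A ^^ n) one_co)) * cmod z ^ n \<le> K * (1 * \<kappa> ^ (\<Sum>{..n})) * cmod z ^ n"
      by (intro mult_right_mono) auto
    then show "norm (neumann_ser L $ n * z ^ n) \<le> K * (cmod z ^ n * \<kappa> ^ (\<Sum>{..n}))"
      by (simp add: neumann_ser_def norm_mult norm_power mult_ac)
  qed
qed

lemma neumann_ser_eval:
  assumes L: "bdd_fun L" shows "eval_fps (neumann_ser L) w = L (neumann \<rho> w one_co)"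
proof -
  obtain K where K: "K \<ge> 0" "\<And>C c. tbound \<sigma> C c \<Longrightarrow> cmod (L c) \<le> K * C" using L unfolding bdd_fun_def by blast
  let ?r = "neumann (of_real \<rho>) w one_co"
  have r: "tbound \<sigma> (1 * neumann_norm w) ?r" by (intro neumann_tbound_sig tbound_one sig)
  have eq: "L ?r = (\<Sum>k<N. neumann_ser L $ k * w ^ k) + w ^ N * L ((A ^^ N) ?r)" for N
  proof -
    obtain C where C: "tbound \<sigma> C (\<lambda>n. \<Sum>k<N. w ^ k * (A ^^ k) one_co n)"
      using tbound_sum[of N "\<lambda>k. (A ^^ k) one_co" "\<lambda>k. w ^ k"] Apow_tbound[OF tbound_one[OF sig(1)]] by blast
    have "L ?r = L (\<lambda>n. (\<Sum>k<N. w ^ k * (A ^^ k) one_co n) + w ^ N * (A ^^ N) ?r n)"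
      by (rule arg_cong[of _ _ L]) (rule ext, rule neumann_truncate)
    also have "\<dots> = L (\<lambda>n. \<Sum>k<N. w ^ k * (A ^^ k) one_co n) + w ^ N * L ((A ^^ N) ?r)"
      by (rule bdd_fun_lin[OF L C Apow_tbound[OF r]])
    also have "L (\<lambda>n. \<Sum>k<N. w ^ k * (A ^^ k) one_co n) = (\<Sum>k<N. w ^ k * L ((A ^^ k) one_co))"
      by (rule bdd_fun_sum[OF L]) (use Apow_tbound[OF tbound_one[OF sig(1)]] in blast)
    finally show ?thesis by (simp add: neumann_ser_def mult.commute)
  qed
  have "(\<lambda>N. w ^ N * L ((A ^^ N) ?r)) \<longlonglongrightarrow> 0"
  proof (rule Lim_null_comparison)
    show "(\<lambda>N. K * neumann_norm w * (cmod w ^ N * \<kappa> ^ (\<Sum>{..N}))) \<longlonglongrightarrow> 0"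
      by (intro tendsto_mult_right_zero summable_LIMSEQ_zero summable_triangular_power) (use kap in auto)
    show "\<forall>\<^sub>F N in sequentially. norm (w ^ N * L ((A ^^ N) ?r)) \<le> K * neumann_norm w * (cmod w ^ N * \<kappa> ^ (\<Sum>{..N}))"
    proof (intro always_eventually allI)
      fix N
      have "cmod (L ((A ^^ N) ?r)) \<le> K * (1 * neumann_norm w * \<kappa> ^ (\<Sum>{..N}))" by (intro K(2) Apow_tbound r)
      then have "cmod w ^ N * cmod (L ((A ^^ N) ?r)) \<le> cmod w ^ N * (K * (1 * neumann_norm w * \<kappa> ^ (\<Sum>{..N})))"
        by (intro mult_left_mono) auto
      then show "norm (w ^ N * L ((A ^^ N) ?r)) \<le> K * neumann_norm w * (cmod w ^ N * \<kappa> ^ (\<Sum>{..N}))"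
        by (simp add: norm_mult norm_power mult_ac)
    qed
  qed
  then have "(\<lambda>N. L ?r - w ^ N * L ((A ^^ N) ?r)) \<longlonglongrightarrow> L ?r - 0" by (intro tendsto_diff tendsto_const)
  moreover have "L ?r - w ^ N * L ((A ^^ N) ?r) = (\<Sum>k<N. neumann_ser L $ k * w ^ k)" for N using eq[of N] by simp
  ultimately have "(\<lambda>k. neumann_ser L $ k * w ^ k) sums L ?r" by (simp add: sums_def)
  then show ?thesis by (simp add: eval_fps_def sums_iff)
qed

primrec iter_co :: "nat \<Rightarrow> nat \<Rightarrow> complex" where
  "iter_co 0 = one_co" | "iter_co (Suc N) = (\<lambda>n. A (iter_co N) n + half_mean (tfun (iter_co N)) * one_co n)"

lemma iter_co_tbound: "\<exists>C. tbound \<sigma> C (iter_co N)"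
proof (induction N)
  case 0 show ?case using tbound_one[OF sig(1)] by auto
next
  case (Suc N)
  then obtain C where "tbound \<sigma> C (iter_co N)" ..
  from tbound_lin[OF A_tbound_sig[OF this] tbound_one[OF sig(1)]] show ?case by auto
qed

text \<open>Unfolding \<open>T = \<ell> 1 + A\<close> from the last occurrence of the rank-one
  part.\<close>

lemma iter_co_renewal: "iter_co N n = (A ^^ N) one_co n + (\<Sum>i<N. half_mean (tfun (iter_co i)) * (A ^^ (N - 1 - i)) one_co n)"
proof (induction N arbitrary: n)
  case (Suc N)
  have "A (iter_co N) n = A (\<lambda>n. (A ^^ N) one_co n + (\<Sum>i<N. half_mean (tfun (iter_co i)) * (A ^^ (N - 1 - i)) one_co n)) n"
    using Suc by (intro volterra_cong) auto
  also have "\<dots> = (A ^^ Suc N) one_co n + (\<Sum>i<N. half_mean (tfun (iter_co i)) * (A ^^ Suc (N - 1 - i)) one_co n)"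
    by (simp add: volterra_add volterra_sum volterra_cmult)
  also have "(\<Sum>i<N. half_mean (tfun (iter_co i)) * (A ^^ Suc (N - 1 - i)) one_co n) = (\<Sum>i<N. half_mean (tfun (iter_co i)) * (A ^^ (Suc N - 1 - i)) one_co n)"
    by (intro sum.cong refl) (simp add: Suc_diff_Suc)
  finally show ?case by simp
qed simp

text \<open>The generating function of \<open>\<ell>(T\<^sup>N 1)\<close>, shifted by one index
  and with leading coefficient \<open>1\<close>; the shift makes it the exact reciprocal of the
  characteristic series.\<close>

definition renewal_ser :: "complex fps" where
  "renewal_ser = Abs_fps (\<lambda>n. case n of 0 \<Rightarrow> 1 | Suc i \<Rightarrow> half_mean (tfun (iter_co i)))"

lemma neumann_ser_renewal: assumes L: "bdd_fun L" shows "Abs_fps (\<lambda>N. L (iter_co N)) = renewal_ser * neumann_ser L"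
proof (rule fps_ext)
  fix N
  have tbs: "\<exists>C. tbound \<sigma> C ((A ^^ j) one_co)" for j using Apow_tbound[OF tbound_one[OF sig(1)]] by blast
  have "\<exists>C. tbound \<sigma> C (\<lambda>n. \<Sum>i<N. half_mean (tfun (iter_co i)) * (A ^^ (N - 1 - i)) one_co n)"
    by (rule tbound_sum) (rule tbs)
  then obtain C where C: "tbound \<sigma> C (\<lambda>n. \<Sum>i<N. half_mean (tfun (iter_co i)) * (A ^^ (N - 1 - i)) one_co n)" ..
  obtain D where D: "tbound \<sigma> D ((A ^^ N) one_co)" using tbs by blast
  have "L (iter_co N) = L (\<lambda>n. (A ^^ N) one_co n + 1 * (\<Sum>i<N. half_mean (tfun (iter_co i)) * (A ^^ (N - 1 - i)) one_co n))"
    by (rule arg_cong[of _ _ L]) (rule ext, simp add: iter_co_renewal)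
  also have "\<dots> = L ((A ^^ N) one_co) + (\<Sum>i<N. half_mean (tfun (iter_co i)) * L ((A ^^ (N - 1 - i)) one_co))"
    by (subst bdd_fun_lin[OF L D C], subst bdd_fun_sum[OF L]) (use tbs in auto)
  also have "\<dots> = (renewal_ser * neumann_ser L) $ N"
  proof (cases N)
    case 0 then show ?thesis by (simp add: renewal_ser_def neumann_ser_def)
  next
    case (Suc M)
    have "(renewal_ser * neumann_ser L) $ N = renewal_ser $ 0 * neumann_ser L $ N + (\<Sum>i=0..M. renewal_ser $ Suc i * neumann_ser L $ (N - Suc i))"
      unfolding fps_mult_nth Suc by (subst sum.atLeast0_atMost_Suc_shift) simp
    also have "(\<Sum>i=0..M. renewal_ser $ Suc i * neumann_ser L $ (N - Suc i)) = (\<Sum>i<N. half_mean (tfun (iter_co i)) * L ((A ^^ (N - 1 - i)) one_co))"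
      unfolding Suc lessThan_Suc_atMost atMost_atLeast0 by (intro sum.cong refl) (simp add: renewal_ser_def neumann_ser_def)
    finally show ?thesis by (simp add: renewal_ser_def neumann_ser_def)
  qed
  finally show "Abs_fps (\<lambda>N. L (iter_co N)) $ N = (renewal_ser * neumann_ser L) $ N" by simp
qed

text \<open>The function \<open>D(w) = 1 - w \<ell>((1 - w A)\<^bsup>-1\<^esup> 1)\<close> whose
  zeros are the reciprocals of the non-zero eigenvalues.\<close>

definition char_ser :: "complex fps" where "char_ser = 1 - fps_X * neumann_ser (\<lambda>c. half_mean (tfun c))"

lemma char_ser_radius: "fps_conv_radius char_ser = \<infinity>"
proof -
  have "fps_conv_radius (fps_X * neumann_ser (\<lambda>c. half_mean (tfun c))) \<ge> \<infinity>"
    using fps_conv_radius_mult[of fps_X "neumann_ser (\<lambda>c. half_mean (tfun c))"] by (simp add: neumann_ser_radius[OF bdd_fun_half_mean])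
  then have "fps_conv_radius char_ser \<ge> \<infinity>"
    using fps_conv_radius_diff[of 1 "fps_X * neumann_ser (\<lambda>c. half_mean (tfun c))"] by (simp add: char_ser_def)
  then show ?thesis by simp
qed

lemma char_ser_eval: "eval_fps char_ser w = 1 - w * half_mean (tfun (neumann \<rho> w one_co))"
proof -
  have r: "fps_conv_radius (fps_X * neumann_ser (\<lambda>c. half_mean (tfun c))) = \<infinity>"
    using fps_conv_radius_mult[of fps_X "neumann_ser (\<lambda>c. half_mean (tfun c))"] by (simp add: neumann_ser_radius[OF bdd_fun_half_mean])
  have "eval_fps char_ser w = 1 - eval_fps (fps_X * neumann_ser (\<lambda>c. half_mean (tfun c))) w"
    unfolding char_ser_def by (subst eval_fps_diff) (simp_all add: r)
  also have "eval_fps (fps_X * neumann_ser (\<lambda>c. half_mean (tfun c))) w = w * eval_fps (neumann_ser (\<lambda>c. half_mean (tfun c))) w"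
    by (subst eval_fps_mult) (simp_all add: neumann_ser_radius[OF bdd_fun_half_mean])
  finally show ?thesis by (simp add: neumann_ser_eval[OF bdd_fun_half_mean])
qed

lemma renewal_char: "renewal_ser * char_ser = 1"
proof -
  have "renewal_ser = 1 + fps_X * Abs_fps (\<lambda>N. half_mean (tfun (iter_co N)))"
    by (rule fps_ext) (simp add: renewal_ser_def split: nat.split)
  also have "Abs_fps (\<lambda>N. half_mean (tfun (iter_co N))) = renewal_ser * neumann_ser (\<lambda>c. half_mean (tfun c))" by (rule neumann_ser_renewal[OF bdd_fun_half_mean])
  finally have "renewal_ser = 1 + fps_X * (renewal_ser * neumann_ser (\<lambda>c. half_mean (tfun c)))" .
  then show ?thesis unfolding char_ser_def by (simp add: algebra_simps)
qed

end

section \<open>Iterates of the operator and the positive eigenfunction\<close>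

text \<open>The integral of \<open>f\<close> over \<open>B\<close> with respect to the standard
  normal law.\<close>

definition gint :: "real set \<Rightarrow> (real \<Rightarrow> real) \<Rightarrow> real" where
  "gint B f = (LINT y:B|lborel. f y * std_normal_density y)"

lemma gint_mono:
  assumes "A \<subseteq> B" "A \<in> sets borel" "B \<in> sets borel"
    and "integrable lborel (\<lambda>y. f y * std_normal_density y)" "integrable lborel (\<lambda>y. g y * std_normal_density y)"
    and "\<And>y. y \<in> A \<Longrightarrow> f y \<le> g y" "\<And>y. y \<in> B \<Longrightarrow> 0 \<le> g y"
  shows "gint A f \<le> gint B g"
  unfolding gint_def set_lebesgue_integral_def
proof (rule integral_mono)
  fix y show "indicator A y *\<^sub>R (f y * std_normal_density y) \<le> indicator B y *\<^sub>R (g y * std_normal_density y)"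
    using assms(1,6,7) by (auto simp: indicator_def intro!: mult_right_mono)
qed (intro integrable_mult_indicator; use assms in simp)+

lemma gint_cmult: "gint A (\<lambda>y. c * f y) = c * gint A f"
  unfolding gint_def mult.assoc by simp

lemma integrable_const_gauss: "integrable lborel (\<lambda>y. c * std_normal_density y)"
  using gauss_poly_integrable[of "[:c:]"] by simp

lemma gint_UNIV_1: "gint UNIV (\<lambda>_. 1) = 1"
  using integral_std_normal_moment_even[of 0] by (simp add: gint_def set_lebesgue_integral_def)

lemma gint_half_even:
  assumes even: "\<And>x. g (- x) = g x" and int: "integrable lborel (\<lambda>y. g y * std_normal_density y)"
  shows "gint {0..} g = gint UNIV g / 2" "gint {..0} g = gint UNIV g / 2"
proof -
  have e: "gint {0..} g = gint {..0} g"
    unfolding gint_def set_lebesgue_integral_def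
    by (subst lborel_integral_real_affine[of "-1" _ 0]) (auto simp: even std_normal_density_def indicator_def intro!: Bochner_Integration.integral_cong)
  have i: "set_integrable lborel B (\<lambda>y. g y * std_normal_density y)" if "B \<in> sets borel" for B
    unfolding set_integrable_def using that int by (intro integrable_mult_indicator) auto
  have "AE y in lborel. \<not> (y \<in> {..0::real} \<and> y \<in> {0..})"
    using AE_lborel_singleton[of 0] by eventually_elim auto
  then have "gint ({..0} \<union> {0..}) g = gint {..0} g + gint {0..} g"
    unfolding gint_def by (intro set_integral_Un_AE i) auto
  moreover have "{..0::real} \<union> {0..} = UNIV" by auto
  ultimately show "gint {0..} g = gint UNIV g / 2" "gint {..0} g = gint UNIV g / 2" using e by simp_all
qed

lemma gint_half: "gint {0..} (\<lambda>_. 1) = 1/2" "gint {..0} (\<lambda>_. 1) = 1/2"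
  using gint_half_even[of "\<lambda>_. 1", OF refl integrable_const_gauss] gint_UNIV_1 by simp_all

lemma gint_of_real:
  "(LINT y:B|lborel. complex_of_real (f y) * complex_of_real (std_normal_density y)) = complex_of_real (gint B f)"
  unfolding gint_def set_lebesgue_integral_def
  by (simp add: scaleR_conv_of_real flip: of_real_mult integral_complex_of_real)

lemma gauss_integrable_Re:
  assumes "integrable lborel (\<lambda>y. f y * complex_of_real (std_normal_density y))"
  shows "integrable lborel (\<lambda>y. Re (f y) * std_normal_density y)"
  using integrable_Re[OF assms] by simp

context ma1 begin

primrec iter :: "nat \<Rightarrow> real \<Rightarrow> real" where
  "iter 0 = (\<lambda>x. 1)" | "iter (Suc n) = (\<lambda>x. gint {- \<rho> * x..} (iter n))"

lemma iter_co_Hq: "tfun (iter_co n) \<in> Hq q"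
  using iter_co_tbound[of n] tbound_in_Hq(1) by blast

lemma iter_eq_tfun: "complex_of_real (iter n x) = tfun (iter_co n) x"
proof (induction n arbitrary: x)
  case 0 show ?case by (simp add: tfun_one)
next
  case (Suc n)
  obtain C where C: "tbound \<sigma> C (iter_co n)" using iter_co_tbound by blast
  have "complex_of_real (iter (Suc n) x) = T_op \<rho> (tfun (iter_co n)) x"
    unfolding T_op_def Suc[symmetric] gint_of_real by simp
  also have "\<dots> = half_mean (tfun (iter_co n)) + tfun (A (iter_co n)) x"
    by (rule T_op_eq[OF tbound_sig_tau[OF C] iter_co_Hq])
  also have "\<dots> = tfun (iter_co (Suc n)) x"
    using tfun_lin[OF A_tbound_sig[OF C] tbound_one[OF sig(1)], of "half_mean (tfun (iter_co n))"] by (simp add: tfun_one)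
  finally show ?case .
qed

lemma iter_Re: "iter n = (\<lambda>x. Re (tfun (iter_co n) x))"
  using iter_eq_tfun[of n] by (auto simp: fun_eq_iff) (metis Re_complex_of_real)

lemma iter_cont: "continuous_on B (iter n)"
proof -
  obtain C where "tbound \<sigma> C (iter_co n)" using iter_co_tbound by blast
  from tfun_continuous[OF this sig(1)] show ?thesis unfolding iter_Re by (intro continuous_intros)
qed

lemma iter_integrable: "integrable lborel (\<lambda>y. iter n y * std_normal_density y)"
  unfolding iter_Re by (intro gauss_integrable_Re Hq_integrable[OF iter_co_Hq q])

lemma iter_nonneg: "0 \<le> iter n x"
proof (induction n arbitrary: x)
  case (Suc n)
  then show ?case unfolding iter.simps gint_def set_lebesgue_integral_def by (intro integral_nonneg_AE) auto
qed simp

lemma iter_le: "(\<And>x. iter n x \<le> M) \<Longrightarrow> 0 \<le> M \<Longrightarrow> B \<in> sets borel \<Longrightarrow> C \<in> sets borel \<Longrightarrow> B \<subseteq> C \<Longrightarrow> gint B (iter n) \<le> M * gint C (\<lambda>_. 1)"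
  unfolding gint_cmult[symmetric] by (rule gint_mono) (auto intro: iter_integrable integrable_const_gauss)

lemma iter_le_1: "iter n x \<le> 1"
proof (induction n arbitrary: x)
  case (Suc n)
  show ?case using iter_le[OF Suc, of "{- \<rho> * x..}" UNIV] gint_UNIV_1 by simp
qed simp

text \<open>On one of the two half-lines the integral defining the next iterate extends at most
  over \<open>[0, \<infinity>)\<close>, which has mass \<open>1/2\<close>. Averaging over both
  half-lines, two steps lose at least the factor \<open>1/2 + 1/4\<close>.\<close>

lemma iter_two:
  assumes M: "\<And>x. iter n x \<le> M" "0 \<le> M"
  shows "iter (Suc (Suc n)) x \<le> 3/4 * M"
proof -
  (* The half-line on which \<rho> y is at most 0, so that -\<rho> y is at least 0. *)
  define H where "H = (if 0 \<le> \<rho> then {..0::real} else {0..})"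
  have H [measurable]: "H \<in> sets borel" by (simp add: H_def)
  have h: "gint H (\<lambda>_. 1) = 1/2" by (simp add: H_def gint_half)
  have b1: "iter (Suc n) y \<le> M" for y
    using iter_le[OF M, of "{- \<rho> * y..}" UNIV] gint_UNIV_1 by simp
  have b2: "iter (Suc n) y \<le> M / 2" if "y \<in> H" for y
  proof -
    have "\<rho> * y \<le> 0" using that by (auto simp: H_def mult_le_0_iff split: if_splits)
    then have "{- \<rho> * y..} \<subseteq> {0..}" by auto
    then show ?thesis using iter_le[OF M, of "{- \<rho> * y..}" "{0..}"] gint_half by simp
  qed
  have i: "integrable lborel (\<lambda>y. indicator H y * std_normal_density y)"
    using integrable_mult_indicator[of H lborel "\<lambda>y. 1 * std_normal_density y"] integrable_const_gauss[of 1] by simp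
  have i2: "integrable lborel (\<lambda>y. (M - M / 2 * indicator H y) * std_normal_density y)"
    unfolding left_diff_distrib mult.assoc
    by (intro Bochner_Integration.integrable_diff integrable_const_gauss integrable_mult_right i)
  have "iter (Suc (Suc n)) x \<le> gint UNIV (\<lambda>y. M - M / 2 * indicator H y)"
    unfolding iter.simps(2)[of "Suc n"]
    by (rule gint_mono) (use b1 b2 iter_integrable[of "Suc n"] i2 M(2) in \<open>auto simp: indicator_def\<close>)
  also have "\<dots> = M * gint UNIV (\<lambda>_. 1) - M / 2 * gint H (\<lambda>_. 1)"
  proof -
    have "(\<integral>y. (M - M / 2 * indicator H y) * std_normal_density y \<partial>lborel)
        = (\<integral>y. M * std_normal_density y - M / 2 * (indicator H y * std_normal_density y) \<partial>lborel)"
      by (simp add: algebra_simps)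
    also have "\<dots> = (\<integral>y. M * std_normal_density y \<partial>lborel) - (\<integral>y. M / 2 * (indicator H y * std_normal_density y) \<partial>lborel)"
      by (intro Bochner_Integration.integral_diff integrable_const_gauss integrable_mult_right i)
    finally show ?thesis by (simp add: gint_def set_lebesgue_integral_def)
  qed
  finally show ?thesis by (simp add: gint_UNIV_1 h)
qed

lemma iter_geometric: "iter (2 * n) x \<le> (3/4) ^ n"
proof (induction n arbitrary: x)
  case (Suc n) show ?case using iter_two[OF Suc] by simp
qed simp

text \<open>A lower bound for the standard normal mass of \<open>[|\<rho>|, 1]\<close>.\<close>

definition "\<delta> = std_normal_density 1 * (1 - \<bar>\<rho>\<bar>)"

lemma delta: "0 < \<delta>" using rho_less_1 by (simp add: \<delta>_def normal_density_pos)

lemma iter_block: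
  assumes M: "\<And>x. 0 \<le> x \<Longrightarrow> x \<le> 1 \<Longrightarrow> M \<le> iter n x" "0 \<le> M" and B: "B \<in> sets borel" "{\<bar>\<rho>\<bar>..1} \<subseteq> B"
  shows "M * \<delta> \<le> gint B (iter n)"
proof -
  have dec: "std_normal_density 1 \<le> std_normal_density y" if "0 \<le> y" "y \<le> 1" for y
    using that by (simp add: std_normal_density_def divide_right_mono power_le_one)
  have "M * \<delta> = (LINT y:{\<bar>\<rho>\<bar>..1}|lborel. M * std_normal_density 1)"
    using rho_less_1 by (simp add: \<delta>_def set_lebesgue_integral_def)
  also have "\<dots> \<le> gint B (iter n)"
    unfolding gint_def set_lebesgue_integral_def
  proof (rule integral_mono)
    show "integrable lborel (\<lambda>y. indicator {\<bar>\<rho>\<bar>..1} y *\<^sub>R (M * std_normal_density 1))"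
      by (intro integrable_scaleR_left integrable_real_indicator) (auto simp: emeasure_lborel_Icc_eq)
    show "integrable lborel (\<lambda>y. indicator B y *\<^sub>R (iter n y * std_normal_density y))"
      by (intro integrable_mult_indicator iter_integrable) (use B in simp)
    fix y
    show "indicator {\<bar>\<rho>\<bar>..1} y *\<^sub>R (M * std_normal_density 1) \<le> indicator B y *\<^sub>R (iter n y * std_normal_density y)"
      using B(2) M iter_nonneg[of n y] dec[of y] by (auto simp: indicator_def intro!: mult_mono)
  qed
  finally show ?thesis .
qed

text \<open>For \<open>x\<close> in \<open>[0, 1]\<close> the domain of integration contains
  \<open>[|\<rho>|, 1]\<close>, which is again part of \<open>[0, 1]\<close>.\<close>

lemma iter_lower: "0 \<le> x \<Longrightarrow> x \<le> 1 \<Longrightarrow> \<delta> ^ n \<le> iter n x"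
proof (induction n arbitrary: x)
  case (Suc n)
  have "- \<rho> * x \<le> \<bar>\<rho>\<bar> * x" using Suc.prems by (intro mult_right_mono) auto
  also have "\<dots> \<le> \<bar>\<rho>\<bar>" using Suc.prems by (simp add: mult_left_le)
  finally have "\<delta> ^ n * \<delta> \<le> gint {- \<rho> * x..} (iter n)"
    using delta by (intro iter_block Suc.IH) auto
  then show ?case by (simp add: mult.commute)
qed simp

definition renewal_seq :: "nat \<Rightarrow> real" where "renewal_seq n = (case n of 0 \<Rightarrow> 1 | Suc i \<Rightarrow> gint {0..} (iter i))"

lemma half_mean_iter_co: "half_mean (tfun (iter_co i)) = of_real (gint {0..} (iter i))"
  unfolding half_mean_def iter_eq_tfun[symmetric] by (rule gint_of_real)

lemma renewal_ser_eq: "renewal_ser = Abs_fps (\<lambda>n. complex_of_real (renewal_seq n))"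
  by (rule fps_ext) (simp add: renewal_ser_def renewal_seq_def half_mean_iter_co split: nat.split)

text \<open>The radius of convergence; its reciprocal turns out to be the spectral radius and the
  persistence exponent.\<close>

definition "pole = real_of_ereal (fps_conv_radius renewal_ser)"

lemma pole: "0 < pole" "ereal pole = fps_conv_radius renewal_ser" "eval_fps char_ser (of_real pole) = 0"
  and renewal_char_eval: "cmod w < pole \<Longrightarrow> eval_fps renewal_ser w * eval_fps char_ser w = 1"
proof -
  have b0: "0 \<le> renewal_seq n" for n
    using iter_nonneg by (auto simp: renewal_seq_def gint_def set_lebesgue_integral_def split: nat.split intro!: integral_nonneg_AE)
  have b1: "renewal_seq n \<le> 1" for n
    using iter_le[OF iter_le_1, of "{0..}" UNIV] gint_UNIV_1 by (auto simp: renewal_seq_def split: nat.split)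
  have b2: "\<delta> ^ n \<le> renewal_seq n" for n
  proof (cases n)
    case (Suc i)
    have "\<delta> ^ i * \<delta> \<le> gint {0..} (iter i)" using delta by (intro iter_block iter_lower) auto
    then show ?thesis by (simp add: renewal_seq_def Suc mult.commute)
  qed (simp add: renewal_seq_def)
  obtain r where r: "0 < r" "ereal r = fps_conv_radius renewal_ser" "eval_fps char_ser (of_real r) = 0"
     "\<And>w. cmod w < r \<Longrightarrow> eval_fps renewal_ser w * eval_fps char_ser w = 1"
    using nonneg_fps_inverse_pole[OF char_ser_radius renewal_char[unfolded renewal_ser_eq] b0 b1 b2 delta] unfolding renewal_ser_eq[symmetric] by blast
  have "r = pole" unfolding pole_def r(2)[symmetric] by simp
  then show "0 < pole" "ereal pole = fps_conv_radius renewal_ser" "eval_fps char_ser (of_real pole) = 0"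
    "cmod w < pole \<Longrightarrow> eval_fps renewal_ser w * eval_fps char_ser w = 1" using r by auto
qed

lemma char_ser_nonzero: "cmod w < pole \<Longrightarrow> eval_fps char_ser w \<noteq> 0" using renewal_char_eval[of w] by auto

lemma renewal_ser_eval_real:
  assumes x: "0 \<le> x" "x < pole" obtains y where "y > 0" "eval_fps renewal_ser (of_real x) = of_real y"
proof -
  have xr: "ereal (norm (complex_of_real x)) < fps_conv_radius renewal_ser" using x pole(2)[symmetric] by simp
  have b0: "0 \<le> renewal_seq n" for n
    using iter_nonneg by (auto simp: renewal_seq_def gint_def set_lebesgue_integral_def split: nat.split intro!: integral_nonneg_AE)
  from norm_summable_fps[OF xr] have s: "summable (\<lambda>n. renewal_seq n * x ^ n)"
    using b0 x by (simp add: renewal_ser_eq norm_mult norm_power)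
  have e: "eval_fps renewal_ser (of_real x) = of_real (\<Sum>n. renewal_seq n * x ^ n)"
    using suminf_of_real[OF s, where 'a = complex] by (simp add: eval_fps_def renewal_ser_eq)
  have "(\<Sum>n. renewal_seq n * x ^ n) \<ge> renewal_seq 0 * x ^ 0"
    using sum_le_suminf[OF s, of "{0}"] b0 x by simp
  then show ?thesis using e that by (simp add: renewal_seq_def)
qed

definition "eigenfun = tfun (neumann \<rho> pole one_co)"

lemma eigenfun_tbound: "tbound \<sigma> (1 * neumann_norm pole) (neumann \<rho> pole one_co)"
  by (intro neumann_tbound_sig tbound_one sig)

lemma eigenfun_Hq: "eigenfun \<in> Hq q" unfolding eigenfun_def by (rule tbound_in_Hq(1)[OF eigenfun_tbound])

lemma eigenfun_at_0: "eigenfun 0 = 1"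
  by (simp add: eigenfun_def tfun_at_0 neumann_def one_co_def)

lemma half_mean_eigenfun: "half_mean eigenfun = of_real (1 / pole)"
  using pole(1,3) unfolding char_ser_eval eigenfun_def by (simp add: field_simps)

lemma T_eigenfun: "T_op \<rho> eigenfun x = of_real (1 / pole) * eigenfun x"
proof -
  have "eigenfun x = tfun (\<lambda>n. one_co n + of_real pole * A (neumann \<rho> pole one_co) n) x"
    unfolding eigenfun_def by (rule arg_cong[of _ _ "\<lambda>c. tfun c x"]) (rule ext, rule neumann_fixpoint)
  also have "\<dots> = 1 + of_real pole * tfun (A (neumann \<rho> pole one_co)) x"
    using tfun_lin[OF tbound_one[OF sig(1)] A_tbound_sig[OF eigenfun_tbound]] by (simp add: tfun_one)
  finally have e: "eigenfun x = 1 + of_real pole * tfun (A (neumann \<rho> pole one_co)) x" .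
  have "T_op \<rho> eigenfun x = half_mean eigenfun + tfun (A (neumann \<rho> pole one_co)) x"
    unfolding eigenfun_def by (rule T_op_eq[OF tbound_sig_tau[OF eigenfun_tbound] eigenfun_Hq[unfolded eigenfun_def]])
  then show ?thesis using e pole(1) by (simp add: half_mean_eigenfun field_simps)
qed

text \<open>For \<open>0 \<le> w < R\<close> the value of \<open>(1 - w A)\<^bsup>-1\<^esup>
  1\<close> at \<open>x\<close> is the quotient of \<open>\<Sum>\<^sub>N w\<^sup>N (T\<^sup>N
  1)(x)\<close> and of the renewal series, both of which are non-negative. The inequality survives
  the limit \<open>w \<rightarrow> R\<close> because the left hand side is entire in
  \<open>w\<close>.\<close>

lemma eigenfun_nonneg: "eigenfun x \<in> \<real>\<^sub>\<ge>\<^sub>0"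
proof -
  let ?E = "neumann_ser (\<lambda>c. tfun c x)"
  have rE: "fps_conv_radius ?E = \<infinity>" by (rule neumann_ser_radius[OF bdd_fun_tfun])
  have pos: "eval_fps ?E (of_real w) \<in> \<real>\<^sub>\<ge>\<^sub>0" if w: "0 \<le> w" "w < pole" for w
  proof -
    have wr: "ereal (norm (complex_of_real w)) < fps_conv_radius renewal_ser" using w pole(2)[symmetric] by simp
    obtain y where y: "y > 0" "eval_fps renewal_ser (of_real w) = of_real y" using renewal_ser_eval_real[OF w] .
    have eq: "Abs_fps (\<lambda>N. complex_of_real (iter N x)) = renewal_ser * ?E"
      using neumann_ser_renewal[OF bdd_fun_tfun, of x] by (simp add: iter_eq_tfun)
    have "fps_conv_radius (renewal_ser * ?E) \<ge> ereal pole"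
      using fps_conv_radius_mult[of renewal_ser ?E] rE pole(2) by simp
    then have "ereal (norm (complex_of_real w)) < fps_conv_radius (renewal_ser * ?E)"
      using w by (elim less_le_trans[rotated]) simp
    from summable_fps[OF this] have s: "summable (\<lambda>N. iter N x * w ^ N)"
      unfolding eq[symmetric] by (simp flip: of_real_power of_real_mult add: summable_of_real_iff)
    have "eval_fps renewal_ser (of_real w) * eval_fps ?E (of_real w) = eval_fps (renewal_ser * ?E) (of_real w)"
      by (rule eval_fps_mult[symmetric]) (use wr rE in auto)
    also have "\<dots> = of_real (\<Sum>N. iter N x * w ^ N)"
      unfolding eq[symmetric] eval_fps_def using suminf_of_real[OF s, where 'a = complex] by simp
    finally have "eval_fps ?E (of_real w) = of_real ((\<Sum>N. iter N x * w ^ N) / y)"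
      using y by (simp add: field_simps)
    moreover have "0 \<le> (\<Sum>N. iter N x * w ^ N)"
      using w iter_nonneg by (intro suminf_nonneg s) auto
    ultimately show ?thesis using y by simp
  qed
  have cont: "continuous_on UNIV (\<lambda>w. eval_fps ?E (complex_of_real w))"
    by (rule continuous_on_compose2[of UNIV "eval_fps ?E"])
      (use continuous_on_eval_fps[of ?E] rE in \<open>auto intro: continuous_intros\<close>)
  have "closed ((\<lambda>w. eval_fps ?E (complex_of_real w)) -` \<real>\<^sub>\<ge>\<^sub>0)"
    by (rule closed_vimage[OF closed_nonneg_Reals_complex cont])
  moreover have "{0..<pole} \<subseteq> (\<lambda>w. eval_fps ?E (complex_of_real w)) -` \<real>\<^sub>\<ge>\<^sub>0" using pos by auto
  ultimately have "closure {0..<pole} \<subseteq> (\<lambda>w. eval_fps ?E (complex_of_real w)) -` \<real>\<^sub>\<ge>\<^sub>0" by (rule closure_minimal[rotated])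
  then have "pole \<in> (\<lambda>w. eval_fps ?E (complex_of_real w)) -` \<real>\<^sub>\<ge>\<^sub>0" by (rule subsetD) (use pole(1) in simp)
  then have "eval_fps ?E (of_real pole) \<in> \<real>\<^sub>\<ge>\<^sub>0" by (rule vimageD)
  then show ?thesis unfolding eigenfun_def neumann_ser_eval[OF bdd_fun_tfun] .
qed

definition "eigenfun_re x = Re (eigenfun x)"

lemma eigenfun_eq_re: "eigenfun x = of_real (eigenfun_re x)" and eigenfun_re_nonneg: "0 \<le> eigenfun_re x"
  using eigenfun_nonneg[of x] by (auto simp: eigenfun_re_def nonneg_Reals_def)

lemma eigenfun_re_integrable: "integrable lborel (\<lambda>y. eigenfun_re y * std_normal_density y)"
  unfolding eigenfun_re_def[abs_def] by (intro gauss_integrable_Re Hq_integrable[OF eigenfun_Hq q])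

lemma eigenfun_re_eq: "eigenfun_re x = pole * gint {- \<rho> * x..} eigenfun_re"
proof -
  have "of_real (gint {- \<rho> * x..} eigenfun_re) = T_op \<rho> eigenfun x"
    unfolding T_op_def eigenfun_eq_re gint_of_real by simp
  also have "\<dots> = of_real (eigenfun_re x / pole)" unfolding T_eigenfun eigenfun_eq_re by simp
  finally have "gint {- \<rho> * x..} eigenfun_re = eigenfun_re x / pole" by (simp only: of_real_eq_iff)
  then show ?thesis using pole(1) by simp
qed

definition "eigen_sup = pole * gint UNIV eigenfun_re"

lemma eigenfun_re_le_eigen_sup: "eigenfun_re x \<le> eigen_sup"
proof -
  have "gint {- \<rho> * x..} eigenfun_re \<le> gint UNIV eigenfun_re"
    by (rule gint_mono) (auto intro: eigenfun_re_integrable eigenfun_re_nonneg)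
  then show ?thesis using eigenfun_re_eq[of x] pole(1) by (simp add: eigen_sup_def mult_left_mono)
qed

lemma eigenfun_re_at_0: "eigenfun_re 0 = 1" by (simp add: eigenfun_re_def eigenfun_at_0)

lemma eigen_sup_pos: "0 < eigen_sup" using eigenfun_re_le_eigen_sup[of 0] eigenfun_re_at_0 by simp

text \<open>Monotonicity of \<open>T\<close>, applied to the bounded eigenfunction.\<close>

lemma eigenfun_re_le_iter: "eigenfun_re x \<le> eigen_sup * pole ^ n * iter n x"
proof (induction n arbitrary: x)
  case 0 show ?case using eigenfun_re_le_eigen_sup by simp
next
  case (Suc n)
  have "eigenfun_re x = pole * gint {- \<rho> * x..} eigenfun_re" by (rule eigenfun_re_eq)
  also have "gint {- \<rho> * x..} eigenfun_re \<le> gint {- \<rho> * x..} (\<lambda>y. eigen_sup * pole ^ n * iter n y)"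
    by (rule gint_mono) (use Suc eigen_sup_pos pole(1) iter_nonneg in \<open>auto intro: eigenfun_re_integrable simp: mult.assoc intro!: integrable_mult_right iter_integrable\<close>)
  also have "\<dots> = eigen_sup * pole ^ n * iter (Suc n) x" by (simp add: gint_cmult)
  finally show ?case using pole(1) by (simp add: mult_ac)
qed

text \<open>Otherwise the eigenfunction would be dominated by a null sequence, although it equals
  \<open>1\<close> at \<open>0\<close>.\<close>

lemma pole_gt_1: "1 < pole"
proof (rule ccontr)
  assume "\<not> 1 < pole"
  then have "pole \<le> 1" by simp
  have "1 \<le> eigen_sup * (3/4) ^ n" for n
  proof -
    have "1 \<le> eigen_sup * pole ^ (2 * n) * iter (2 * n) 0" using eigenfun_re_le_iter[of 0 "2 * n"] eigenfun_re_at_0 by simp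
    also have "\<dots> \<le> eigen_sup * 1 * (3/4) ^ n"
      using eigen_sup_pos pole(1) \<open>pole \<le> 1\<close> iter_nonneg iter_geometric by (intro mult_mono power_le_one) auto
    finally show ?thesis by simp
  qed
  moreover have "(\<lambda>n. eigen_sup * (3/4) ^ n) \<longlonglongrightarrow> eigen_sup * 0" by (intro tendsto_intros LIMSEQ_power_zero) auto
  ultimately show False using LIMSEQ_le_const[of "\<lambda>n. eigen_sup * (3/4) ^ n" "eigen_sup * 0" 1] by auto
qed

lemma iter_mean_lower: "1 / (eigen_sup * pole ^ Suc n) \<le> gint UNIV (iter n)"
proof -
  have "gint {- \<rho> * 0..} eigenfun_re \<le> gint UNIV (\<lambda>y. eigen_sup * pole ^ n * iter n y)"
    by (rule gint_mono) (use eigenfun_re_le_iter eigen_sup_pos pole(1) iter_nonneg in \<open>auto intro: eigenfun_re_integrable simp: mult.assoc intro!: integrable_mult_right iter_integrable\<close>)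
  moreover have "gint {- \<rho> * 0..} eigenfun_re = 1 / pole"
    using eigenfun_re_eq[of 0] eigenfun_re_at_0 pole(1) by (simp add: field_simps)
  moreover have "gint UNIV (\<lambda>y. eigen_sup * pole ^ n * iter n y) = eigen_sup * pole ^ n * gint UNIV (iter n)" by (rule gint_cmult)
  ultimately have "1 / pole \<le> eigen_sup * pole ^ n * gint UNIV (iter n)" by simp
  then show ?thesis using eigen_sup_pos pole(1) by (simp add: field_simps)
qed

lemma iter_mean_upper:
  assumes w: "0 \<le> w" "w < pole" shows "\<exists>K. \<forall>n. gint UNIV (iter n) * w ^ n \<le> K"
proof -
  have e: "gauss_mean (tfun (iter_co n)) = of_real (gint UNIV (iter n))" for n
    unfolding gauss_mean_def iter_eq_tfun[symmetric] using gint_of_real[of UNIV] by (simp add: set_lebesgue_integral_def)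
  have eq: "Abs_fps (\<lambda>N. complex_of_real (gint UNIV (iter N))) = renewal_ser * neumann_ser (\<lambda>c. gauss_mean (tfun c))"
    using neumann_ser_renewal[OF bdd_fun_gauss_mean] by (simp add: e)
  have "fps_conv_radius (renewal_ser * neumann_ser (\<lambda>c. gauss_mean (tfun c))) \<ge> ereal pole"
    using fps_conv_radius_mult[of renewal_ser "neumann_ser (\<lambda>c. gauss_mean (tfun c))"] neumann_ser_radius[OF bdd_fun_gauss_mean] pole(2) by simp
  then have "ereal (norm (complex_of_real w)) < fps_conv_radius (renewal_ser * neumann_ser (\<lambda>c. gauss_mean (tfun c)))"
    using w by (elim less_le_trans[rotated]) simp
  from summable_fps[OF this] have s: "summable (\<lambda>N. gint UNIV (iter N) * w ^ N)"
    unfolding eq[symmetric] by (simp flip: of_real_power of_real_mult add: summable_of_real_iff)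
  then have "Bseq (\<lambda>N. gint UNIV (iter N) * w ^ N)" by (rule summable_imp_Bseq)
  then obtain K where K: "\<forall>n. norm (gint UNIV (iter n) * w ^ n) \<le> K" by (rule BseqE)
  have "gint UNIV (iter n) * w ^ n \<le> K" for n
    using spec[OF K, of n] by (simp only: real_norm_def abs_le_iff)
  then show ?thesis by blast
qed

end

section \<open>Persistence probabilities\<close>

text \<open>The correction term is \<open>e(N) = ln p(N) / ln l - N\<close>. The lower bound on
  \<open>p\<close> bounds it from above, because \<open>ln l < 0\<close>, and the upper bounds
  give \<open>e(N) \<ge> - \<epsilon> N\<close> eventually.\<close>

lemma exponential_rateI:
  fixes p :: "nat \<Rightarrow> real"
  assumes l: "0 < l" "l < 1" and c: "0 < c" and lower: "\<And>N. c * l ^ N \<le> p N"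
    and upper: "\<And>w. 0 < w \<Longrightarrow> w < 1 / l \<Longrightarrow> \<exists>K. \<forall>N. p N * w ^ N \<le> K"
  shows "\<exists>e. e \<in> o(\<lambda>N. real N) \<and> (\<forall>N. p N = l powr (real N + e N))"
proof -
  have lnl: "ln l < 0" using l by simp
  have pos: "0 < p N" for N using lower[of N] c l by (smt (verit) mult_pos_pos zero_less_power)
  define e where "e = (\<lambda>N. ln (p N) / ln l - real N)"
  have eq: "p N = l powr (real N + e N)" for N
    using lnl pos[of N] l by (simp add: e_def powr_def)
  have up: "e N \<le> ln c / ln l" for N
  proof -
    have "ln (c * l ^ N) \<le> ln (p N)" using lower[of N] c l by (intro ln_mono) auto
    then have "ln c + real N * ln l \<le> ln (p N)" using c l by (simp add: ln_mult ln_realpow)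
    then have "ln (p N) / ln l \<le> (ln c + real N * ln l) / ln l" using lnl by (intro divide_right_mono_neg) auto
    also have "\<dots> = ln c / ln l + real N" using lnl by (simp add: add_divide_distrib)
    finally show ?thesis by (simp add: e_def)
  qed
  have "e \<in> o(\<lambda>N. real N)"
  proof (rule landau_o.smallI)
    fix \<epsilon> :: real assume eps: "0 < \<epsilon>"
    (* Slightly below 1 / l; the gap in the exponent is half of the target \<epsilon>. *)
    define w where "w = l powr (\<epsilon> / 2 - 1)"
    have w0: "0 < w" using l by (simp add: w_def)
    have "w < l powr (- 1)" unfolding w_def using l eps by (intro powr_less_mono') auto
    also have "l powr (- 1) = 1 / l" using l by (simp add: powr_minus divide_simps)
    finally obtain K where K: "\<And>N. p N * w ^ N \<le> K" using upper[OF w0] by blast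
    have K0: "0 < K" using K[of 0] pos[of 0] by simp
    have low: "ln K / ln l - \<epsilon> / 2 * real N \<le> e N" for N
    proof -
      have "ln (p N * w ^ N) \<le> ln K" using K[of N] pos[of N] w0 by (intro ln_mono) auto
      then have "ln (p N) + real N * ln w \<le> ln K" using pos[of N] w0 by (simp add: ln_mult ln_realpow)
      moreover have "ln w = (\<epsilon> / 2 - 1) * ln l" using l by (simp add: w_def ln_powr)
      ultimately have "ln (p N) \<le> ln K - real N * (\<epsilon> / 2 - 1) * ln l" by simp
      then have "(ln K - real N * (\<epsilon> / 2 - 1) * ln l) / ln l \<le> ln (p N) / ln l" using lnl by (intro divide_right_mono_neg) auto
      moreover have "(ln K - real N * (\<epsilon> / 2 - 1) * ln l) / ln l = ln K / ln l - real N * (\<epsilon> / 2 - 1)"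
        using lnl by (simp add: diff_divide_distrib)
      ultimately show ?thesis by (simp add: e_def algebra_simps)
    qed
    show "\<forall>\<^sub>F N in at_top. norm (e N) \<le> \<epsilon> * norm (real N)"
    proof -
      obtain N0 :: nat where N0: "2 * (\<bar>ln c / ln l\<bar> + \<bar>ln K / ln l\<bar>) / \<epsilon> \<le> real N0"
        using real_arch_simple by blast
      show ?thesis
      proof (rule eventually_mono[OF eventually_ge_at_top[of N0]])
        fix N assume "N0 \<le> N"
        then have "2 * (\<bar>ln c / ln l\<bar> + \<bar>ln K / ln l\<bar>) / \<epsilon> \<le> real N" using N0 by linarith
        then have "\<bar>ln c / ln l\<bar> + \<bar>ln K / ln l\<bar> \<le> \<epsilon> / 2 * real N" using eps by (simp add: field_simps)
        moreover have "0 \<le> \<epsilon> / 2 * real N" using eps by simp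
        moreover have "\<epsilon> * real N = \<epsilon> / 2 * real N + \<epsilon> / 2 * real N" by simp
        ultimately show "norm (e N) \<le> \<epsilon> * norm (real N)"
          using up[of N] low[of N] by (simp only: real_norm_def abs_of_nat; linarith)
      qed
    qed
  qed
  then show ?thesis using eq by blast
qed

text \<open>The indicator of the event that the first \<open>n\<close> values of the process are
  non-negative, as a function of the path \<open>y\<close> of innovations.\<close>

definition nonneg_path :: "real \<Rightarrow> nat \<Rightarrow> (int \<Rightarrow> real) \<Rightarrow> real" where
  "nonneg_path \<rho> n y = (\<Prod>j<n. indicator {0..} (\<rho> * y (int j - 1) + y (int j)))"

lemma nonneg_path_bounds: "0 \<le> nonneg_path \<rho> n y" "nonneg_path \<rho> n y \<le> 1"
  unfolding nonneg_path_def by (auto intro!: prod_nonneg prod_le_1 simp: indicator_def)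

context ma1 begin

lemma iter_meas [measurable]: "iter n \<in> borel_measurable borel"
  by (intro borel_measurable_continuous_onI iter_cont)

lemma threshold_measurable: "(\<lambda>z. k * (indicator {0..} (c + z) * iter m z)) \<in> borel_measurable lborel"
proof -
  have "(\<lambda>z. k * (indicator {0..} (c + z) * iter m z)) \<in> borel_measurable borel" for k c :: real
    by measurable
  then show ?thesis by simp
qed

text \<open>Integrating out the innovation with index \<open>n\<close>, which is independent of
  the earlier ones: the condition \<open>\<rho> \<xi>\<^bsub>n-1\<^esub> + \<xi>\<^sub>n \<ge>
  0\<close> is the domain of integration in the definition of the next iterate.\<close>

lemma path_step:
  fixes M :: "'a measure" and \<xi> :: "int \<Rightarrow> 'a \<Rightarrow> real"
  assumes prob: "prob_space M"
    and indep: "prob_space.indep_vars M (\<lambda>_. borel) \<xi> {-1..}"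
    and normal: "\<And>i. i \<ge> -1 \<Longrightarrow> distributed M lborel (\<xi> i) std_normal_density"
  shows "(\<integral>\<omega>. nonneg_path \<rho> n (\<lambda>i. \<xi> i \<omega>) * iter (Suc m) (\<xi> (int n - 1) \<omega>) \<partial>M)
    = (\<integral>\<omega>. nonneg_path \<rho> (Suc n) (\<lambda>i. \<xi> i \<omega>) * iter m (\<xi> (int n) \<omega>) \<partial>M)"
proof -
  interpret prob_space M by (rule prob)
  define J where "J = {-1..<int n}"
  define P where "P = PiM J (\<lambda>_. borel :: real measure)"
  define Y where "Y = (\<lambda>\<omega>. restrict (\<lambda>i. \<xi> i \<omega>) J)"
  define Q where "Q = PiM {int n} (\<lambda>_. borel :: real measure)"
  define Z where "Z = (\<lambda>\<omega>. restrict (\<lambda>i. \<xi> i \<omega>) {int n})"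
  have ind: "indep_var P Y Q Z"
    unfolding P_def Y_def Q_def Z_def by (rule indep_var_restrict[OF indep]) (auto simp: J_def)
  have Y [measurable]: "Y \<in> M \<rightarrow>\<^sub>M P" and Z [measurable]: "Z \<in> M \<rightarrow>\<^sub>M Q"
    using indep_var_rv1[OF ind] indep_var_rv2[OF ind] by auto
  have dist: "distr M P Y \<Otimes>\<^sub>M distr M Q Z = distr M (P \<Otimes>\<^sub>M Q) (\<lambda>\<omega>. (Y \<omega>, Z \<omega>))"
    using ind unfolding indep_var_distribution_eq by simp
  have compQ [measurable]: "(\<lambda>z. z (int n)) \<in> borel_measurable Q"
    unfolding Q_def by (rule measurable_component_singleton) simp
  have comp [measurable]: "(\<lambda>y. y i) \<in> borel_measurable P" if "i \<in> J" for i
    unfolding P_def using that by (rule measurable_component_singleton)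
  have pm [measurable]: "nonneg_path \<rho> n \<in> borel_measurable P"
    unfolding nonneg_path_def[abs_def]
  proof (rule borel_measurable_prod)
    fix j assume "j \<in> {..<n}"
    then have "int j - 1 \<in> J" "int j \<in> J" by (auto simp: J_def)
    then have [measurable]: "(\<lambda>y. y (int j - 1)) \<in> borel_measurable P" "(\<lambda>y. y (int j)) \<in> borel_measurable P"
      by (simp_all add: comp)
    show "(\<lambda>y. indicator {0..} (\<rho> * y (int j - 1) + y (int j)) :: real) \<in> borel_measurable P" by measurable
  qed
  have [measurable]: "(\<lambda>y. y (int n - 1)) \<in> borel_measurable P" by (rule comp) (auto simp: J_def)
  (* Past and present innovations are both represented as families over index sets, as required
     by the notion of independence for pairs. *)
  define h where "h = (\<lambda>(y, z :: int \<Rightarrow> real). nonneg_path \<rho> n y * (indicator {0..} (\<rho> * y (int n - 1) + z (int n)) * iter m (z (int n))))"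
  have h [measurable]: "h \<in> borel_measurable (P \<Otimes>\<^sub>M Q)" unfolding h_def by measurable
  have hb: "norm (h p) \<le> 1" for p
  proof -
    obtain y z' where p: "p = (y, z')" by force
    let ?z = "z' (int n)"
    have "indicator {0..} (\<rho> * y (int n - 1) + ?z) * iter m ?z \<le> 1 * 1"
      using iter_le_1[of m ?z] iter_nonneg[of m ?z] by (auto simp: indicator_def)
    then have "nonneg_path \<rho> n y * (indicator {0..} (\<rho> * y (int n - 1) + ?z) * iter m ?z) \<le> 1 * 1"
      using nonneg_path_bounds[of \<rho> n y] iter_nonneg[of m ?z] by (intro mult_mono) auto
    moreover have "0 \<le> nonneg_path \<rho> n y * (indicator {0..} (\<rho> * y (int n - 1) + ?z) * iter m ?z)"
      using nonneg_path_bounds[of \<rho> n y] iter_nonneg[of m ?z] by (intro mult_nonneg_nonneg) auto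
    ultimately show ?thesis by (simp add: h_def p)
  qed
  interpret PY: prob_space "distr M P Y" by (rule prob_space_distr) simp
  interpret PZ: prob_space "distr M Q Z" by (rule prob_space_distr) simp
  interpret PP: pair_prob_space "distr M P Y" "distr M Q Z" ..
  have hP: "h \<in> borel_measurable (distr M P Y \<Otimes>\<^sub>M distr M Q Z)"
    using h by (simp add: measurable_distr_eq1 cong: measurable_cong_sets)
  have hint: "integrable (distr M P Y \<Otimes>\<^sub>M distr M Q Z) h"
    by (rule PP.integrable_const_bound[of _ 1]) (use hb hP in auto)
  note mm = threshold_measurable
  have inner: "(\<integral>z. h (y, z) \<partial>distr M Q Z) = nonneg_path \<rho> n y * iter (Suc m) (y (int n - 1))" if y: "y \<in> space P" for y
  proof -
    have [measurable]: "(\<lambda>z. h (y, z)) \<in> borel_measurable Q"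
      by (rule measurable_compose[OF measurable_Pair1' h]) (rule y)
    have "(\<integral>z. h (y, z) \<partial>distr M Q Z) = (\<integral>\<omega>. h (y, Z \<omega>) \<partial>M)"
      by (rule integral_distr) measurable
    also have "\<dots> = (\<integral>\<omega>. nonneg_path \<rho> n y * (indicator {0..} (\<rho> * y (int n - 1) + \<xi> (int n) \<omega>) * iter m (\<xi> (int n) \<omega>)) \<partial>M)"
      by (simp add: h_def Z_def)
    also have "\<dots> = (\<integral>z. std_normal_density z * (nonneg_path \<rho> n y * (indicator {0..} (\<rho> * y (int n - 1) + z) * iter m z)) \<partial>lborel)"
      by (rule distributed_integral[OF normal, symmetric]) (auto intro: mm)
    also have "\<dots> = (\<integral>z. nonneg_path \<rho> n y * (indicator {- \<rho> * y (int n - 1)..} z *\<^sub>R (iter m z * std_normal_density z)) \<partial>lborel)"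
      by (intro Bochner_Integration.integral_cong refl) (auto simp: indicator_def)
    also have "\<dots> = nonneg_path \<rho> n y * iter (Suc m) (y (int n - 1))"
      by (simp add: gint_def set_lebesgue_integral_def)
    finally show ?thesis .
  qed
  have r: "nonneg_path \<rho> n (Y \<omega>) = nonneg_path \<rho> n (\<lambda>i. \<xi> i \<omega>)" "Y \<omega> (int n - 1) = \<xi> (int n - 1) \<omega>" for \<omega>
    unfolding nonneg_path_def Y_def J_def by (auto intro!: prod.cong)
  have "(\<integral>\<omega>. nonneg_path \<rho> n (\<lambda>i. \<xi> i \<omega>) * iter (Suc m) (\<xi> (int n - 1) \<omega>) \<partial>M)
      = (\<integral>\<omega>. nonneg_path \<rho> n (Y \<omega>) * iter (Suc m) (Y \<omega> (int n - 1)) \<partial>M)" by (simp only: r)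
  also have "\<dots> = (\<integral>y. nonneg_path \<rho> n y * iter (Suc m) (y (int n - 1)) \<partial>distr M P Y)"
  proof (rule integral_distr[symmetric])
    show "(\<lambda>y. nonneg_path \<rho> n y * iter (Suc m) (y (int n - 1))) \<in> borel_measurable P"
      using iter_meas[of "Suc m"] by measurable
  qed simp
  also have "\<dots> = (\<integral>y. (\<integral>z. h (y, z) \<partial>distr M Q Z) \<partial>distr M P Y)"
    by (intro Bochner_Integration.integral_cong refl) (simp add: inner)
  also have "\<dots> = integral\<^sup>L (distr M P Y \<Otimes>\<^sub>M distr M Q Z) h"
    by (rule PP.integral_fst'[OF hint])
  also have "\<dots> = (\<integral>\<omega>. h (Y \<omega>, Z \<omega>) \<partial>M)"
    unfolding dist by (subst integral_distr) auto
  also have "\<dots> = (\<integral>\<omega>. nonneg_path \<rho> (Suc n) (\<lambda>i. \<xi> i \<omega>) * iter m (\<xi> (int n) \<omega>) \<partial>M)"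
  proof (rule Bochner_Integration.integral_cong[OF refl])
    fix \<omega>
    have "h (Y \<omega>, Z \<omega>) = nonneg_path \<rho> n (Y \<omega>) * (indicator {0..} (\<rho> * Y \<omega> (int n - 1) + \<xi> (int n) \<omega>) * iter m (\<xi> (int n) \<omega>))"
      by (simp add: h_def Z_def)
    also have "\<dots> = nonneg_path \<rho> (Suc n) (\<lambda>i. \<xi> i \<omega>) * iter m (\<xi> (int n) \<omega>)"
      unfolding r by (simp add: nonneg_path_def mult.assoc)
    finally show "h (Y \<omega>, Z \<omega>) = nonneg_path \<rho> (Suc n) (\<lambda>i. \<xi> i \<omega>) * iter m (\<xi> (int n) \<omega>)" .
  qed
  finally show ?thesis .
qed

lemma persistence_prob_eq:
  fixes M :: "'a measure" and \<xi> :: "int \<Rightarrow> 'a \<Rightarrow> real"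
  assumes prob: "prob_space M"
    and indep: "prob_space.indep_vars M (\<lambda>_. borel) \<xi> {-1..}"
    and normal: "\<And>i. i \<ge> -1 \<Longrightarrow> distributed M lborel (\<xi> i) std_normal_density"
  shows "persistence_prob M (MA1 \<rho> \<xi>) N = gint UNIV (iter (Suc N))"
proof -
  interpret prob_space M by (rule prob)
  define J where "J = (\<lambda>n m. \<integral>\<omega>. nonneg_path \<rho> n (\<lambda>i. \<xi> i \<omega>) * iter m (\<xi> (int n - 1) \<omega>) \<partial>M)"
  have step: "J n (Suc m) = J (Suc n) m" for n m
  proof -
    have "int (Suc n) - 1 = int n" by simp
    then show ?thesis unfolding J_def by (simp only: path_step[OF assms, of n m])
  qed
  have "J 0 m = J k (m - k)" if "k \<le> m" for k m
    using that
  proof (induction k)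
    case (Suc k)
    then have e: "m - k = Suc (m - Suc k)" by simp
    have "J 0 m = J k (m - k)" using Suc by simp
    also have "\<dots> = J (Suc k) (m - Suc k)" unfolding e by (rule step)
    finally show ?case .
  qed (simp only: diff_zero)
  from this[of "Suc N" "Suc N"] have J0: "J 0 (Suc N) = J (Suc N) 0" by (simp only: order_refl diff_self_eq_0)
  have "J (Suc N) 0 = (\<integral>\<omega>. indicator {\<omega> \<in> space M. \<forall>n\<le>N. MA1 \<rho> \<xi> n \<omega> \<ge> 0} \<omega> \<partial>M)"
    unfolding J_def
  proof (rule Bochner_Integration.integral_cong[OF refl])
    fix \<omega> assume w: "\<omega> \<in> space M"
    show "nonneg_path \<rho> (Suc N) (\<lambda>i. \<xi> i \<omega>) * iter 0 (\<xi> (int (Suc N) - 1) \<omega>) = indicator {\<omega> \<in> space M. \<forall>n\<le>N. MA1 \<rho> \<xi> n \<omega> \<ge> 0} \<omega>"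
    proof (cases "\<forall>n\<le>N. MA1 \<rho> \<xi> n \<omega> \<ge> 0")
      case True
      then show ?thesis using w by (auto simp: nonneg_path_def MA1_def lessThan_Suc_atMost intro!: prod.neutral)
    next
      case False
      then obtain n where "n \<le> N" "\<not> MA1 \<rho> \<xi> n \<omega> \<ge> 0" by auto
      then have "nonneg_path \<rho> (Suc N) (\<lambda>i. \<xi> i \<omega>) = 0"
        unfolding nonneg_path_def by (intro prod_zero) (auto intro!: bexI[of _ n] simp: MA1_def indicator_def)
      then show ?thesis using False by auto
    qed
  qed
  also have "\<dots> = persistence_prob M (MA1 \<rho> \<xi>) N"
  proof -
    have I: "{\<omega> \<in> space M. \<forall>n\<le>N. MA1 \<rho> \<xi> n \<omega> \<ge> 0} \<inter> space M = {\<omega> \<in> space M. \<forall>n\<le>N. MA1 \<rho> \<xi> n \<omega> \<ge> 0}"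
      by (rule Int_absorb2, rule subsetI, drule CollectD, erule conjunct1)
    show ?thesis unfolding persistence_prob_def
      by (simp only: Bochner_Integration.integral_indicator I)
  qed
  finally have "persistence_prob M (MA1 \<rho> \<xi>) N = J 0 (Suc N)" using J0 by (simp only:)
  also have "\<dots> = (\<integral>\<omega>. iter (Suc N) (\<xi> (-1) \<omega>) \<partial>M)"
    by (simp add: J_def nonneg_path_def del: iter.simps)
  also have "\<dots> = (\<integral>x. std_normal_density x * iter (Suc N) x \<partial>lborel)"
    by (rule distributed_integral[OF normal, symmetric]) (use iter_meas[of "Suc N"] in auto)
  also have "\<dots> = gint UNIV (iter (Suc N))" by (simp add: gint_def set_lebesgue_integral_def mult.commute del: iter.simps)
  finally show ?thesis .
qed

lemma persistence_exponent_eq: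
  fixes M :: "'a measure" and \<xi> :: "int \<Rightarrow> 'a \<Rightarrow> real"
  assumes prob: "prob_space M"
    and indep: "prob_space.indep_vars M (\<lambda>_. borel) \<xi> {-1..}"
    and normal: "\<And>i. i \<ge> -1 \<Longrightarrow> distributed M lborel (\<xi> i) std_normal_density"
  shows "has_persistence_exponent M (MA1 \<rho> \<xi>) (1 / pole)"
proof -
  note p = persistence_prob_eq[OF assms]
  have "\<exists>e. e \<in> o(\<lambda>N. real N) \<and> (\<forall>N. gint UNIV (iter (Suc N)) = (1 / pole) powr (real N + e N))"
  proof (rule exponential_rateI)
    show "0 < 1 / pole" "1 / pole < 1" using pole_gt_1 by auto
    show "0 < 1 / (eigen_sup * pole\<^sup>2)" using eigen_sup_pos pole_gt_1 by simp
    show "1 / (eigen_sup * pole\<^sup>2) * (1 / pole) ^ N \<le> gint UNIV (iter (Suc N))" for N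
      using iter_mean_lower[of "Suc N"] by (simp add: power_divide power2_eq_square mult_ac)
    fix w assume w: "0 < w" "w < 1 / (1 / pole)"
    then obtain K where K: "\<And>n. gint UNIV (iter n) * w ^ n \<le> K" using iter_mean_upper[of w] by auto
    have "gint UNIV (iter (Suc N)) * w ^ N \<le> K / w" for N
      using K[of "Suc N"] w by (simp add: pos_le_divide_eq mult_ac del: iter.simps)
    then show "\<exists>K. \<forall>N. gint UNIV (iter (Suc N)) * w ^ N \<le> K" by blast
  qed
  then obtain e where e: "e \<in> o(\<lambda>N. real N)" "\<And>N. gint UNIV (iter (Suc N)) = (1 / pole) powr (real N + e N)" by blast
  show ?thesis unfolding has_persistence_exponent_def
    by (intro conjI exI[of _ e] e(1) always_eventually allI) (use pole(1) in \<open>simp_all only: p e(2) zero_less_divide_1_iff\<close>)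
qed

lemma tfun_tau_lin: "tbound \<tau> C c \<Longrightarrow> tbound \<tau> D' d \<Longrightarrow> tfun (\<lambda>n. c n + z * d n) = (\<lambda>x. tfun c x + z * tfun d x)"
  using tfun_add[OF _ tbound_cmult[of \<tau> D' d z], of C c] tfun_cmult[of \<tau> D' d] tau_pos by (auto simp: fun_eq_iff)

lemma Hq_lin: "f \<in> Hq q \<Longrightarrow> g \<in> Hq q \<Longrightarrow> (\<lambda>x. f x + z * g x) \<in> Hq q"
  by (rule Hq_add(1)[OF _ Hq_cmult(1)[OF _ q] q])

lemma Hq_one: "(\<lambda>x. 1) \<in> Hq q"
  using tbound_in_Hq(1)[OF tbound_one[OF sig(1)]] by (simp add: tfun_one[abs_def])

lemma Hq_const: "(\<lambda>x. z) \<in> Hq q"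
  using Hq_cmult(1)[OF Hq_one q, of z] by simp

definition "taylor_const = 1 / (1 - sqrt (q / (1 - q / \<tau>)))"

lemma tcoeffs_tbound: "f \<in> Hq q \<Longrightarrow> tbound \<tau> (taylor_const * Hq_norm q f) (tcoeffs q f)"
  and tfun_tcoeffs: "f \<in> Hq q \<Longrightarrow> tfun (tcoeffs q f) = f"
  using Hq_taylor[OF _ q tau] by (simp_all add: taylor_const_def)

lemma T_op_tcoeffs: "f \<in> Hq q \<Longrightarrow> T_op \<rho> f x = half_mean f + tfun (A (tcoeffs q f)) x"
  using T_op_eq[OF tcoeffs_tbound, of f x] by (simp add: tfun_tcoeffs)

lemma T_op_Hq: assumes f: "f \<in> Hq q" shows "T_op \<rho> f \<in> Hq q"
proof -
  have "T_op \<rho> f = (\<lambda>x. half_mean f + 1 * tfun (A (tcoeffs q f)) x)" using T_op_tcoeffs[OF f] by auto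
  then show ?thesis using Hq_lin[OF Hq_const tbound_in_Hq(1)[OF A_tbound[OF tcoeffs_tbound[OF f]]], of "half_mean f" 1] by simp
qed

lemma T_op_lin:
  assumes f: "f \<in> Hq q" and g: "g \<in> Hq q"
  shows "T_op \<rho> (\<lambda>x. f x + z * g x) x = T_op \<rho> f x + z * T_op \<rho> g x"
proof -
  have si: "set_integrable lborel {- \<rho> * x..} (\<lambda>y. h y * complex_of_real (std_normal_density y))" if "h \<in> Hq q" for h
    unfolding set_integrable_def using Hq_integrable[OF that q] by (intro integrable_mult_indicator) auto
  have "T_op \<rho> (\<lambda>x. f x + z * g x) x = T_op \<rho> f x + T_op \<rho> (\<lambda>x. z * g x) x"
    unfolding T_op_def distrib_right by (intro set_integral_add si f Hq_cmult(1)[OF g q])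
  also have "T_op \<rho> (\<lambda>x. z * g x) x = z * T_op \<rho> g x"
    unfolding T_op_def set_lebesgue_integral_def
    by (subst integral_mult_right_zero[symmetric]) (simp add: mult_ac scaleR_conv_of_real)
  finally show ?thesis .
qed

text \<open>The solution \<open>f\<close> of \<open>T f - z f = g\<close> for \<open>w =
  1/z\<close>. Writing the equation as \<open>f - w A f = w (\<ell>(f) 1 - g)\<close> gives
  \<open>f = w (\<ell>(f) (1 - w A)\<^bsup>-1\<^esup> 1 - (1 - w A)\<^bsup>-1\<^esup> g)\<close>,
  and applying \<open>\<ell>\<close> determines \<open>\<ell>(f)\<close> when \<open>D(w) \<noteq>
  0\<close>.\<close>

definition resolv :: "complex \<Rightarrow> (real \<Rightarrow> complex) \<Rightarrow> real \<Rightarrow> complex" where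
  "resolv w g = (let r = tfun (neumann \<rho> w (tcoeffs q g)) in
     (\<lambda>x. w * (- w * half_mean r / eval_fps char_ser w * tfun (neumann \<rho> w one_co) x - r x)))"

lemma neumann_one_tbound: "tbound \<sigma> (1 * neumann_norm w) (neumann \<rho> w one_co)" by (intro neumann_tbound_sig tbound_one sig)

lemma neumann_one_Hq: "tfun (neumann \<rho> w one_co) \<in> Hq q" by (rule tbound_in_Hq(1)[OF neumann_one_tbound])

text \<open>The identity \<open>(1 - w A)\<^bsup>-1\<^esup> g = g + w A (1 - w
  A)\<^bsup>-1\<^esup> g\<close> brings the solution back to \<open>Hq\<close>, since
  \<open>A\<close> maps the larger sequence space into \<open>Hq\<close>.\<close>

lemma neumann_Hq:
  fixes w :: complex
  assumes g: "g \<in> Hq q"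
  defines "r \<equiv> neumann \<rho> w (tcoeffs q g)"
  shows "tbound \<tau> (taylor_const * Hq_norm q g * neumann_norm w) r" "tfun r \<in> Hq q"
    "Hq_norm q (tfun r) \<le> 2 * (1 + cmod w * (embed_const * (taylor_const * neumann_norm w))) * Hq_norm q g"
proof -
  show r: "tbound \<tau> (taylor_const * Hq_norm q g * neumann_norm w) r" unfolding r_def by (intro neumann_tbound_tau tcoeffs_tbound g)
  have "tfun r = tfun (\<lambda>n. tcoeffs q g n + w * A r n)"
    unfolding r_def by (rule arg_cong[of _ _ tfun]) (rule ext, rule neumann_fixpoint)
  also have "\<dots> = (\<lambda>x. g x + w * tfun (A r) x)"
    using tfun_tau_lin[OF tcoeffs_tbound[OF g] tbound_sig_tau[OF A_tbound[OF r]]] by (simp add: tfun_tcoeffs g)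
  finally have e: "tfun r = (\<lambda>x. g x + w * tfun (A r) x)" .
  note Ar = tbound_in_Hq[OF A_tbound[OF r]]
  show "tfun r \<in> Hq q" unfolding e by (rule Hq_lin[OF g Ar(1)])
  have "Hq_norm q (tfun r) \<le> 2 * (Hq_norm q g + cmod w * Hq_norm q (tfun (A r)))"
    unfolding e using Hq_add(2)[OF g Hq_cmult(1)[OF Ar(1) q, of w] q] Hq_cmult(2)[OF Ar(1) q] by simp
  also have "\<dots> \<le> 2 * (Hq_norm q g + cmod w * (embed_const * (taylor_const * Hq_norm q g * neumann_norm w)))"
    by (intro mult_left_mono add_left_mono Ar(2)) auto
  finally show "Hq_norm q (tfun r) \<le> 2 * (1 + cmod w * (embed_const * (taylor_const * neumann_norm w))) * Hq_norm q g"
    by (simp add: algebra_simps)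
qed

lemma resolv_Hq:
  assumes g: "g \<in> Hq q" shows "resolv w g \<in> Hq q"
proof -
  let ?r = "tfun (neumann \<rho> w (tcoeffs q g))"
  have "resolv w g = (\<lambda>x. w * ((- w * half_mean ?r / eval_fps char_ser w * tfun (neumann \<rho> w one_co) x) + (- 1) * ?r x))"
    by (simp add: resolv_def Let_def fun_eq_iff)
  then show ?thesis
    using Hq_cmult(1)[OF Hq_lin[OF Hq_cmult(1)[OF neumann_one_Hq q] neumann_Hq(2)[OF g]] q] by (simp only:)
qed

lemma resolv_bound: "\<exists>C. \<forall>g\<in>Hq q. Hq_norm q (resolv w g) \<le> C * Hq_norm q g"
proof (intro exI ballI)
  fix g assume g: "g \<in> Hq q"
  let ?r = "tfun (neumann \<rho> w (tcoeffs q g))" and ?N = "Hq_norm q g" and ?N1 = "Hq_norm q (tfun (neumann \<rho> w one_co))"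
  let ?\<mu> = "- w * half_mean ?r / eval_fps char_ser w"
  let ?K = "2 * (1 + cmod w * (embed_const * (taylor_const * neumann_norm w)))"
  have rN: "Hq_norm q ?r \<le> ?K * ?N" by (rule neumann_Hq(3)[OF g])
  have sq: "0 \<le> 1 / (1 - sqrt q)" using q by simp
  have "cmod (half_mean ?r) \<le> 1 / (1 - sqrt q) * Hq_norm q ?r" by (rule half_mean_bound[OF neumann_Hq(2)[OF g] q])
  also have "\<dots> \<le> 1 / (1 - sqrt q) * (?K * ?N)" by (intro mult_left_mono rN sq)
  finally have l: "cmod (half_mean ?r) \<le> 1 / (1 - sqrt q) * (?K * ?N)" .
  have "cmod ?\<mu> = cmod w / cmod (eval_fps char_ser w) * cmod (half_mean ?r)" by (simp add: norm_mult norm_divide)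
  also have "\<dots> \<le> cmod w / cmod (eval_fps char_ser w) * (1 / (1 - sqrt q) * (?K * ?N))" by (intro mult_left_mono l) auto
  finally have m: "cmod ?\<mu> \<le> cmod w / cmod (eval_fps char_ser w) * (1 / (1 - sqrt q) * (?K * ?N))" .
  have n1: "0 \<le> ?N1" by (rule Hq_norm_nonneg[OF neumann_one_Hq q])
  have e: "resolv w g = (\<lambda>x. w * ((?\<mu> * tfun (neumann \<rho> w one_co) x) + (- 1) * ?r x))"
    by (simp add: resolv_def Let_def fun_eq_iff)
  have "Hq_norm q (resolv w g) = cmod w * Hq_norm q (\<lambda>x. (?\<mu> * tfun (neumann \<rho> w one_co) x) + (- 1) * ?r x)"
    unfolding e by (rule Hq_cmult(2)[OF Hq_lin[OF Hq_cmult(1)[OF neumann_one_Hq q] neumann_Hq(2)[OF g]] q])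
  also have "\<dots> \<le> cmod w * (2 * (Hq_norm q (\<lambda>x. ?\<mu> * tfun (neumann \<rho> w one_co) x) + Hq_norm q (\<lambda>x. (- 1) * ?r x)))"
    by (intro mult_left_mono Hq_add(2)[OF Hq_cmult(1)[OF neumann_one_Hq q] Hq_cmult(1)[OF neumann_Hq(2)[OF g] q] q]) auto
  also have "\<dots> = cmod w * (2 * (cmod ?\<mu> * ?N1 + Hq_norm q ?r))"
    unfolding Hq_cmult(2)[OF neumann_one_Hq q] Hq_cmult(2)[OF neumann_Hq(2)[OF g] q] by simp
  also have "\<dots> \<le> cmod w * (2 * (cmod w / cmod (eval_fps char_ser w) * (1 / (1 - sqrt q) * (?K * ?N)) * ?N1 + ?K * ?N))"
    by (intro mult_left_mono add_mono mult_right_mono m rN n1) auto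
  also have "\<dots> = cmod w * (2 * (cmod w / cmod (eval_fps char_ser w) * (1 / (1 - sqrt q) * ?K) * ?N1 + ?K)) * ?N"
    by (simp add: algebra_simps)
  finally show "Hq_norm q (resolv w g) \<le> cmod w * (2 * (cmod w / cmod (eval_fps char_ser w) * (1 / (1 - sqrt q) * ?K) * ?N1 + ?K)) * Hq_norm q g" .
qed

lemma resolv_left:
  assumes f: "f \<in> Hq q" and w: "w \<noteq> 0" "eval_fps char_ser w \<noteq> 0"
  shows "resolv w (\<lambda>x. T_op \<rho> f x - inverse w * f x) = f"
proof -
  define c where "c = tcoeffs q f"
  define r1 where "r1 = neumann \<rho> w one_co"
  define d where "d = (\<lambda>n. (A c n + half_mean f * one_co n) + (- inverse w) * c n)"
  have c: "tbound \<tau> (taylor_const * Hq_norm q f) c" unfolding c_def by (rule tcoeffs_tbound[OF f])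
  have ec: "tfun c = f" unfolding c_def by (rule tfun_tcoeffs[OF f])
  have r1: "tbound \<tau> (1 * neumann_norm w) r1" unfolding r1_def by (rule tbound_sig_tau[OF neumann_one_tbound])
  have one: "tbound \<tau> 1 one_co" using tau_pos by (intro tbound_one) simp
  note d' = tbound_lin[OF tbound_sig_tau[OF A_tbound[OF c]] one, of "half_mean f"]
  have dt: "tbound \<tau> (taylor_const * Hq_norm q f + cmod (half_mean f) * 1 + cmod (- inverse w) * (taylor_const * Hq_norm q f)) d"
    unfolding d_def by (rule tbound_lin[OF d' c])
  have ed: "tfun d = (\<lambda>x. T_op \<rho> f x - inverse w * f x)"
    unfolding d_def tfun_tau_lin[OF d' c] tfun_tau_lin[OF tbound_sig_tau[OF A_tbound[OF c]] one]
    using T_op_tcoeffs[OF f] by (auto simp: fun_eq_iff tfun_one ec c_def[symmetric])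
  have gH: "tfun d \<in> Hq q"
    unfolding ed using Hq_lin[OF T_op_Hq[OF f] f, of "- inverse w"] by simp
  have td: "tcoeffs q (tfun d) = d" using tau_pos by (intro tcoeffs_eq[OF dt _ gH q]) simp
  (* The right hand side solves the triangular equation that characterises the left hand side.
     *)
  have Rd: "neumann \<rho> w d = (\<lambda>n. half_mean f * r1 n + (- inverse w) * c n)"
  proof
    fix n
    have Aeq: "A (\<lambda>n. half_mean f * r1 n + (- inverse w) * c n) = (\<lambda>n. half_mean f * A r1 n + (- inverse w) * A c n)"
      unfolding volterra_add[of _ "\<lambda>n. half_mean f * r1 n" "\<lambda>n. (- inverse w) * c n"] volterra_cmult ..
    show "neumann \<rho> w d n = half_mean f * r1 n + (- inverse w) * c n"
    proof (rule volterra_fixpoint_unique[where g = d and w = w and \<rho> = "of_real \<rho>"])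
      show "neumann \<rho> w d n = d n + w * A (neumann \<rho> w d) n" for n by (rule neumann_fixpoint)
      fix n
      have "r1 n = one_co n + w * A r1 n" unfolding r1_def by (rule neumann_fixpoint)
      then show "half_mean f * r1 n + (- inverse w) * c n = d n + w * A (\<lambda>n. half_mean f * r1 n + (- inverse w) * c n) n"
        unfolding Aeq d_def using w by (simp add: algebra_simps)
    qed
  qed
  have r1t: "tbound \<tau> (cmod (half_mean f) * (1 * neumann_norm w)) (\<lambda>n. half_mean f * r1 n)" by (rule tbound_cmult[OF r1])
  have eRd: "tfun (neumann \<rho> w d) = (\<lambda>x. half_mean f * tfun r1 x + (- inverse w) * f x)"
    unfolding Rd tfun_tau_lin[OF r1t c] using tfun_cmult[OF r1, of "half_mean f"] tau_pos by (simp add: ec)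
  have r1H: "tfun r1 \<in> Hq q" unfolding r1_def by (rule neumann_one_Hq)
  have lRd: "half_mean (tfun (neumann \<rho> w d)) = half_mean f * half_mean (tfun r1) - inverse w * half_mean f"
    unfolding eRd half_mean_lin[OF Hq_cmult(1)[OF r1H q] f] half_mean_cmult by simp
  have "- w * half_mean (tfun (neumann \<rho> w d)) = half_mean f * eval_fps char_ser w"
    unfolding lRd char_ser_eval r1_def[symmetric] using w by (simp add: algebra_simps)
  then have half_moment: "- w * half_mean (tfun (neumann \<rho> w d)) / eval_fps char_ser w = half_mean f" using w by simp
  show ?thesis
    unfolding ed[symmetric] resolv_def td Let_def half_moment unfolding eRd r1_def[symmetric]
    using w by (auto simp: fun_eq_iff algebra_simps)
qed

lemma resolv_right:
  assumes g: "g \<in> Hq q" and w: "w \<noteq> 0" "eval_fps char_ser w \<noteq> 0"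
  shows "T_op \<rho> (resolv w g) x - inverse w * resolv w g x = g x"
proof -
  define c where "c = tcoeffs q g"
  define r where "r = neumann \<rho> w c"
  define r1 where "r1 = neumann \<rho> w one_co"
  define \<mu> where "\<mu> = - w * half_mean (tfun r) / eval_fps char_ser w"
  have r: "tbound \<tau> (taylor_const * Hq_norm q g * neumann_norm w) r" and rH: "tfun r \<in> Hq q"
    unfolding r_def c_def by (rule neumann_Hq[OF g])+
  have r1: "tbound \<tau> (1 * neumann_norm w) r1" unfolding r1_def by (rule tbound_sig_tau[OF neumann_one_tbound])
  have r1H: "tfun r1 \<in> Hq q" unfolding r1_def by (rule neumann_one_Hq)
  have c: "tbound \<tau> (taylor_const * Hq_norm q g) c" "tfun c = g" unfolding c_def by (rule tcoeffs_tbound[OF g], rule tfun_tcoeffs[OF g])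
  have one: "tbound \<tau> 1 one_co" using tau_pos by (intro tbound_one) simp
  define fc where "fc = (\<lambda>n. (w * \<mu>) * r1 n + (- w) * r n)"
  have fc: "\<exists>C. tbound \<tau> C fc" unfolding fc_def using tbound_lin[OF tbound_cmult[OF r1] r] by blast
  then obtain C where C: "tbound \<tau> C fc" ..
  have efc: "tfun fc = resolv w g"
  proof
    fix x
    have "tfun (\<lambda>n. (w * \<mu>) * r1 n) x = (w * \<mu>) * tfun r1 x" by (rule tfun_cmult[OF r1]) (use tau_pos in simp)
    then have "tfun fc x = (w * \<mu>) * tfun r1 x + (- w) * tfun r x"
      unfolding fc_def tfun_tau_lin[OF tbound_cmult[OF r1] r] by (simp only:)
    also have "\<dots> = resolv w g x"
      unfolding resolv_def Let_def c_def[symmetric] r_def[symmetric] r1_def[symmetric] \<mu>_def[symmetric]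
      by (simp add: algebra_simps)
    finally show "tfun fc x = resolv w g x" .
  qed
  have "A fc = (\<lambda>n. (fc n + (- (w * \<mu>)) * one_co n + w * c n) * inverse w)"
  proof
    fix n
    have 1: "A fc n = (w * \<mu>) * A r1 n + (- w) * A r n"
      unfolding fc_def volterra_add[of _ "\<lambda>n. (w * \<mu>) * r1 n" "\<lambda>n. (- w) * r n"] volterra_cmult ..
    have 2: "r1 n = one_co n + w * A r1 n" unfolding r1_def by (rule neumann_fixpoint)
    have 3: "r n = c n + w * A r n" unfolding r_def by (rule neumann_fixpoint)
    show "A fc n = (fc n + (- (w * \<mu>)) * one_co n + w * c n) * inverse w"
    proof -
      have "fc n = (w * \<mu>) * (one_co n + w * A r1 n) + (- w) * (c n + w * A r n)"
        by (simp only: fc_def 2[symmetric] 3[symmetric])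
      then have "fc n + (- (w * \<mu>)) * one_co n + w * c n = w * ((w * \<mu>) * A r1 n + (- w) * A r n)"
        by (simp add: algebra_simps)
      then show ?thesis using w by (simp add: 1)
    qed
  qed
  then have Afc: "A fc = (\<lambda>n. inverse w * ((fc n + (- (w * \<mu>)) * one_co n) + w * c n))"
    by (simp add: mult.commute)
  have "tfun (A fc) x = inverse w * (tfun fc x - w * \<mu> + w * g x)"
  proof -
    have "tfun (A fc) x = inverse w * tfun (\<lambda>n. (fc n + (- (w * \<mu>)) * one_co n) + w * c n) x"
      unfolding Afc by (rule tfun_cmult[OF tbound_lin[OF tbound_lin[OF C one] c(1)]]) (use tau_pos in simp)
    also have "tfun (\<lambda>n. (fc n + (- (w * \<mu>)) * one_co n) + w * c n) x = tfun fc x + (- (w * \<mu>)) * 1 + w * g x"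
      unfolding tfun_tau_lin[OF tbound_lin[OF C one] c(1)] tfun_tau_lin[OF C one] tfun_one c(2) ..
    finally show ?thesis by simp
  qed
  then have Ax: "tfun (A fc) x = inverse w * resolv w g x - \<mu> + g x" using w by (simp add: efc algebra_simps)
  have Sg: "resolv w g = (\<lambda>x. (w * \<mu>) * tfun r1 x + (- w) * tfun r x)"
    unfolding resolv_def Let_def c_def[symmetric] r_def[symmetric] r1_def[symmetric] \<mu>_def[symmetric]
    by (simp add: algebra_simps)
  have "half_mean (resolv w g) = (w * \<mu>) * half_mean (tfun r1) + (- w) * half_mean (tfun r)"
    unfolding Sg half_mean_lin[OF Hq_cmult(1)[OF r1H q] rH] half_mean_cmult ..
  also have "- w * half_mean (tfun r) = \<mu> * eval_fps char_ser w" using w by (simp add: \<mu>_def)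
  also have "(w * \<mu>) * half_mean (tfun r1) + \<mu> * eval_fps char_ser w = \<mu>"
    unfolding char_ser_eval r1_def[symmetric] by (simp add: algebra_simps)
  finally have l: "half_mean (resolv w g) = \<mu>" .
  have "T_op \<rho> (resolv w g) x = half_mean (resolv w g) + tfun (A fc) x"
    using T_op_eq[OF C, of x] resolv_Hq[OF g, of w] by (simp add: efc)
  then show ?thesis unfolding l Ax by simp
qed

text \<open>Linearity of the resolvent is a consequence of its being a two-sided inverse of a
  linear operator.\<close>

lemma outside_spectrum:
  assumes z: "1 / pole < cmod z" shows "z \<notin> Hq_spectrum q (T_op \<rho>)"
proof -
  define w where "w = inverse z"
  have z0: "z \<noteq> 0" using z pole(1) by (metis divide_pos_pos less_asym norm_zero zero_less_one)
  have w: "w \<noteq> 0" "inverse w = z" using z0 by (simp_all add: w_def)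
  have "cmod w = inverse (cmod z)" by (simp only: w_def norm_inverse)
  also have "\<dots> < inverse (1 / pole)" using z pole(1) by (intro less_imp_inverse_less) auto
  finally have "cmod w < pole" by simp
  then have D: "eval_fps char_ser w \<noteq> 0" by (rule char_ser_nonzero)
  have left: "resolv w (\<lambda>x. T_op \<rho> f x - z * f x) = f" if "f \<in> Hq q" for f
    using resolv_left[OF that w(1) D] by (simp add: w(2))
  have right: "(\<lambda>x. T_op \<rho> (resolv w g) x - z * resolv w g x) = g" if "g \<in> Hq q" for g
    using resolv_right[OF that w(1) D] by (auto simp: w(2))
  have lin: "resolv w (\<lambda>x. f x + c * g x) = (\<lambda>x. resolv w f x + c * resolv w g x)" if f: "f \<in> Hq q" and g: "g \<in> Hq q" for f g c
  proof -
    let ?h = "\<lambda>x. resolv w f x + c * resolv w g x"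
    have h: "?h \<in> Hq q" by (rule Hq_lin[OF resolv_Hq[OF f] resolv_Hq[OF g]])
    have "(\<lambda>x. T_op \<rho> ?h x - z * ?h x) = (\<lambda>x. f x + c * g x)"
    proof
      fix x
      have "T_op \<rho> ?h x - z * ?h x = (T_op \<rho> (resolv w f) x - z * resolv w f x) + c * (T_op \<rho> (resolv w g) x - z * resolv w g x)"
        by (simp add: T_op_lin[OF resolv_Hq[OF f] resolv_Hq[OF g]] algebra_simps)
      then show "T_op \<rho> ?h x - z * ?h x = f x + c * g x"
        using fun_cong[OF right[OF f], of x] fun_cong[OF right[OF g], of x] by simp
    qed
    then show ?thesis using left[OF h] by simp
  qed
  have "Hq_bounded_operator q (resolv w)"
    unfolding Hq_bounded_operator_def
  proof (intro conjI ballI allI)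
    show "resolv w f \<in> Hq q" if "f \<in> Hq q" for f by (rule resolv_Hq[OF that])
    show "resolv w (\<lambda>x. f x + g x) = (\<lambda>x. resolv w f x + resolv w g x)" if "f \<in> Hq q" "g \<in> Hq q" for f g
      using lin[OF that, of 1] by simp
    have zH: "(\<lambda>x. 0) \<in> Hq q" by (rule Hq_const)
    have "resolv w (\<lambda>x. 0) = (\<lambda>x. resolv w (\<lambda>x. 0) x + 1 * resolv w (\<lambda>x. 0) x)"
      using lin[OF zH zH, of 1] by simp
    then have z1: "resolv w (\<lambda>x. 0) = (\<lambda>x. 0)" by (auto simp: fun_eq_iff)
    show "resolv w (\<lambda>x. c * f x) = (\<lambda>x. c * resolv w f x)" if "f \<in> Hq q" for c f
      using lin[OF zH that, of c] by (simp add: z1)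
  qed (rule resolv_bound)
  then show ?thesis unfolding Hq_spectrum_def using left right by blast
qed

lemma eigenvalue_in_spectrum:
  assumes "Hq_eigenvalue q (T_op \<rho>) z" shows "z \<in> Hq_spectrum q (T_op \<rho>)"
proof -
  obtain f where f: "f \<in> Hq q" "f \<noteq> (\<lambda>x. 0)" "T_op \<rho> f = (\<lambda>x. z * f x)"
    using assms unfolding Hq_eigenvalue_def Hq_eigenfunction_def by blast
  show ?thesis unfolding Hq_spectrum_def
  proof (intro CollectI notI)
    assume "\<exists>S. Hq_bounded_operator q S \<and> (\<forall>f\<in>Hq q. S (\<lambda>x. T_op \<rho> f x - z * f x) = f) \<and>
      (\<forall>f\<in>Hq q. (\<lambda>x. T_op \<rho> (S f) x - z * S f x) = f)"
    then obtain S where S: "Hq_bounded_operator q S" "S (\<lambda>x. T_op \<rho> f x - z * f x) = f" using f(1) by blast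
    have "S (\<lambda>x. 0 * f x) = (\<lambda>x. 0 * S f x)" using S(1) f(1) unfolding Hq_bounded_operator_def by blast
    then show False using S(2) f by simp
  qed
qed

lemma eigenfun_is_eigenfunction: "Hq_eigenfunction q (T_op \<rho>) (complex_of_real (1 / pole)) eigenfun"
  unfolding Hq_eigenfunction_def
proof (intro conjI)
  show "eigenfun \<noteq> (\<lambda>x. 0)" using eigenfun_at_0 by (metis zero_neq_one)
  show "T_op \<rho> eigenfun = (\<lambda>x. complex_of_real (1 / pole) * eigenfun x)" using T_eigenfun by auto
qed (rule eigenfun_Hq)

lemma spectral_radius_eq: "Hq_spectral_radius q (T_op \<rho>) = 1 / pole"
  unfolding Hq_spectral_radius_def
proof (rule cSup_eq_maximum)
  have "complex_of_real (1 / pole) \<in> Hq_spectrum q (T_op \<rho>)"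
    using eigenfun_is_eigenfunction by (intro eigenvalue_in_spectrum) (auto simp: Hq_eigenvalue_def)
  then have "cmod (complex_of_real (1 / pole)) \<in> cmod ` Hq_spectrum q (T_op \<rho>)" by (rule imageI)
  then show "1 / pole \<in> cmod ` Hq_spectrum q (T_op \<rho>)" using pole(1) by (simp add: norm_divide)
  fix y assume "y \<in> cmod ` Hq_spectrum q (T_op \<rho>)"
  then show "y \<le> 1 / pole" using outside_spectrum by force
qed

lemma eigenvalue_le_inverse_pole: "Hq_eigenvalue q (T_op \<rho>) z \<Longrightarrow> cmod z \<le> 1 / pole"
  using eigenvalue_in_spectrum outside_spectrum by force

end

text \<open>The bound on \<open>\<rho>\<close> says \<open>\<rho>\<^sup>2/(1-q) < q/(1+q)\<close>,
  which leaves room for a value of \<open>1 + \<tau>\<close> slightly above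
  \<open>1/(1-q)\<close>.\<close>

lemma ma1_exists:
  fixes \<rho> q :: real
  assumes q: "0 < q" "q < 1"
    and rho: "- sqrt ((1 - q) / (1 + inverse q)) < \<rho>" "\<rho> < sqrt ((1 - q) / (1 + inverse q))"
  obtains \<tau> where "ma1 \<rho> q \<tau>"
proof -
  have "\<bar>\<rho>\<bar> < sqrt ((1 - q) / (1 + inverse q))" using rho by linarith
  then have "\<bar>\<rho>\<bar>\<^sup>2 < (sqrt ((1 - q) / (1 + inverse q)))\<^sup>2" by (intro power_strict_mono) auto
  also have "\<dots> = (1 - q) / (1 + inverse q)" using q by simp
  also have "\<dots> = q / (1 + q) * (1 - q)" using q by (simp add: field_simps)
  finally have r: "\<rho>\<^sup>2 < q / (1 + q) * (1 - q)" by simp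
  show ?thesis
  proof (cases "\<rho> = 0")
    case True
    show ?thesis by (rule that[of "q / (1 - q) + 1"], unfold_locales) (use q True in auto)
  next
    case False
    then have p: "0 < \<rho>\<^sup>2" by simp
    have "q / (1 - q) < q / (1 + q) / \<rho>\<^sup>2 - 1"
    proof -
      have "1 / (1 - q) < q / (1 + q) / \<rho>\<^sup>2"
      proof -
        have "\<rho>\<^sup>2 / (1 - q) < q / (1 + q)" using r q by (simp add: pos_divide_less_eq)
        then have "\<rho>\<^sup>2 / (1 - q) / \<rho>\<^sup>2 < q / (1 + q) / \<rho>\<^sup>2" using p by (rule divide_strict_right_mono)
        then show ?thesis using p by simp
      qed
      moreover have "q / (1 - q) + 1 = 1 / (1 - q)" using q by (simp add: field_simps)
      ultimately show ?thesis by linarith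
    qed
    then obtain \<tau> where t: "q / (1 - q) < \<tau>" "\<tau> < q / (1 + q) / \<rho>\<^sup>2 - 1" using dense by blast
    then have "(1 + \<tau>) < q / (1 + q) / \<rho>\<^sup>2" by linarith
    then have "\<rho>\<^sup>2 * (1 + \<tau>) < q / (1 + q)" using p by (subst (asm) pos_less_divide_eq) (auto simp: mult.commute)
    then show ?thesis using t q by (intro that[of \<tau>]) (unfold_locales, auto)
  qed
qed

section \<open>Moments of the half-normal law\<close>

definition half_moment :: "nat \<Rightarrow> real" where "half_moment n = gint {0..} (\<lambda>x. x ^ n)"

lemma half_moment_abs: "half_moment n = gint UNIV (\<lambda>x. \<bar>x\<bar> ^ n) / 2"
proof -
  have "half_moment n = gint {0..} (\<lambda>x. \<bar>x\<bar> ^ n)"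
    unfolding half_moment_def gint_def set_lebesgue_integral_def
    by (intro Bochner_Integration.integral_cong refl) (auto simp: indicator_def)
  also have "\<dots> = gint UNIV (\<lambda>x. \<bar>x\<bar> ^ n) / 2"
    using integrable_std_normal_moment_abs[of n] by (intro gint_half_even) (auto simp: mult.commute)
  finally show ?thesis .
qed

lemma half_moment_even: "half_moment (2 * k) = fact (2 * k) / (2 ^ k * fact k) / 2"
  unfolding half_moment_abs using integral_std_normal_moment_even[of k]
  by (simp add: gint_def set_lebesgue_integral_def mult.commute power_even_abs)

lemma half_moment_odd: "half_moment (2 * k + 1) = sqrt (2 / pi) * 2 ^ k * fact k / 2"
  unfolding half_moment_abs using integral_std_normal_moment_abs_odd[of k]
  by (simp add: gint_def set_lebesgue_integral_def mult.commute)

lemma half_moment_0: "half_moment 0 = 1/2" using half_moment_even[of 0] by simp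

lemma half_sqrt_2_pi: "sqrt (2 / pi) / 2 = 1 / sqrt (2 * pi)"
proof -
  have "sqrt (2 / pi) * sqrt (2 * pi) = 2" by (simp flip: real_sqrt_mult)
  then show ?thesis by (simp add: field_simps)
qed

lemma half_moment_1: "half_moment 1 = 1 / sqrt (2 * pi)"
  using half_moment_odd[of 0] half_sqrt_2_pi by simp

lemma half_moment_rec: "half_moment (n + 2) = real (n + 1) * half_moment n"
proof (cases "even n")
  case True
  then obtain k where k: "n = 2 * k" by blast
  have "n + 2 = 2 * Suc k" using k by simp
  then show ?thesis unfolding k half_moment_even by (simp only: half_moment_even) (simp add: divide_simps)
next
  case False
  then obtain k where k: "n = 2 * k + 1" by (metis oddE)
  have "n + 2 = 2 * Suc k + 1" using k by simp
  then show ?thesis unfolding k half_moment_odd by (simp only: half_moment_odd) (simp add: algebra_simps)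
qed

lemma nat_two_step_induct [case_names 0 1 step]:
  assumes "P 0" "P 1" "\<And>n. P n \<Longrightarrow> P (n + 2)" shows "P (n::nat)"
proof -
  have "P n \<and> P (Suc n)" by (induction n) (use assms in \<open>auto simp: numeral_2_eq_2\<close>)
  then show ?thesis ..
qed

lemma half_moment_nonneg: "0 \<le> half_moment n"
  by (induction n rule: nat_two_step_induct) (simp_all add: half_moment_0 half_moment_1[simplified] half_moment_rec[simplified])

lemma inv_sqrt_2pi: "1 / sqrt (2 * pi) \<le> 0.3991"
proof -
  have "(1 / 0.3991)\<^sup>2 \<le> 2 * pi" using pi_approx(1) by (simp add: power2_eq_square)
  then have "1 / 0.3991 \<le> sqrt (2 * pi)" by (intro real_le_rsqrt)
  then have "1 / sqrt (2 * pi) \<le> 1 / (1 / 0.3991)" by (intro divide_left_mono) auto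
  then show ?thesis by simp
qed

lemma half_moment_le_sqrt_fact: "half_moment n \<le> sqrt (fact n)"
proof (induction n rule: nat_two_step_induct)
  case 1
  show ?case using inv_sqrt_2pi half_moment_1 pi_gt3 by simp
next
  case (step n)
  have "half_moment (n + 2) \<le> real (n + 1) * sqrt (fact n)" unfolding half_moment_rec by (intro mult_left_mono step) auto
  also have "\<dots> = sqrt ((real (n + 1))\<^sup>2 * fact n)" by (simp add: real_sqrt_mult)
  also have "\<dots> \<le> sqrt (fact (n + 2))"
    unfolding real_sqrt_le_iff by (simp add: power2_eq_square mult_right_mono algebra_simps)
  finally show ?case .
qed (simp add: half_moment_0)

lemma half_moment_pochhammer: "half_moment (k + 2 * i) = half_moment k * 2 ^ i * pochhammer (real (k + 1) / 2) i"
proof (induction i)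
  case (Suc i)
  have "half_moment (k + 2 * Suc i) = real (k + 2 * i + 1) * half_moment (k + 2 * i)" using half_moment_rec[of "k + 2 * i"] by simp
  also have "\<dots> = half_moment k * 2 ^ Suc i * pochhammer (real (k + 1) / 2) (Suc i)"
    unfolding Suc pochhammer_Suc by (simp add: field_simps)
  finally show ?case .
qed simp

text \<open>The recursion divides the quotient by \<open>k + 5\<close> in each double step, so the
  two initial values decide.\<close>

lemma half_moment_fact_le: "half_moment (k + 3) / fact (k + 3) \<le> 2/15"
proof (induction k rule: nat_two_step_induct)
  case 0
  have "half_moment 3 = 2 * half_moment 1" using half_moment_rec[of 1] by (simp add: numeral_3_eq_3)
  then show ?case using inv_sqrt_2pi half_moment_1 by (simp add: fact_numeral)
next
  case 1
  have "half_moment 4 = 3 * (1 * half_moment 0)" using half_moment_rec[of 2] half_moment_rec[of 0] by (simp add: numeral_2_eq_2 eval_nat_numeral)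
  then show ?case by (simp add: half_moment_0 fact_numeral)
next
  case (step k)
  have "half_moment (k + 2 + 3) / fact (k + 2 + 3) = (half_moment (k + 3) / fact (k + 3)) / real (k + 5)"
  proof -
    have "half_moment (k + 2 + 3) = real (k + 4) * half_moment (k + 3)" using half_moment_rec[of "k + 3"] by (simp add: add.commute add.left_commute)
    moreover have "(fact (k + 2 + 3) :: real) = real (k + 5) * (real (k + 4) * fact (k + 3))"
    proof -
      have "k + 2 + 3 = Suc (Suc (k + 3))" by simp
      then show ?thesis by (simp only: fact_Suc of_nat_mult) (simp add: algebra_simps)
    qed
    ultimately have "half_moment (k + 2 + 3) / fact (k + 2 + 3) = (real (k + 4) * half_moment (k + 3)) / (real (k + 4) * (fact (k + 3) * real (k + 5)))"
      by (simp only: mult_ac)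
    then show ?thesis by (subst (asm) nonzero_mult_divide_mult_cancel_left) simp_all
  qed
  also have "\<dots> \<le> (half_moment (k + 3) / fact (k + 3)) / 1"
    using half_moment_nonneg[of "k + 3"] by (intro divide_left_mono) auto
  also have "\<dots> \<le> 2/15" using step by simp
  finally show ?case .
qed

section \<open>The coefficients of the characteristic equation\<close>

text \<open>The Taylor coefficients of \<open>x\<^sup>k exp (\<beta> x\<^sup>2 /
  2)\<close>.\<close>

definition majorant :: "nat \<Rightarrow> real \<Rightarrow> nat \<Rightarrow> real" where
  "majorant k \<beta> n = (if n < k then 0 else gauss_ser (\<beta> / 2) $ (n - k))"

lemma gauss_ser_nonneg: "0 \<le> a \<Longrightarrow> 0 \<le> gauss_ser (a::real) $ n" by (simp add: gauss_ser_def)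

lemma gauss_ser_mono: "0 \<le> a \<Longrightarrow> a \<le> a' \<Longrightarrow> gauss_ser (a::real) $ n \<le> gauss_ser a' $ n"
  by (simp add: gauss_ser_def divide_right_mono power_mono)

lemma gauss_ser_scale: "r ^ n * gauss_ser (a::real) $ n = gauss_ser (r\<^sup>2 * a) $ n"
  by (auto simp: gauss_ser_def power_mult_distrib simp flip: power_mult elim!: evenE)

lemma abs_gauss_ser_neg_half: "\<bar>gauss_ser (-1/2 :: real) $ n\<bar> = gauss_ser (1/2) $ n"
  by (simp add: gauss_ser_def power_abs)

lemma majorant_convolution: "(\<Sum>i\<le>m. majorant k \<beta> i * gauss_ser (1/2) $ (m - i)) = majorant k (\<beta> + 1) m"
proof -
  have e: "majorant k \<beta> i = (fps_X ^ k * gauss_ser (\<beta> / 2)) $ i" for k \<beta> i by (simp add: majorant_def fps_X_power_mult_nth)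
  have "(\<Sum>i\<le>m. majorant k \<beta> i * gauss_ser (1/2) $ (m - i)) = (fps_X ^ k * gauss_ser (\<beta> / 2) * gauss_ser (1/2)) $ m"
    unfolding e atMost_atLeast0 fps_mult_nth[of "fps_X ^ k * gauss_ser (\<beta> / 2)"] ..
  also have "\<dots> = majorant k (\<beta> + 1) m" unfolding e mult.assoc gauss_ser_mult by (simp add: add_divide_distrib)
  finally show ?thesis .
qed

text \<open>With absolute values inside, the Volterra operator becomes \<open>f \<mapsto>
  (2\<pi>)\<^bsup>-1/2\<^esup> \<integral>\<^bsub>0\<^esub>\<^bsup>r x\<^esup> f(y) exp
  (y\<^sup>2/2) dy\<close>. It maps \<open>x\<^sup>k exp (\<beta> x\<^sup>2/2)\<close> to a
  multiple of a function of the same form with \<open>k + 1\<close> and \<open>r\<^sup>2 (1 +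
  \<beta>)\<close>; hence the condition that makes \<open>\<beta>\<close> stable.\<close>

lemma volterra_majorant:
  assumes c: "\<And>n. cmod (c n) \<le> K * majorant k \<beta> n" and K: "0 \<le> K" and rho: "cmod \<rho> \<le> r"
    and b: "0 \<le> \<beta>" "r\<^sup>2 * (1 + \<beta>) \<le> \<beta>"
  shows "cmod (volterra \<rho> c n) \<le> K * (r ^ Suc k / (real (Suc k) * sqrt (2 * pi))) * majorant (Suc k) \<beta> n"
proof (cases n)
  case (Suc m)
  have r0: "0 \<le> r" using rho norm_ge_zero order_trans by blast
  have "cmod (\<Sum>i\<le>m. c i * of_real (gauss_ser (-1/2) $ (m - i))) \<le> (\<Sum>i\<le>m. K * majorant k \<beta> i * gauss_ser (1/2) $ (m - i))"
  proof (rule sum_norm_le)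
    fix i
    show "cmod (c i * of_real (gauss_ser (-1/2) $ (m - i))) \<le> K * majorant k \<beta> i * gauss_ser (1/2) $ (m - i)"
      unfolding norm_mult norm_of_real abs_gauss_ser_neg_half by (intro mult_right_mono c gauss_ser_nonneg) auto
  qed
  also have "\<dots> = K * majorant k (\<beta> + 1) m"
    unfolding mult.assoc sum_distrib_left[symmetric] majorant_convolution ..
  finally have S: "cmod (\<Sum>i\<le>m. c i * of_real (gauss_ser (-1/2) $ (m - i))) \<le> K * majorant k (\<beta> + 1) m" .
  have "cmod (volterra \<rho> c n) = cmod \<rho> ^ Suc m / real (Suc m) * cmod (\<Sum>i\<le>m. c i * of_real (gauss_ser (-1/2) $ (m - i))) / sqrt (2 * pi)"
    unfolding Suc volterra_Suc norm_mult norm_divide norm_minus_cancel norm_power norm_of_nat norm_of_real by simp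
  also have "\<dots> \<le> r ^ Suc m / real (Suc m) * (K * majorant k (\<beta> + 1) m) / sqrt (2 * pi)"
    by (intro divide_right_mono mult_mono S power_mono rho) (use r0 in auto)
  also have "\<dots> \<le> K * (r ^ Suc k / (real (Suc k) * sqrt (2 * pi))) * majorant (Suc k) \<beta> n"
  proof (cases "m < k")
    case True then show ?thesis by (simp add: majorant_def Suc)
  next
    case False
    have eigenfun_re: "0 \<le> gauss_ser (\<beta> / 2) $ (m - k)" using b by (intro gauss_ser_nonneg) auto
    have "r ^ Suc m = r ^ Suc k * r ^ (m - k)" using False by (simp flip: power_add)
    then have "r ^ Suc m * gauss_ser ((\<beta> + 1) / 2) $ (m - k) = r ^ Suc k * gauss_ser (r\<^sup>2 * ((\<beta> + 1) / 2)) $ (m - k)"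
      by (simp only: mult.assoc gauss_ser_scale)
    also have "\<dots> \<le> r ^ Suc k * gauss_ser (\<beta> / 2) $ (m - k)"
      using b r0 by (intro mult_left_mono gauss_ser_mono) (auto simp: algebra_simps)
    finally have "r ^ Suc m * gauss_ser ((\<beta> + 1) / 2) $ (m - k) * (K / sqrt (2 * pi)) / real (Suc m)
        \<le> r ^ Suc k * gauss_ser (\<beta> / 2) $ (m - k) * (K / sqrt (2 * pi)) / real (Suc m)"
      using K by (intro divide_right_mono mult_right_mono) auto
    also have "\<dots> \<le> r ^ Suc k * gauss_ser (\<beta> / 2) $ (m - k) * (K / sqrt (2 * pi)) / real (Suc k)"
      using False K r0 eigenfun_re by (intro divide_left_mono) auto
    finally show ?thesis using False by (simp add: majorant_def Suc mult_ac del: of_nat_Suc power_Suc)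
  qed
  finally show ?thesis .
qed (simp add: majorant_def)

definition majorant_const :: "real \<Rightarrow> nat \<Rightarrow> real" where
  "majorant_const r k = r ^ (\<Sum>{..k}) / (fact k * sqrt (2 * pi) ^ k)"

lemma volterra_pow_majorant:
  assumes rho: "cmod \<rho> \<le> r" and b: "0 \<le> \<beta>" "r\<^sup>2 * (1 + \<beta>) \<le> \<beta>"
  shows "cmod ((volterra \<rho> ^^ k) one_co n) \<le> majorant_const r k * majorant k \<beta> n"
proof (induction k arbitrary: n)
  case 0
  show ?case using gauss_ser_nonneg[of "\<beta> / 2" n] b by (auto simp: one_co_def majorant_def majorant_const_def gauss_ser_0)
next
  case (Suc k)
  have r0: "0 \<le> r" using rho norm_ge_zero order_trans by blast
  have "cmod (volterra \<rho> ((volterra \<rho> ^^ k) one_co) n) \<le> majorant_const r k * (r ^ Suc k / (real (Suc k) * sqrt (2 * pi))) * majorant (Suc k) \<beta> n"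
    by (rule volterra_majorant[OF Suc _ rho b]) (use r0 in \<open>simp add: majorant_const_def\<close>)
  also have "majorant_const r k * (r ^ Suc k / (real (Suc k) * sqrt (2 * pi))) = majorant_const r (Suc k)"
    by (simp add: majorant_const_def power_add mult_ac)
  finally show ?case by simp
qed

text \<open>The integral \<open>\<integral>\<^bsub>0\<^esub>\<^bsup>\<infinity>\<^esup> x\<^sup>k
  exp (\<beta> x\<^sup>2/2) \<phi>(x) dx\<close>, as an instance of the binomial series.\<close>

lemma majorant_half_moment_sums:
  assumes b: "0 \<le> \<beta>" "\<beta> < 1"
  shows "(\<lambda>n. majorant k \<beta> n * half_moment n) sums (half_moment k * (1 - \<beta>) powr (- (real (k + 1) / 2)))"
proof -
  let ?a = "real (k + 1) / 2"
  have "(\<lambda>i. ((- ?a) gchoose i) * (- \<beta>) ^ i) sums (1 + (- \<beta>)) powr (- ?a)"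
    using b by (intro gen_binomial_real) auto
  also have "(\<lambda>i. ((- ?a) gchoose i) * (- \<beta>) ^ i) = (\<lambda>i. \<beta> ^ i * pochhammer ?a i / fact i)"
  proof
    fix i
    have "(- 1) ^ i * (- \<beta>) ^ i = \<beta> ^ i" by (simp flip: power_mult_distrib)
    then show "((- ?a) gchoose i) * (- \<beta>) ^ i = \<beta> ^ i * pochhammer ?a i / fact i"
      unfolding gbinomial_pochhammer minus_minus by (metis mult.assoc mult.commute times_divide_eq_left)
  qed
  finally have "(\<lambda>i. half_moment k * (\<beta> ^ i * pochhammer ?a i / fact i)) sums (half_moment k * (1 - \<beta>) powr (- ?a))"
    by (intro sums_mult) simp
  also have "(\<lambda>i. half_moment k * (\<beta> ^ i * pochhammer ?a i / fact i)) = (\<lambda>i. majorant k \<beta> (k + 2 * i) * half_moment (k + 2 * i))"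
    unfolding half_moment_pochhammer by (simp add: majorant_def gauss_ser_def power_divide fun_eq_iff)
  also have "(\<dots> sums (half_moment k * (1 - \<beta>) powr (- ?a))) \<longleftrightarrow> ?thesis"
  proof (rule sums_mono_reindex[of "\<lambda>i. k + 2 * i"])
    fix n :: nat assume n: "n \<notin> range (\<lambda>i. k + 2 * i)"
    show "majorant k \<beta> n * half_moment n = 0"
    proof (cases "n < k \<or> odd (n - k)")
      case False
      then obtain i where "n - k = 2 * i" by blast
      then have "n = k + 2 * i" using False by linarith
      then show ?thesis using n by blast
    qed (auto simp: majorant_def gauss_ser_def)
  qed (simp add: strict_mono_def)
  finally show ?thesis .
qed

text \<open>The number \<open>\<ell>(A\<^sup>k 1)\<close>, with the functional written as a sum
  over Taylor coefficients so that it makes sense for complex \<open>\<rho>\<close>.\<close>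

definition char_coeff :: "nat \<Rightarrow> complex \<Rightarrow> complex" where
  "char_coeff k \<rho> = (\<Sum>n. (volterra \<rho> ^^ k) one_co n * of_real (half_moment n))"

definition char_bound :: "real \<Rightarrow> real \<Rightarrow> nat \<Rightarrow> real" where
  "char_bound r \<beta> k = majorant_const r k * (half_moment k * (1 - \<beta>) powr (- (real (k + 1) / 2)))"

lemma char_coeff_term_bound:
  assumes "cmod \<rho> \<le> r" "0 \<le> \<beta>" "r\<^sup>2 * (1 + \<beta>) \<le> \<beta>"
  shows "cmod ((volterra \<rho> ^^ k) one_co n * of_real (half_moment n)) \<le> majorant_const r k * (majorant k \<beta> n * half_moment n)"
  using mult_right_mono[OF volterra_pow_majorant[OF assms, of k n] half_moment_nonneg[of n]]
  by (simp add: norm_mult half_moment_nonneg mult.assoc)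

lemma char_coeff_bound:
  assumes "cmod \<rho> \<le> r" "0 \<le> \<beta>" "r\<^sup>2 * (1 + \<beta>) \<le> \<beta>" "\<beta> < 1"
  shows "cmod (char_coeff k \<rho>) \<le> char_bound r \<beta> k"
proof -
  have s: "(\<lambda>n. majorant_const r k * (majorant k \<beta> n * half_moment n)) sums char_bound r \<beta> k"
    unfolding char_bound_def by (intro sums_mult majorant_half_moment_sums assms)
  have "cmod (char_coeff k \<rho>) \<le> (\<Sum>n. majorant_const r k * (majorant k \<beta> n * half_moment n))"
    unfolding char_coeff_def by (intro norm_suminf_le char_coeff_term_bound[OF assms(1-3)] sums_summable[OF s])
  then show ?thesis using s by (simp add: sums_iff)
qed

lemma char_coeff_0: "char_coeff 0 \<rho> = 1/2"
proof -
  have "(\<lambda>n. (volterra \<rho> ^^ 0) one_co n * of_real (half_moment n)) sums (\<Sum>n\<in>{0}. (volterra \<rho> ^^ 0) one_co n * of_real (half_moment n))"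
    by (rule sums_finite) (auto simp: one_co_def)
  then show ?thesis by (simp add: char_coeff_def sums_iff one_co_def half_moment_0)
qed

lemma holomorphic_M_test:
  fixes f :: "nat \<Rightarrow> complex \<Rightarrow> complex"
  assumes S: "open S" and f: "\<And>n. f n holomorphic_on S" and M: "\<And>n z. z \<in> S \<Longrightarrow> cmod (f n z) \<le> M n" "summable M"
  shows "(\<lambda>z. \<Sum>n. f n z) holomorphic_on S"
proof (rule holomorphic_uniform_sequence[OF S])
  show "(\<lambda>z. \<Sum>i<n. f i z) holomorphic_on S" for n by (intro holomorphic_intros f)
  have u: "uniform_limit S (\<lambda>n z. \<Sum>i<n. f i z) (\<lambda>z. \<Sum>n. f n z) sequentially"
    by (rule Weierstrass_m_test[OF M])
  fix x assume "x \<in> S"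
  then obtain d where d: "d > 0" "cball x d \<subseteq> S" using S open_contains_cball by blast
  then show "\<exists>d. 0 < d \<and> cball x d \<subseteq> S \<and> uniform_limit (cball x d) (\<lambda>n z. \<Sum>i<n. f i z) (\<lambda>z. \<Sum>n. f n z) sequentially"
    using uniform_limit_on_subset[OF u] by blast
qed

lemma volterra_holomorphic:
  assumes "\<And>n. (\<lambda>\<rho>. c \<rho> n) holomorphic_on S"
  shows "(\<lambda>\<rho>. volterra \<rho> (c \<rho>) n) holomorphic_on S"
proof (cases n)
  case (Suc m)
  have "sqrt (2 * pi) \<noteq> 0" by simp
  then show ?thesis unfolding Suc volterra_Suc by (intro holomorphic_intros assms) (auto simp del: of_nat_Suc)
qed simp

lemma char_coeff_holomorphic:
  assumes "0 \<le> \<beta>" "r\<^sup>2 * (1 + \<beta>) \<le> \<beta>" "\<beta> < 1"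
  shows "char_coeff k holomorphic_on ball 0 r"
proof -
  have "(\<lambda>\<rho>. (volterra \<rho> ^^ k) one_co n) holomorphic_on ball 0 r" for n
  proof (induction k arbitrary: n)
    case (Suc k)
    then show ?case using volterra_holomorphic[of "\<lambda>\<rho>. (volterra \<rho> ^^ k) one_co"] by simp
  qed simp
  then have "(\<lambda>\<rho>. \<Sum>n. (volterra \<rho> ^^ k) one_co n * of_real (half_moment n)) holomorphic_on ball 0 r"
    by (intro holomorphic_M_test[where M = "\<lambda>n. majorant_const r k * (majorant k \<beta> n * half_moment n)"] char_coeff_term_bound
        summable_mult sums_summable[OF majorant_half_moment_sums] holomorphic_intros assms) auto
  then show ?thesis unfolding char_coeff_def[abs_def] .
qed

text \<open>The first coefficient is \<open>arctan \<rho> / (2\<pi>)\<close>. It dominates all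
  others, and the general majorant would be too crude for it; here its series is bounded by that
  of \<open>artanh r\<close>.\<close>

lemma char_coeff_1_le:
  assumes rho: "cmod \<rho> \<le> r" and r: "r < 1"
  shows "cmod (char_coeff 1 \<rho>) \<le> (r + r ^ 3 / 3 + r ^ 5 / 5 / (1 - r\<^sup>2)) / (2 * pi)"
proof -
  have r0: "0 \<le> r" using rho norm_ge_zero order_trans by blast
  have r2: "r\<^sup>2 < 1" using r r0 by (simp add: power_less_one_iff abs_square_less_1)
  define t where "t = (\<lambda>j. r ^ (2 * j + 1) / real (2 * j + 1) / (2 * pi))"
  define g where "g = (\<lambda>n. if odd n then r ^ n / real n / (2 * pi) else 0)"
  have bound: "cmod (volterra \<rho> one_co n * of_real (half_moment n)) \<le> g n" for n
  proof (cases "even n")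
    case True
    then have "volterra \<rho> one_co n = 0"
    proof (cases n)
      case (Suc m)
      have "(\<Sum>i\<le>m. one_co i * of_real (gauss_ser (-1/2) $ (m - i))) = of_real (gauss_ser (-1/2) $ m)"
        by (subst sum.remove[of _ 0]) (auto simp: one_co_def)
      then show ?thesis using True Suc by (simp add: volterra_Suc gauss_ser_def)
    qed simp
    then show ?thesis using True by (simp add: g_def)
  next
    case False
    then obtain j where j: "n = 2 * j + 1" by (metis oddE)
    have "(\<Sum>i\<le>2 * j. one_co i * of_real (gauss_ser (-1/2) $ (2 * j - i))) = of_real (gauss_ser (-1/2) $ (2 * j))"
      by (subst sum.remove[of _ 0]) (auto simp: one_co_def)
    then have "cmod (volterra \<rho> one_co n) = cmod \<rho> ^ n / real n * (1 / (2 ^ j * fact j)) / sqrt (2 * pi)"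
      unfolding j Suc_eq_plus1[symmetric] volterra_Suc
      by (simp add: norm_mult norm_divide norm_power gauss_ser_def power_divide power_abs del: of_nat_Suc power_Suc)
    moreover have "half_moment n = 2 ^ j * fact j * (1 / sqrt (2 * pi))"
      unfolding j half_moment_odd half_sqrt_2_pi[symmetric] by simp
    moreover have "cmod (volterra \<rho> one_co n * of_real (half_moment n)) = cmod (volterra \<rho> one_co n) * half_moment n"
      by (simp only: norm_mult norm_of_real abs_of_nonneg[OF half_moment_nonneg])
    ultimately have "cmod (volterra \<rho> one_co n * of_real (half_moment n)) = cmod \<rho> ^ n / real n / (sqrt (2 * pi) * sqrt (2 * pi))"
      by simp
    also have "\<dots> = cmod \<rho> ^ n / real n / (2 * pi)" by simp
    also have "\<dots> \<le> r ^ n / real n / (2 * pi)" by (intro divide_right_mono power_mono rho) auto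
    finally show ?thesis using False by (simp add: g_def)
  qed
  have tb2: "t (j + 2) \<le> r ^ 5 / 5 / (2 * pi) * (r\<^sup>2) ^ j" for j
  proof -
    have "t (j + 2) = r ^ 5 * (r\<^sup>2) ^ j / real (2 * (j + 2) + 1) / (2 * pi)"
    proof -
      have "2 * (j + 2) + 1 = 5 + 2 * j" by simp
      then show ?thesis unfolding t_def by (simp only: power_add power_mult)
    qed
    also have "\<dots> \<le> r ^ 5 * (r\<^sup>2) ^ j / 5 / (2 * pi)"
      using r0 by (intro divide_right_mono divide_left_mono) auto
    finally show ?thesis by simp
  qed
  have gs: "(\<lambda>j. r ^ 5 / 5 / (2 * pi) * (r\<^sup>2) ^ j) sums (r ^ 5 / 5 / (2 * pi) * (1 / (1 - r\<^sup>2)))"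
    using r2 by (intro sums_mult geometric_sums) simp
  have st2: "summable (\<lambda>j. t (j + 2))"
    by (rule summable_comparison_test'[OF sums_summable[OF gs], of 0]) (use tb2 r0 in \<open>auto simp: t_def\<close>)
  then have st: "summable t" by (subst (asm) summable_iff_shift)
  have "(\<Sum>j. t j) = (\<Sum>j. t (j + 2)) + (\<Sum>j<2. t j)" by (rule suminf_split_initial_segment[OF st])
  also have "\<dots> \<le> r ^ 5 / 5 / (2 * pi) * (1 / (1 - r\<^sup>2)) + (\<Sum>j<2. t j)"
    using suminf_le[OF tb2 st2 sums_summable[OF gs]] gs by (simp add: sums_iff)
  also have "\<dots> = (r + r ^ 3 / 3 + r ^ 5 / 5 / (1 - r\<^sup>2)) / (2 * pi)"
    by (simp add: t_def numeral_2_eq_2 eval_nat_numeral add_divide_distrib mult_ac)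
  finally have tle: "(\<Sum>j. t j) \<le> (r + r ^ 3 / 3 + r ^ 5 / 5 / (1 - r\<^sup>2)) / (2 * pi)" .
  have "(\<lambda>j. g (2 * j + 1)) sums (\<Sum>j. t j) \<longleftrightarrow> g sums (\<Sum>j. t j)"
  proof (rule sums_mono_reindex)
    fix n :: nat assume "n \<notin> range (\<lambda>j. 2 * j + 1)"
    then have "even n" by (metis oddE rangeI)
    then show "g n = 0" by (simp add: g_def)
  qed (simp add: strict_mono_def)
  moreover have "(\<lambda>j. g (2 * j + 1)) = t" by (simp add: g_def t_def fun_eq_iff)
  ultimately have gsum: "g sums (\<Sum>j. t j)" using summable_sums[OF st] by simp
  have "cmod (char_coeff 1 \<rho>) \<le> (\<Sum>n. g n)"
    unfolding char_coeff_def by (rule norm_suminf_le) (use bound sums_summable[OF gsum] in auto)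
  then show ?thesis using gsum tle by (simp add: sums_iff)
qed

text \<open>Term by term integration is legitimate because the half moments are at most
  \<open>sqrt n!\<close> and \<open>\<sigma> < 1\<close>.\<close>

lemma (in ma1) half_mean_sums:
  assumes c: "tbound \<sigma> C c"
  shows "(\<lambda>n. c n * of_real (half_moment n)) sums half_mean (tfun c)"
proof -
  let ?f = "\<lambda>n x. c n * of_real (indicator {0..} x *\<^sub>R (x ^ n * std_normal_density x))"
  have i0: "integrable lborel (\<lambda>x. indicator {0..} x *\<^sub>R (x ^ n * std_normal_density x))" for n :: nat
    using integrable_std_normal_moment[of n] by (intro integrable_mult_indicator) (auto simp: mult.commute)
  have int: "integrable lborel (?f n)" for n
    by (intro integrable_mult_right integrable_of_real i0)
  have cn: "cmod (c n) * half_moment n \<le> C * sqrt \<sigma> ^ n" for n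
  proof -
    have "cmod (c n) * half_moment n \<le> C * wt \<sigma> n * sqrt (fact n)"
      using tbound_D[OF c, of n] tbound_nonneg[OF c] sig(1) by (intro mult_mono half_moment_le_sqrt_fact half_moment_nonneg mult_nonneg_nonneg wt_nonneg)
    then show ?thesis by (simp add: wt_def real_sqrt_divide real_sqrt_power)
  qed
  have s1: "\<sigma> < 1" using sig(2) q by (smt (verit) divide_less_eq_1_pos)
  have nrm: "(\<integral>x. norm (?f n x) \<partial>lborel) = cmod (c n) * half_moment n" for n
  proof -
    have "norm (?f n x) = cmod (c n) * (indicator {0..} x *\<^sub>R (x ^ n * std_normal_density x))" for x
      by (auto simp: norm_mult norm_power indicator_def)
    then show ?thesis by (simp add: half_moment_def gint_def set_lebesgue_integral_def)
  qed
  have sn: "summable (\<lambda>n. \<integral>x. norm (?f n x) \<partial>lborel)"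
    unfolding nrm
  proof (rule summable_comparison_test'[of _ 0])
    show "summable (\<lambda>n. C * sqrt \<sigma> ^ n)" using s1 sig(1) by (intro summable_mult summable_geometric) simp
    show "norm (cmod (c n) * half_moment n) \<le> C * sqrt \<sigma> ^ n" for n using cn[of n] half_moment_nonneg[of n] by simp
  qed
  have eq: "?f n x = indicator {0..} x *\<^sub>R ((c n * of_real (x ^ n)) * of_real (std_normal_density x))" for n x
    by (simp add: scaleR_conv_of_real)
  have AE: "AE x in lborel. summable (\<lambda>n. norm (?f n x))"
  proof (rule AE_I2)
    fix x
    have e: "norm (?f n x) = cmod (c n * of_real (x ^ n)) * norm (indicator {0..} x * std_normal_density x)" for n
      by (simp add: norm_mult abs_mult)
    show "summable (\<lambda>n. norm (?f n x))" unfolding e by (intro summable_mult2 tfun_summable[OF c sig(1)])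
  qed
  have sumf: "(\<Sum>n. ?f n x) = indicator {0..} x *\<^sub>R (tfun c x * of_real (std_normal_density x))" for x
  proof -
    have "(\<lambda>n. indicator {0..} x *\<^sub>R ((c n * of_real (x ^ n)) * of_real (std_normal_density x))) sums
        (indicator {0..} x *\<^sub>R (tfun c x * of_real (std_normal_density x)))"
      by (intro sums_scaleR_right sums_mult2 tfun_sums[OF c sig(1)])
    then show ?thesis unfolding eq by (simp add: sums_iff)
  qed
  have fi: "integral\<^sup>L lborel (?f n) = c n * of_real (half_moment n)" for n
    by (simp only: integral_mult_right_zero integral_complex_of_real half_moment_def gint_def set_lebesgue_integral_def)
  show ?thesis
    using sums_integral[OF int AE sn] unfolding fi sumf by (simp only: half_mean_def set_lebesgue_integral_def)
qed

lemma (in ma1) neumann_ser_half_mean: "neumann_ser (\<lambda>c. half_mean (tfun c)) $ k = char_coeff k (of_real \<rho>)"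
  using half_mean_sums[OF Apow_tbound[OF tbound_one[OF sig(1)], of k]] by (simp add: neumann_ser_def char_coeff_def sums_iff)

lemma (in ma1) char_ser_series:
  "(\<lambda>k. char_coeff k (of_real \<rho>) * w ^ k) sums half_mean (tfun (neumann \<rho> w one_co))"
  using sums_eval_fps[of w "neumann_ser (\<lambda>c. half_mean (tfun c))"]
  unfolding neumann_ser_eval[OF bdd_fun_half_mean] neumann_ser_half_mean by (simp add: neumann_ser_radius[OF bdd_fun_half_mean])

section \<open>Holomorphic dependence of a fixed point on a parameter\<close>

lemma inverse_power_diff:
  fixes x y :: complex
  assumes "0 < l" "l \<le> cmod x" "l \<le> cmod y"
  shows "cmod (inverse x ^ m - inverse y ^ m) \<le> real m / l ^ (m + 1) * cmod (x - y)"
proof -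
  define X Y where "X = of_real l * inverse x" and "Y = of_real l * inverse y"
  have n0: "x \<noteq> 0" "y \<noteq> 0" using assms by auto
  have n1: "cmod X \<le> 1" "cmod Y \<le> 1" using assms n0 by (auto simp: X_def Y_def norm_mult norm_inverse inverse_eq_divide norm_divide)
  have "X - Y = of_real l * (y - x) * inverse x * inverse y" using n0 by (simp add: X_def Y_def field_simps)
  then have "cmod (X - Y) = l * cmod (x - y) * (inverse (cmod x) * inverse (cmod y))"
    using assms by (simp add: norm_mult norm_inverse norm_minus_commute)
  also have "\<dots> \<le> l * cmod (x - y) * (inverse l * inverse l)"
    using assms by (intro mult_left_mono mult_mono le_imp_inverse_le) auto
  also have "\<dots> = cmod (x - y) / l" using assms by (simp add: field_simps)
  finally have XY: "cmod (X - Y) \<le> cmod (x - y) / l" .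
  have "cmod (X ^ m - Y ^ m) \<le> real m * cmod (X - Y)" by (rule norm_power_diff[OF n1])
  also have "\<dots> \<le> real m * (cmod (x - y) / l)" by (intro mult_left_mono XY) auto
  finally have a: "cmod (X ^ m - Y ^ m) \<le> real m * (cmod (x - y) / l)" .
  have "X ^ m - Y ^ m = of_real (l ^ m) * (inverse x ^ m - inverse y ^ m)"
    by (simp add: X_def Y_def power_mult_distrib algebra_simps)
  then have "cmod (X ^ m - Y ^ m) = l ^ m * cmod (inverse x ^ m - inverse y ^ m)"
    using assms by (simp only: norm_mult norm_of_real) simp
  then have "l ^ m * cmod (inverse x ^ m - inverse y ^ m) \<le> real m * (cmod (x - y) / l)" using a by simp
  then show ?thesis using assms by (simp add: field_simps)
qed

text \<open>Picard iteration with values in \<open>|x - a| \<le> a - l\<close>, which implies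
  \<open>|x| \<ge> l\<close>. The iterates are holomorphic in the parameter and converge
  uniformly, so the fixed point is holomorphic.\<close>

lemma holomorphic_fixed_point:
  fixes c :: "nat \<Rightarrow> complex \<Rightarrow> complex" and e :: "nat \<Rightarrow> real" and a l K :: real
  assumes S: "open S" and hol: "\<And>k. c k holomorphic_on S"
    and bound: "\<And>k \<rho>. \<rho> \<in> S \<Longrightarrow> cmod (c k \<rho>) \<le> e k" and e0: "\<And>k. 0 \<le> e k"
    and l: "0 < l"
    and s1: "summable (\<lambda>k. e k / l ^ Suc k)" "(\<Sum>k. e k / l ^ Suc k) \<le> a - l"
    and s2: "summable (\<lambda>k. real (Suc k) * e k / l ^ (k + 2))" "(\<Sum>k. real (Suc k) * e k / l ^ (k + 2)) \<le> K" and K: "K < 1"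
  defines "\<Psi> \<equiv> \<lambda>\<rho> x. of_real a + (\<Sum>k. c k \<rho> * inverse x ^ Suc k)"
  shows "\<And>\<rho> x y. \<rho> \<in> S \<Longrightarrow> l \<le> cmod x \<Longrightarrow> l \<le> cmod y \<Longrightarrow> cmod (\<Psi> \<rho> x - \<Psi> \<rho> y) \<le> K * cmod (x - y)"
    and "\<exists>\<Lambda>. \<Lambda> holomorphic_on S \<and> (\<forall>\<rho>\<in>S. l \<le> cmod (\<Lambda> \<rho>) \<and> \<Psi> \<rho> (\<Lambda> \<rho>) = \<Lambda> \<rho>)"
proof -
  have tbound: "cmod (c k \<rho> * inverse x ^ Suc k) \<le> e k / l ^ Suc k" if "\<rho> \<in> S" "l \<le> cmod x" for k \<rho> x
  proof -
    have "cmod (inverse x ^ Suc k) \<le> inverse l ^ Suc k"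
      unfolding norm_power norm_inverse using l that by (intro power_mono le_imp_inverse_le) auto
    then have "cmod (c k \<rho>) * cmod (inverse x ^ Suc k) \<le> e k * inverse l ^ Suc k"
      using bound[OF that(1), of k] e0[of k] by (intro mult_mono) auto
    then show ?thesis by (simp only: norm_mult divide_inverse power_inverse)
  qed
  have sm: "summable (\<lambda>k. c k \<rho> * inverse x ^ Suc k)" if "\<rho> \<in> S" "l \<le> cmod x" for \<rho> x
    by (rule summable_comparison_test'[OF s1(1), of 0]) (use tbound[OF that] in auto)
  show contr: "cmod (\<Psi> \<rho> x - \<Psi> \<rho> y) \<le> K * cmod (x - y)" if "\<rho> \<in> S" "l \<le> cmod x" "l \<le> cmod y" for \<rho> x y
  proof -
    have "\<Psi> \<rho> x - \<Psi> \<rho> y = (\<Sum>k. c k \<rho> * inverse x ^ Suc k - c k \<rho> * inverse y ^ Suc k)"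
      unfolding \<Psi>_def using suminf_diff[OF sm[OF that(1,2)] sm[OF that(1,3)]] by simp
    moreover have "cmod (\<Sum>k. c k \<rho> * inverse x ^ Suc k - c k \<rho> * inverse y ^ Suc k)
        \<le> (\<Sum>k. real (Suc k) * e k / l ^ (k + 2) * cmod (x - y))"
    proof (rule norm_suminf_le[OF _ summable_mult2[OF s2(1)]])
      fix k
      have "cmod (c k \<rho> * inverse x ^ Suc k - c k \<rho> * inverse y ^ Suc k) = cmod (c k \<rho>) * cmod (inverse x ^ Suc k - inverse y ^ Suc k)"
        by (simp only: right_diff_distrib[symmetric] norm_mult)
      also have "\<dots> \<le> e k * (real (Suc k) / l ^ (Suc k + 1) * cmod (x - y))"
        by (intro mult_mono bound inverse_power_diff that l e0) auto
      finally show "cmod (c k \<rho> * inverse x ^ Suc k - c k \<rho> * inverse y ^ Suc k) \<le> real (Suc k) * e k / l ^ (k + 2) * cmod (x - y)"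
        by (simp add: mult_ac)
    qed
    moreover have "(\<Sum>k. real (Suc k) * e k / l ^ (k + 2) * cmod (x - y)) \<le> K * cmod (x - y)"
      unfolding suminf_mult2[OF s2(1), symmetric] by (intro mult_right_mono s2(2)) auto
    ultimately show ?thesis by simp
  qed
  have s0: "0 \<le> a - l"
    by (rule order_trans[OF suminf_nonneg[OF s1(1)] s1(2)]) (use e0 l in simp)
  have K0: "0 \<le> K"
    by (rule order_trans[OF suminf_nonneg[OF s2(1)] s2(2)]) (use e0 l in simp)
  have far: "l \<le> cmod x" if "cmod (x - of_real a) \<le> a - l" for x
    using norm_triangle_ineq2[of "of_real a" "of_real a - x"] that s0 l by (simp add: norm_minus_commute)
  have self: "cmod (\<Psi> \<rho> x - of_real a) \<le> a - l" if "\<rho> \<in> S" "l \<le> cmod x" for \<rho> x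
  proof -
    have "cmod (\<Psi> \<rho> x - of_real a) \<le> (\<Sum>k. e k / l ^ Suc k)"
      unfolding \<Psi>_def using norm_suminf_le[OF tbound[OF that] s1(1)] by simp
    then show ?thesis using s1(2) by linarith
  qed
  define L where "L = (\<lambda>j \<rho>. (\<Psi> \<rho> ^^ j) (complex_of_real a))"
  have L0: "L 0 \<rho> = of_real a" and LS: "L (Suc j) \<rho> = \<Psi> \<rho> (L j \<rho>)" for j \<rho> by (simp_all add: L_def)
  have La: "cmod (L j \<rho> - of_real a) \<le> a - l" if "\<rho> \<in> S" for j \<rho>
    by (induction j) (use s0 self[OF that] far in \<open>auto simp: L0 LS\<close>)
  have Ll: "l \<le> cmod (L j \<rho>)" if "\<rho> \<in> S" for j \<rho> by (rule far[OF La[OF that]])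
  have hol_L: "L j holomorphic_on S" for j
  proof (induction j)
    case 0 show ?case unfolding L_def by simp
  next
    case (Suc j)
    have "(\<lambda>\<rho>. \<Sum>k. c k \<rho> * inverse (L j \<rho>) ^ Suc k) holomorphic_on S"
    proof (rule holomorphic_M_test[OF S _ _ s1(1)])
      show "(\<lambda>\<rho>. c k \<rho> * inverse (L j \<rho>) ^ Suc k) holomorphic_on S" for k
        using Ll l by (intro holomorphic_intros hol Suc) (metis norm_zero not_less)
    qed (rule tbound, auto intro: Ll)
    then have "(\<lambda>\<rho>. \<Psi> \<rho> (L j \<rho>)) holomorphic_on S" unfolding \<Psi>_def by (intro holomorphic_intros)
    moreover have "L (Suc j) = (\<lambda>\<rho>. \<Psi> \<rho> (L j \<rho>))" by (rule ext) (rule LS)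
    ultimately show ?case by (simp only:)
  qed
  have diff: "cmod (L (Suc j) \<rho> - L j \<rho>) \<le> (a - l) * K ^ j" if "\<rho> \<in> S" for j \<rho>
  proof (induction j)
    case 0 show ?case using La[OF that, of 1] by (simp add: L0)
  next
    case (Suc j)
    have "cmod (L (Suc (Suc j)) \<rho> - L (Suc j) \<rho>) \<le> K * cmod (L (Suc j) \<rho> - L j \<rho>)"
      unfolding LS[of "Suc j"] LS[of j, of \<rho>] using contr[OF that Ll[OF that, of "Suc j"] Ll[OF that, of j]] by (simp add: LS)
    also have "\<dots> \<le> K * ((a - l) * K ^ j)" by (intro mult_left_mono Suc K0)
    finally show ?case by (simp add: mult_ac)
  qed
  define \<Lambda> where "\<Lambda> = (\<lambda>\<rho>. of_real a + (\<Sum>j. L (Suc j) \<rho> - L j \<rho>))"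
  have gs: "summable (\<lambda>j. (a - l) * K ^ j)" using K K0 by (intro summable_mult summable_geometric) simp
  have hol\<Lambda>: "\<Lambda> holomorphic_on S"
    unfolding \<Lambda>_def
    by (intro holomorphic_intros holomorphic_M_test[OF S _ diff gs] hol_L)
  have lim: "(\<lambda>j. L j \<rho>) \<longlonglongrightarrow> \<Lambda> \<rho>" if "\<rho> \<in> S" for \<rho>
  proof -
    have "summable (\<lambda>j. L (Suc j) \<rho> - L j \<rho>)"
      by (rule summable_comparison_test'[OF gs, of 0]) (rule diff[OF that])
    then have "(\<lambda>n. \<Sum>j<n. L (Suc j) \<rho> - L j \<rho>) \<longlonglongrightarrow> (\<Sum>j. L (Suc j) \<rho> - L j \<rho>)" by (rule summable_LIMSEQ)
    moreover have "(\<Sum>j<n. L (Suc j) \<rho> - L j \<rho>) = L n \<rho> - of_real a" for n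
      by (induction n) (simp_all add: L0)
    ultimately have "(\<lambda>n. L n \<rho> - of_real a) \<longlonglongrightarrow> (\<Sum>j. L (Suc j) \<rho> - L j \<rho>)"
      by (simp only:)
    then have "(\<lambda>n. of_real a + (L n \<rho> - of_real a)) \<longlonglongrightarrow> \<Lambda> \<rho>"
      unfolding \<Lambda>_def by (intro tendsto_add tendsto_const)
    then show ?thesis by simp
  qed
  show "\<exists>\<Lambda>. \<Lambda> holomorphic_on S \<and> (\<forall>\<rho>\<in>S. l \<le> cmod (\<Lambda> \<rho>) \<and> \<Psi> \<rho> (\<Lambda> \<rho>) = \<Lambda> \<rho>)"
  proof (intro exI conjI ballI)
    show "\<Lambda> holomorphic_on S" by (rule hol\<Lambda>)
    fix \<rho> assume r: "\<rho> \<in> S"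
    show far\<Lambda>: "l \<le> cmod (\<Lambda> \<rho>)"
      by (rule LIMSEQ_le_const[OF tendsto_norm[OF lim[OF r]]]) (use Ll[OF r] in auto)
    have "(\<lambda>j. L (Suc j) \<rho> - \<Psi> \<rho> (\<Lambda> \<rho>)) \<longlonglongrightarrow> 0"
    proof (rule Lim_null_comparison)
      show "\<forall>\<^sub>F j in sequentially. norm (L (Suc j) \<rho> - \<Psi> \<rho> (\<Lambda> \<rho>)) \<le> K * cmod (L j \<rho> - \<Lambda> \<rho>)"
        unfolding LS by (intro always_eventually allI contr r Ll far\<Lambda>)
      have "(\<lambda>j. K * cmod (L j \<rho> - \<Lambda> \<rho>)) \<longlonglongrightarrow> K * cmod (\<Lambda> \<rho> - \<Lambda> \<rho>)"
        by (intro tendsto_intros lim r)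
      then show "(\<lambda>j. K * cmod (L j \<rho> - \<Lambda> \<rho>)) \<longlonglongrightarrow> 0" by simp
    qed
    then have "(\<lambda>j. L (Suc j) \<rho>) \<longlonglongrightarrow> \<Psi> \<rho> (\<Lambda> \<rho>)" by (rule LIM_zero_cancel)
    moreover have "(\<lambda>j. L (Suc j) \<rho>) \<longlonglongrightarrow> \<Lambda> \<rho>" using lim[OF r] by (rule LIMSEQ_Suc)
    ultimately show "\<Psi> \<rho> (\<Lambda> \<rho>) = \<Lambda> \<rho>" by (rule LIMSEQ_unique)
  qed
qed

section \<open>Numerical bounds for the characteristic equation\<close>

text \<open>Bounds for the coefficients \<open>char_coeff (k + 1)\<close> on \<open>|\<rho>| \<le>
  0.3322\<close>. The requirement is that their sum with weights
  \<open>0.27\<^bsup>-k-1\<^esup>\<close> stays below \<open>0.23 = 1/2 - 0.27\<close>; the value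
  \<open>0.27\<close> nearly minimises the sum relative to this target, and the radius
  \<open>0.3322\<close> is close to the largest one for which such a value exists.\<close>

definition num_bound :: "nat \<Rightarrow> real" where
  "num_bound k = (if k = 0 then 0.055 else if k = 1 then 0.001784 else 0.000015 * (1/150) ^ (k - 2))"

lemma num_bound_nonneg: "0 \<le> num_bound k" by (simp add: num_bound_def)

lemma powr_78: "(1 - 1/8) powr (- (real (k + 1) / 2)) = sqrt (8/7) ^ (k + 1)"
proof -
  have "(1 - 1/8 :: real) powr (- (real (k + 1) / 2)) = (8/7) powr (real (k + 1) / 2)"
    by (subst powr_minus) (simp add: powr_divide field_simps)
  also have "\<dots> = ((8/7) powr (1/2)) powr (real (k + 1))" by (simp add: powr_powr)
  also have "\<dots> = sqrt (8/7) ^ (k + 1)" by (subst powr_realpow) (simp_all add: powr_half_sqrt)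
  finally show ?thesis .
qed

lemma sqrt_87: "sqrt (8/7) \<le> 1.0691"
  by (rule real_le_lsqrt) (auto simp: power2_eq_square)

text \<open>The factor \<open>r\<^bsup>1 + ... + k\<^esup>\<close> makes consecutive bounds
  decrease at least by \<open>r\<^sup>4 sqrt (8/7) / sqrt (2\<pi>) < 1/150\<close>.\<close>

lemma char_bound_tail: "char_bound 0.3322 (1/8) (k + 3) \<le> 0.000015 * (1/150) ^ k"
proof -
  define g where "g = sqrt (8/7 :: real)"
  define b where "b = 1 / sqrt (2 * pi)"
  have g: "0 \<le> g" "g \<le> 1.0691" using sqrt_87 by (auto simp: g_def)
  have b: "0 \<le> b" "b \<le> 0.3991" using inv_sqrt_2pi by (auto simp: b_def)
  define h where "h = (\<lambda>k. g * (g * b) ^ (k + 3) * (0.3322::real) ^ (\<Sum>{..k + 3}))"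
  have gb: "g * b \<le> 1.0691 * 0.3991" using g b by (intro mult_mono) auto
  have gb0: "0 \<le> g * b" using g b by simp
  have h0: "0 \<le> h k" for k using g gb0 by (simp add: h_def)
  have hb: "h k \<le> 0.0001125 * (1/150) ^ k"
  proof (induction k)
    case 0
    have "(\<Sum>{..0 + 3 :: nat}) = 6" by (simp add: numeral_3_eq_3)
    then have "h 0 = g * (g * b) ^ 3 * 0.3322 ^ 6" unfolding h_def by (simp only: add_0)
    also have "\<dots> \<le> 1.0691 * (1.0691 * 0.3991) ^ 3 * 0.3322 ^ 6"
      using g gb0 power_mono[OF gb gb0, of 3] by (intro mult_right_mono mult_mono) auto
    also have "\<dots> \<le> 0.0001125" by (simp add: power_divide eval_nat_numeral)
    finally show ?case by simp
  next
    case (Suc k)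
    have "h (Suc k) = h k * (g * b * 0.3322 ^ (k + 4))"
    proof -
      have "Suc k + 3 = Suc (k + 3)" "k + 4 = Suc (k + 3)" by simp_all
      then have "(\<Sum>{..Suc k + 3}) = (\<Sum>{..k + 3}) + (k + 4)" by (simp only: sum.atMost_Suc)
      moreover have "(g * b) ^ (Suc k + 3) = (g * b) ^ (k + 3) * (g * b)" by (simp only: add_Suc power_Suc2)
      ultimately show ?thesis unfolding h_def by (simp only: power_add[of _ "\<Sum>{..k + 3}"] mult_ac)
    qed
    also have "\<dots> \<le> h k * (1.0691 * 0.3991 * 0.3322 ^ 4)"
      by (intro mult_left_mono h0 mult_mono[OF gb] power_decreasing) auto
    also have "\<dots> \<le> h k * (1/150)" by (intro mult_left_mono h0) (simp add: power_divide eval_nat_numeral)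
    finally show ?case using Suc by simp
  qed
  have "char_bound 0.3322 (1/8) (k + 3) = (half_moment (k + 3) / fact (k + 3)) * h k"
  proof -
    have e: "sqrt (8/7 :: real) ^ (k + 3 + 1) = sqrt (8/7) * sqrt (8/7) ^ (k + 3)"
      by (simp only: Suc_eq_plus1[symmetric] power_Suc)
    show ?thesis
      unfolding char_bound_def majorant_const_def powr_78 e h_def g_def b_def by (simp add: power_mult_distrib power_divide mult_ac)
  qed
  also have "\<dots> \<le> 2/15 * (0.0001125 * (1/150) ^ k)"
    by (intro mult_mono half_moment_fact_le hb h0) auto
  finally show ?thesis by simp
qed

lemma char_bound_2: "char_bound 0.3322 (1/8) 2 \<le> 0.001784"
proof -
  have m2: "half_moment 2 = 1/2" using half_moment_rec[of 0] half_moment_0 by (simp add: numeral_2_eq_2)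
  have "char_bound 0.3322 (1/8) 2 = 0.3322 ^ 3 / (2 * (2 * pi)) * (1/2 * sqrt (8/7) ^ 3)"
    unfolding char_bound_def majorant_const_def powr_78 m2 by (simp add: numeral_2_eq_2 eval_nat_numeral)
  also have "\<dots> \<le> 0.3322 ^ 3 / (2 * (2 * 3.1415)) * (1/2 * 1.0691 ^ 3)"
    using pi_approx(1) sqrt_87 by (intro mult_mono divide_left_mono power_mono) auto
  also have "\<dots> \<le> 0.001784" by (simp add: power_divide eval_nat_numeral)
  finally show ?thesis .
qed

lemma char_coeff_Suc_le_num_bound:
  assumes "cmod \<rho> \<le> 0.3322" shows "cmod (char_coeff (Suc k) \<rho>) \<le> num_bound k"
proof -
  (* The majorant exponent \<beta> = 1/8 is just stable for r = 0.3322. *)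
  have b: "(0::real) \<le> 1/8" "0.3322\<^sup>2 * (1 + 1/8) \<le> (1/8::real)" "(1/8::real) < 1" by (auto simp: power2_eq_square)
  consider "k = 0" | "k = 1" | j where "k = j + 2"
    by (metis One_nat_def Suc_1 add_2_eq_Suc' not0_implies_Suc)
  then show ?thesis
  proof cases
    case 1
    have "cmod (char_coeff 1 \<rho>) \<le> (0.3322 + 0.3322 ^ 3 / 3 + 0.3322 ^ 5 / 5 / (1 - 0.3322\<^sup>2)) / (2 * pi)"
      by (rule char_coeff_1_le[OF assms]) simp
    also have "\<dots> \<le> (0.3322 + 0.3322 ^ 3 / 3 + 0.3322 ^ 5 / 5 / (1 - 0.3322\<^sup>2)) / (2 * 3.1415)"
      using pi_approx(1) by (intro divide_left_mono) (auto simp: power_divide eval_nat_numeral)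
    also have "\<dots> \<le> 0.055" by (simp add: power_divide eval_nat_numeral)
    finally show ?thesis using 1 by (simp add: num_bound_def)
  next
    case 2
    have "cmod (char_coeff 2 \<rho>) \<le> 0.001784" using char_coeff_bound[OF assms b, of 2] char_bound_2 by linarith
    then show ?thesis using 2 by (simp add: num_bound_def numeral_2_eq_2)
  next
    case (3 j)
    have "cmod (char_coeff (j + 3) \<rho>) \<le> 0.000015 * (1/150) ^ j" using char_coeff_bound[OF assms b, of "j + 3"] char_bound_tail[of j] by linarith
    moreover have "Suc k = j + 3" using 3 by simp
    moreover have "num_bound k = 0.000015 * (1/150) ^ j" using 3 by (simp add: num_bound_def)
    ultimately show ?thesis by (simp only:)
  qed
qed

lemma num_bound_sum_1: "summable (\<lambda>k. num_bound k / 0.27 ^ Suc k)" "(\<Sum>k. num_bound k / 0.27 ^ Suc k) \<le> 1/2 - 0.27"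
proof -
  have t: "num_bound (k + 2) / 0.27 ^ Suc (k + 2) = 0.000015 / 0.27 ^ 3 * (1 / (150 * 0.27)) ^ k" for k
  proof -
    have "num_bound (k + 2) = 0.000015 * (1/150) ^ k" by (simp add: num_bound_def)
    moreover have "(1/150 :: real) ^ k / 0.27 ^ k = (1 / (150 * 0.27)) ^ k"
      by (subst power_divide[symmetric]) (simp only: divide_divide_eq_left)
    moreover have "Suc (k + 2) = 3 + k" by simp
    ultimately show ?thesis by (simp only: power_add times_divide_times_eq[symmetric])
  qed
  have s: "(\<lambda>k. num_bound (k + 2) / 0.27 ^ Suc (k + 2)) sums (0.000015 / 0.27 ^ 3 * (1 / (1 - 1 / (150 * 0.27))))"
    unfolding t by (intro sums_mult geometric_sums) simp
  then show sm: "summable (\<lambda>k. num_bound k / 0.27 ^ Suc k)"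
    using summable_iff_shift[of "\<lambda>k. num_bound k / 0.27 ^ Suc k" 2] by (simp only: sums_summable)
  have "(\<Sum>k. num_bound k / 0.27 ^ Suc k) = (\<Sum>k. num_bound (k + 2) / 0.27 ^ Suc (k + 2)) + (\<Sum>k<2. num_bound k / 0.27 ^ Suc k)"
    by (rule suminf_split_initial_segment[OF sm])
  also have "\<dots> \<le> 1/2 - 0.27"
    unfolding sums_unique[OF s, symmetric] by (simp add: numeral_2_eq_2 num_bound_def power_divide eval_nat_numeral)
  finally show "(\<Sum>k. num_bound k / 0.27 ^ Suc k) \<le> 1/2 - 0.27" .
qed

lemma num_bound_sum_2: "summable (\<lambda>k. real (Suc k) * num_bound k / 0.27 ^ (k + 2))" "(\<Sum>k. real (Suc k) * num_bound k / 0.27 ^ (k + 2)) \<le> 0.95"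
proof -
  let ?f = "\<lambda>k. real (Suc k) * num_bound k / 0.27 ^ (k + 2)"
  have t: "?f (k + 2) \<le> 3 * 0.000015 / 0.27 ^ 4 * (2 / (150 * 0.27)) ^ k" for k
  proof -
    have "real (k + 3) \<le> 3 * 2 ^ k"
    proof (induction k)
      case (Suc k)
      have "real (Suc k + 3) = real (k + 3) + 1" by simp
      also have "\<dots> \<le> 3 * 2 ^ k + 3 * 2 ^ k" using Suc by (intro add_mono) (auto intro: order_trans[OF _ mult_left_mono[of 1 "2 ^ k" 3]])
      finally show ?case by simp
    qed simp
    then have "real (k + 3) * (0.000015 * (1/150) ^ k / 0.27 ^ (k + 4)) \<le> 3 * 2 ^ k * (0.000015 * (1/150) ^ k / 0.27 ^ (k + 4))"
      by (intro mult_right_mono) auto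
    moreover have "?f (k + 2) = real (k + 3) * (0.000015 * (1/150) ^ k / 0.27 ^ (k + 4))"
    proof -
      have "num_bound (k + 2) = 0.000015 * (1/150) ^ k" by (simp add: num_bound_def)
      moreover have "Suc (k + 2) = k + 3" "k + 2 + 2 = k + 4" by simp_all
      ultimately show ?thesis by (simp only: times_divide_eq_right)
    qed
    moreover have "(3::real) * 2 ^ k * (0.000015 * (1/150) ^ k / 0.27 ^ (k + 4)) = 3 * 0.000015 / 0.27 ^ 4 * (2 / (150 * 0.27)) ^ k"
    proof -
      have "2 ^ k * ((1/150 :: real) ^ k / 0.27 ^ k) = (2 / (150 * 0.27)) ^ k"
        by (simp only: power_mult_distrib[symmetric] power_divide[symmetric] times_divide_eq_right mult_1_right divide_divide_eq_left)
      moreover have "(3::real) * 2 ^ k * (0.000015 * (1/150) ^ k / 0.27 ^ (k + 4)) = 3 * 0.000015 / 0.27 ^ 4 * (2 ^ k * ((1/150) ^ k / 0.27 ^ k))"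
        by (simp add: power_add)
      ultimately show ?thesis by (simp only:)
    qed
    ultimately show ?thesis by simp
  qed
  have s: "(\<lambda>k. 3 * 0.000015 / 0.27 ^ 4 * (2 / (150 * 0.27)) ^ k) sums (3 * 0.000015 / 0.27 ^ 4 * (1 / (1 - 2 / (150 * 0.27))) :: real)"
    by (intro sums_mult geometric_sums) simp
  have s2: "summable (\<lambda>k. ?f (k + 2))"
  proof (rule summable_comparison_test'[OF sums_summable[OF s], of 0])
    fix k
    have "0 \<le> ?f (k + 2)" by (intro divide_nonneg_nonneg mult_nonneg_nonneg num_bound_nonneg) auto
    then show "norm (?f (k + 2)) \<le> 3 * 0.000015 / 0.27 ^ 4 * (2 / (150 * 0.27)) ^ k"
      unfolding real_norm_def using t[of k] by (simp only: abs_of_nonneg)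
  qed
  then show sm: "summable ?f" using summable_iff_shift[of ?f 2] by (simp only:)
  have "(\<Sum>k. ?f k) = (\<Sum>k. ?f (k + 2)) + (\<Sum>k<2. ?f k)"
    by (rule suminf_split_initial_segment[OF sm])
  also have "\<dots> \<le> 3 * 0.000015 / 0.27 ^ 4 * (1 / (1 - 2 / (150 * 0.27))) + (\<Sum>k<2. ?f k)"
    using suminf_le[OF t s2 sums_summable[OF s]] unfolding sums_unique[OF s, symmetric] by (rule add_right_mono)
  also have "\<dots> \<le> 0.95" by (simp add: numeral_2_eq_2 num_bound_def power_divide eval_nat_numeral)
  finally show "(\<Sum>k. ?f k) \<le> 0.95" .
qed

section \<open>The persistence exponent as spectral radius and as power series\<close>

lemma (in ma1) persistence_spectral:
  fixes M :: "'a measure" and \<xi> :: "int \<Rightarrow> 'a \<Rightarrow> real"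
  assumes prob: "prob_space M"
    and indep: "prob_space.indep_vars M (\<lambda>_. borel) \<xi> {-1..}"
    and normal: "\<And>i. i \<ge> -1 \<Longrightarrow> distributed M lborel (\<xi> i) std_normal_density"
  shows "let l = Hq_spectral_radius q (T_op \<rho>) in
          has_persistence_exponent M (MA1 \<rho> \<xi>) l \<and>
          0 < l \<and> l < 1 \<and>
          Hq_eigenvalue q (T_op \<rho>) (complex_of_real l) \<and>
          (\<forall>z. Hq_eigenvalue q (T_op \<rho>) z \<longrightarrow> cmod z \<le> l) \<and>
          (\<exists>f. Hq_eigenfunction q (T_op \<rho>) (complex_of_real l) f \<and> (\<forall>x. f x \<in> \<real>\<^sub>\<ge>\<^sub>0))"
  unfolding spectral_radius_eq Let_def
proof (intro conjI allI impI)
  show "has_persistence_exponent M (MA1 \<rho> \<xi>) (1 / pole)"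
    by (rule persistence_exponent_eq[OF prob indep normal])
  show "0 < 1 / pole" "1 / pole < 1" using pole_gt_1 by auto
  show "Hq_eigenvalue q (T_op \<rho>) (complex_of_real (1 / pole))"
    unfolding Hq_eigenvalue_def using eigenfun_is_eigenfunction by blast
  show "cmod z \<le> 1 / pole" if "Hq_eigenvalue q (T_op \<rho>) z" for z
    using that by (rule eigenvalue_le_inverse_pole)
  show "\<exists>f. Hq_eigenfunction q (T_op \<rho>) (complex_of_real (1 / pole)) f \<and> (\<forall>x. f x \<in> \<real>\<^sub>\<ge>\<^sub>0)"
    using eigenfun_is_eigenfunction eigenfun_nonneg by blast
qed

text \<open>The right hand side of the characteristic equation, multiplied by \<open>1/w\<close>
  and written in terms of \<open>x = 1/w\<close>.\<close>

definition char_map :: "complex \<Rightarrow> complex \<Rightarrow> complex" where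
  "char_map \<rho> x = complex_of_real (1/2) + (\<Sum>k. char_coeff (Suc k) \<rho> * inverse x ^ Suc k)"

lemma char_map_contraction:
  assumes "\<rho> \<in> ball 0 0.3322" "0.27 \<le> cmod x" "0.27 \<le> cmod y"
  shows "cmod (char_map \<rho> x - char_map \<rho> y) \<le> 95/100 * cmod (x - y)"
    and "\<exists>\<Lambda>. \<Lambda> holomorphic_on ball 0 0.3322 \<and>
      (\<forall>\<rho>\<in>ball 0 0.3322. 0.27 \<le> cmod (\<Lambda> \<rho>) \<and> char_map \<rho> (\<Lambda> \<rho>) = \<Lambda> \<rho>)"
proof -
  have hol: "char_coeff (Suc k) holomorphic_on ball 0 0.3322" for k
    by (rule char_coeff_holomorphic[of "1/8"]) (auto simp: power2_eq_square)
  have le: "cmod (char_coeff (Suc k) \<rho>) \<le> num_bound k" if "\<rho> \<in> ball 0 0.3322" for k \<rho>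
    using that by (intro char_coeff_Suc_le_num_bound) simp
  have pos: "(0::real) < 0.27" "(0.95::real) < 1" by simp_all
  note fp = holomorphic_fixed_point[OF open_ball hol le num_bound_nonneg pos(1) num_bound_sum_1 num_bound_sum_2 pos(2)]
  have "cmod (char_map \<rho> x - char_map \<rho> y) \<le> 0.95 * cmod (x - y)"
    unfolding char_map_def by (rule fp(1)[OF _ assms])
  moreover have "(0.95::real) = 95/100" by simp
  ultimately show "cmod (char_map \<rho> x - char_map \<rho> y) \<le> 95/100 * cmod (x - y)" by (simp only:)
  show "\<exists>\<Lambda>. \<Lambda> holomorphic_on ball 0 0.3322 \<and>
      (\<forall>\<rho>\<in>ball 0 0.3322. 0.27 \<le> cmod (\<Lambda> \<rho>) \<and> char_map \<rho> (\<Lambda> \<rho>) = \<Lambda> \<rho>)"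
    using fp(2)[OF asm_rl] unfolding char_map_def by blast
qed

lemma (in ma1) char_map_inverse:
  "char_map (of_real \<rho>) (inverse w) = half_mean (tfun (neumann \<rho> w one_co))"
proof -
  have "(\<lambda>k. char_coeff (Suc k) (of_real \<rho>) * w ^ Suc k) sums
      (half_mean (tfun (neumann \<rho> w one_co)) - char_coeff 0 (of_real \<rho>) * w ^ 0)"
    using char_ser_series[of w] sums_Suc_iff[of "\<lambda>k. char_coeff k (of_real \<rho>) * w ^ k"] by simp
  then show ?thesis unfolding char_map_def inverse_inverse_eq by (simp add: sums_iff char_coeff_0)
qed

text \<open>Both numbers are fixed points. The zero of least modulus of the characteristic series
  belongs to the fixed point of largest modulus, so \<open>1/R\<close> is at least as large as
  \<open>x\<close> and lies in the region where the map contracts.\<close>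

lemma (in ma1) fixed_point_eq_inverse_pole:
  assumes rho: "\<bar>\<rho>\<bar> < 0.3322" and x: "0.27 \<le> cmod x" "char_map (of_real \<rho>) x = x"
  shows "x = of_real (1 / pole)"
proof -
  have rb: "complex_of_real \<rho> \<in> ball 0 0.3322" using rho by simp
  have x0: "x \<noteq> 0" using x by auto
  (* 1 / x is a zero of the characteristic series, and pole is the zero of least modulus. *)
  have "eval_fps char_ser (inverse x) = 0"
    using char_map_inverse[of "inverse x"] x(2) x0 by (simp add: char_ser_eval)
  then have "\<not> cmod (inverse x) < pole" using char_ser_nonzero by blast
  then have "pole \<le> inverse (cmod x)" by (simp add: norm_inverse)
  then have xle: "cmod x \<le> 1 / pole" using pole(1) x0 by (simp add: field_simps)
  (* So 1 / pole lies in the region of contraction as well, and it is a fixed point too. *)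
  have "char_map (of_real \<rho>) (inverse (of_real pole)) = half_mean eigenfun"
    unfolding eigenfun_def by (rule char_map_inverse)
  then have "char_map (of_real \<rho>) (of_real (1 / pole)) = of_real (1 / pole)"
    unfolding half_mean_eigenfun by (simp add: inverse_eq_divide)
  moreover have "0.27 \<le> cmod (complex_of_real (1 / pole))" using x(1) xle pole(1) by (simp add: norm_divide)
  ultimately have "cmod (x - of_real (1 / pole)) \<le> 95/100 * cmod (x - of_real (1 / pole))"
    using char_map_contraction(1)[OF rb x(1), of "of_real (1 / pole)"] x(2) by simp
  then have "cmod (x - of_real (1 / pole)) \<le> 0" by linarith
  then show ?thesis by simp
qed

text \<open>The coefficients are the real parts of the Taylor coefficients of the holomorphic
  fixed point; on real arguments the imaginary parts cancel, because the values are real.\<close>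

lemma persistence_power_series:
  fixes M :: "'a measure" and \<xi> :: "int \<Rightarrow> 'a \<Rightarrow> real"
  assumes prob: "prob_space M"
    and indep: "prob_space.indep_vars M (\<lambda>_. borel) \<xi> {-1..}"
    and normal: "\<And>i. i \<ge> -1 \<Longrightarrow> distributed M lborel (\<xi> i) std_normal_density"
  shows "\<exists>K. \<forall>\<rho>::real. \<bar>\<rho>\<bar> < 0.3322 \<longrightarrow>
    (\<exists>l. has_persistence_exponent M (MA1 \<rho> \<xi>) l \<and> (\<lambda>n. \<rho> ^ n * K n) sums l)"
proof -
  obtain \<Lambda> where \<Lambda>: "\<Lambda> holomorphic_on ball 0 0.3322"
      "\<And>\<rho>. \<rho> \<in> ball 0 0.3322 \<Longrightarrow> 0.27 \<le> cmod (\<Lambda> \<rho>) \<and> char_map \<rho> (\<Lambda> \<rho>) = \<Lambda> \<rho>"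
    using char_map_contraction(2)[of 0 1 1] by auto
  define K where "K = (\<lambda>n. Re ((deriv ^^ n) \<Lambda> 0 / fact n))"
  have "\<exists>l. has_persistence_exponent M (MA1 \<rho> \<xi>) l \<and> (\<lambda>n. \<rho> ^ n * K n) sums l"
    if small: "\<bar>\<rho>\<bar> < 0.3322" for \<rho> :: real
  proof -
    have rb: "complex_of_real \<rho> \<in> ball 0 0.3322" using small by simp
    have "\<rho>\<^sup>2 \<le> 0.3322\<^sup>2" using small by (intro power2_le_iff_abs_le[THEN iffD2]) auto
    (* The persistence exponent is the same for all q; q = 2/5 admits every such \<rho>. *)
    then have "ma1 \<rho> (2/5) 1" by unfold_locales (auto simp: power2_eq_square)
    then interpret ma1 \<rho> "2/5" 1 .
    have xR: "\<Lambda> (of_real \<rho>) = of_real (1 / pole)"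
      using fixed_point_eq_inverse_pole[OF small] \<Lambda>(2)[OF rb] by blast
    have "(\<lambda>n. (deriv ^^ n) \<Lambda> 0 / fact n * (of_real \<rho> - 0) ^ n) sums of_real (1 / pole)"
      using holomorphic_power_series[OF \<Lambda>(1) rb] unfolding xR .
    from sums_Re[OF this]
    moreover have "Re (z * complex_of_real t) = t * Re z" for z t by simp
    ultimately have "(\<lambda>n. \<rho> ^ n * K n) sums (1 / pole)"
      unfolding K_def by (simp only: diff_zero of_real_power[symmetric] Re_complex_of_real)
    then show ?thesis using persistence_exponent_eq[OF prob indep normal] by blast
  qed
  then show ?thesis by blast
qed

theorem theorem2:
  fixes M :: "'a measure" and \<xi> :: "int \<Rightarrow> 'a \<Rightarrow> real" and q :: real
  assumes prob: "prob_space M"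
    and indep: "prob_space.indep_vars M (\<lambda>_. borel) \<xi> {-1..}"
    and normal: "\<And>i. i \<ge> -1 \<Longrightarrow> distributed M lborel (\<xi> i) std_normal_density"
    and q: "0 < q" "q < 1"
  shows "(\<forall>\<rho>::real. - sqrt ((1 - q) / (1 + inverse q)) < \<rho> \<and> \<rho> < sqrt ((1 - q) / (1 + inverse q)) \<longrightarrow>
            (let l = Hq_spectral_radius q (T_op \<rho>) in
              has_persistence_exponent M (MA1 \<rho> \<xi>) l \<and>
              0 < l \<and> l < 1 \<and>
              Hq_eigenvalue q (T_op \<rho>) (complex_of_real l) \<and>
              (\<forall>z. Hq_eigenvalue q (T_op \<rho>) z \<longrightarrow> cmod z \<le> l) \<and>
              (\<exists>f. Hq_eigenfunction q (T_op \<rho>) (complex_of_real l) f \<and>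
                   (\<forall>x. f x \<in> \<real>\<^sub>\<ge>\<^sub>0))))
       \<and> (\<exists>(K :: nat \<Rightarrow> real) (r0 :: real). r0 > 0.332 \<and>
            (\<forall>\<rho>. \<bar>\<rho>\<bar> < r0 \<longrightarrow>
              (\<exists>l. has_persistence_exponent M (MA1 \<rho> \<xi>) l \<and> (\<lambda>n. \<rho> ^ n * K n) sums l)))"
proof (intro conjI allI impI, goal_cases)
  case (1 \<rho>)
  then obtain \<tau> where "ma1 \<rho> q \<tau>" using ma1_exists[OF q] by blast
  then show ?case by (rule ma1.persistence_spectral[OF _ prob indep normal])
next
  case 2
  have "(0.332::real) < 0.3322" by simp
  then show ?case using persistence_power_series[OF prob indep normal] by blast
qed

end
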